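(* Let $\mathbb{D}\in\mathbb{R}^{M\times M}$ satisfy $\mathbb{D}+\mathbb{D}^T\le 0$, let $r\ge 1$ be an integer and let $s\ge 1$. Let $\mathbf{Y}$ be the solution of $\mathbf{Y}'=\mathbb{D}\mathbf{Y}+\mathbf{R}$ in $(0,T)$, $\mathbf{Y}(0)=\mathbf{Y}_0$, and assume that $\mathbf{R}\in[H^s(0,T)]^M$ and $\mathbf{Y}\in[W^{1+s,\infty}(0,T)]^M$. Let $\mathbf{Y}_r\in\mathbf{V}_\tau^r$ be the solution of the continuous time Galerkin method: $\mathbf{Y}_r(0)=\mathbf{Y}_0$ and $\mathbf{Y}_r'=\mathbb{D}\mathcal{P}_{r-1}\mathbf{Y}_r+\mathcal{P}_{r-1}\mathbf{R}$ in $I_n$, $0\le n\le N-1$. Then $$\max_{1\le n\le N}\|(\mathbf{Y}-\mathbf{Y}_r)(t_n)\|_{\mathbb{R}^M}\le CT^{1/2}\frac{\tau^{\min(r+1,s)}}{r^s}\|\mathbb{D}\mathbf{Y}\|_{H^s(0,T)},$$ $$\max_{0\le t\le T}\|(\mathbf{Y}-\mathbf{Y}_r)(t)\|_{\mathbb{R}^M}\le C(1+T^{1/2})\frac{\tau^{\min(r+1,s)}}{r^{s-2}}\left(T^{1/2}\|\mathbf{Y}\|_{W^{s+1,\infty}(0,T)}+\|\mathbf{R}\|_{H^s(0,T)}\right),$$ where the constant $C$ is independent of $\tau,r,\mathbb{D}$ but may depend on $s$.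
   Context: $T>0$; $M\ge 1$; $\mathbb{D}+\mathbb{D}^T\le 0$ means negative semidefinite. $0=t_0<t_1<\cdots<t_N=T$ is a partition, $I_n=(t_n,t_{n+1})$, $\tau_n=t_{n+1}-t_n$, $\tau=\max_{0\le n\le N-1}\tau_n$. $P^m$ is the set of polynomials of degree at most $m$. $\mathbf{V}_\tau^m$ ($m\ge 1$) is the space of continuous functions $\mathbf{v}:[0,T]\to\mathbb{R}^M$ with $\mathbf{v}|_{I_n}\in[P^m]^M$ for all $0\le n\le N-1$. For $m\ge 0$, $\mathcal{P}_m$ is the local $L^2$ projection: on each $I_n$, $\mathcal{P}_m\mathbf{v}\in[P^m]^M$ and $\int_{I_n}(\mathcal{P}_m\mathbf{v},\mathbf{w})\,dt=\int_{I_n}(\mathbf{v},\mathbf{w})\,dt$ for all $\mathbf{w}\in[P^m]^M$. The discrete problem has a unique solution. $H^s$, $W^{s,\infty}$ are the usual Sobolev spaces; the norm of a vector-valued function in $[X]^M$ is written $\|\cdot\|_X$. As usual, the generic constant $C$ does not depend on the data $\mathbf{Y}_0,\mathbf{R}$ or on the solution. *)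

theory Defs
  imports "HOL-Analysis.Analysis" "HOL-Probability.Essential_Supremum"
    "HOL-Computational_Algebra.Polynomial"
begin

section \<open>Weak derivatives on an open interval\<close>

definition test_function :: "real \<Rightarrow> real \<Rightarrow> (real \<Rightarrow> real) \<Rightarrow> bool" where
  "test_function a b \<phi> \<longleftrightarrow>
     (\<forall>k x. (deriv ^^ k) \<phi> differentiable (at x)) \<and>
     (\<exists>c d. a < c \<and> d < b \<and> (\<forall>x. x \<notin> {c..d} \<longrightarrow> \<phi> x = 0))"

definition locally_integrable :: "real \<Rightarrow> real \<Rightarrow> (real \<Rightarrow> real) \<Rightarrow> bool" where
  "locally_integrable a b u \<longleftrightarrow>
     (\<forall>c d. a < c \<longrightarrow> d < b \<longrightarrow> integrable (lebesgue_on {c..d}) u)"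

definition has_weak_deriv ::
    "real \<Rightarrow> real \<Rightarrow> nat \<Rightarrow> (real \<Rightarrow> real) \<Rightarrow> (real \<Rightarrow> real) \<Rightarrow> bool" where
  "has_weak_deriv a b k u g \<longleftrightarrow>
     locally_integrable a b u \<and> locally_integrable a b g \<and>
     (\<forall>\<phi>. test_function a b \<phi> \<longrightarrow>
        (\<integral>x. u x * (deriv ^^ k) \<phi> x \<partial>lebesgue_on {a<..<b}) =
        (- 1) ^ k * (\<integral>x. g x * \<phi> x \<partial>lebesgue_on {a<..<b}))"

text \<open>A representative of the weak derivative, which is unique up to null sets. Everything below
  depends only on its class modulo equality almost everywhere.\<close>

definition weak_deriv :: "real \<Rightarrow> real \<Rightarrow> nat \<Rightarrow> (real \<Rightarrow> real) \<Rightarrow> real \<Rightarrow> real" where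
  "weak_deriv a b k u = (SOME g. has_weak_deriv a b k u g)"


section \<open>Sobolev spaces of real order\<close>

text \<open>For \<open>s \<ge> 0\<close> write \<open>s = k + \<sigma>\<close> with \<open>k = \<lfloor>s\<rfloor>\<close> and \<open>0 \<le> \<sigma> < 1\<close>. If \<open>\<sigma> > 0\<close>, the spaces are the
  Sobolev--Slobodeckij spaces: the \<open>k\<close>-th weak derivative must in addition have a finite Gagliardo
  seminorm (respectively, for exponent \<open>\<infinity>\<close>, a finite Hoelder seminorm) of order \<open>\<sigma>\<close>. The norms are
  meaningful for members of the spaces only: a divergent integral or an infinite essential
  supremum is turned into \<open>0\<close>.\<close>

definition in_L2 :: "real \<Rightarrow> real \<Rightarrow> (real \<Rightarrow> real) \<Rightarrow> bool" where
  "in_L2 a b u \<longleftrightarrow> u \<in> borel_measurable (lebesgue_on {a<..<b}) \<and>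
     integrable (lebesgue_on {a<..<b}) (\<lambda>x. (u x)\<^sup>2)"

text \<open>On the diagonal the quotient is \<open>0 / 0 = 0\<close>; the diagonal is a null set.\<close>

definition gagliardo_quot :: "real \<Rightarrow> (real \<Rightarrow> real) \<Rightarrow> real \<times> real \<Rightarrow> real" where
  "gagliardo_quot \<sigma> u = (\<lambda>(x, y). (u x - u y)\<^sup>2 / \<bar>x - y\<bar> powr (1 + 2 * \<sigma>))"

definition in_Hs :: "real \<Rightarrow> real \<Rightarrow> real \<Rightarrow> (real \<Rightarrow> real) \<Rightarrow> bool" where
  "in_Hs a b s u \<longleftrightarrow>
     (\<forall>j\<le>nat \<lfloor>s\<rfloor>. (\<exists>g. has_weak_deriv a b j u g) \<and> in_L2 a b (weak_deriv a b j u)) \<and>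
     (s \<notin> \<int> \<longrightarrow> integrable (lebesgue_on ({a<..<b} \<times> {a<..<b}))
        (gagliardo_quot (frac s) (weak_deriv a b (nat \<lfloor>s\<rfloor>) u)))"

definition Hs_norm :: "real \<Rightarrow> real \<Rightarrow> real \<Rightarrow> (real \<Rightarrow> real) \<Rightarrow> real" where
  "Hs_norm a b s u = sqrt (
     (\<Sum>j\<le>nat \<lfloor>s\<rfloor>. \<integral>x. (weak_deriv a b j u x)\<^sup>2 \<partial>lebesgue_on {a<..<b}) +
     (if s \<in> \<int> then 0
      else \<integral>z. gagliardo_quot (frac s) (weak_deriv a b (nat \<lfloor>s\<rfloor>) u) z
             \<partial>lebesgue_on ({a<..<b} \<times> {a<..<b})))"

definition Linf_enorm :: "real \<Rightarrow> real \<Rightarrow> (real \<Rightarrow> real) \<Rightarrow> ennreal" where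
  "Linf_enorm a b u = esssup (lebesgue_on {a<..<b}) (\<lambda>x. ennreal \<bar>u x\<bar>)"

definition hoelder_eseminorm :: "real \<Rightarrow> real \<Rightarrow> real \<Rightarrow> (real \<Rightarrow> real) \<Rightarrow> ennreal" where
  "hoelder_eseminorm a b \<sigma> u = esssup (lebesgue_on ({a<..<b} \<times> {a<..<b}))
     (\<lambda>(x, y). ennreal (\<bar>u x - u y\<bar> / \<bar>x - y\<bar> powr \<sigma>))"

definition in_Wsinf :: "real \<Rightarrow> real \<Rightarrow> real \<Rightarrow> (real \<Rightarrow> real) \<Rightarrow> bool" where
  "in_Wsinf a b s u \<longleftrightarrow>
     (\<forall>j\<le>nat \<lfloor>s\<rfloor>. (\<exists>g. has_weak_deriv a b j u g) \<and>
        weak_deriv a b j u \<in> borel_measurable (lebesgue_on {a<..<b}) \<and>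
        Linf_enorm a b (weak_deriv a b j u) < \<infinity>) \<and>
     (s \<notin> \<int> \<longrightarrow> hoelder_eseminorm a b (frac s) (weak_deriv a b (nat \<lfloor>s\<rfloor>) u) < \<infinity>)"

definition Wsinf_norm :: "real \<Rightarrow> real \<Rightarrow> real \<Rightarrow> (real \<Rightarrow> real) \<Rightarrow> real" where
  "Wsinf_norm a b s u =
     (\<Sum>j\<le>nat \<lfloor>s\<rfloor>. enn2real (Linf_enorm a b (weak_deriv a b j u))) +
     (if s \<in> \<int> then 0
      else enn2real (hoelder_eseminorm a b (frac s) (weak_deriv a b (nat \<lfloor>s\<rfloor>) u)))"


section \<open>Vectors, matrices and vector-valued functions\<close>

text \<open>Since the dimension \<open>M\<close> has to be quantified inside a formula, vectors in \<open>\<real>\<^sup>M\<close> are functions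
  on \<open>nat\<close> of which only the components \<open>i < M\<close> matter, and matrices are functions of two indices.
  The Euclidean norm is \<^term>\<open>L2_set v {..<M}\<close>. A vector-valued function \<open>Y\<close> is given by its
  components, \<open>Y i x\<close> being the \<open>i\<close>-th component of \<open>Y(x)\<close>; \<open>[X]\<^sup>M\<close> carries the Euclidean
  product norm.\<close>

definition neg_semidef :: "nat \<Rightarrow> (nat \<Rightarrow> nat \<Rightarrow> real) \<Rightarrow> bool" where
  "neg_semidef M A \<longleftrightarrow> (\<forall>x. (\<Sum>i<M. \<Sum>j<M. x i * A i j * x j) \<le> 0)"

definition mat_vec :: "nat \<Rightarrow> (nat \<Rightarrow> nat \<Rightarrow> real) \<Rightarrow> (nat \<Rightarrow> real \<Rightarrow> real) \<Rightarrow> nat \<Rightarrow> real \<Rightarrow> real" where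
  "mat_vec M D Y = (\<lambda>i x. \<Sum>j<M. D i j * Y j x)"

definition vec_Hs_norm :: "nat \<Rightarrow> real \<Rightarrow> real \<Rightarrow> real \<Rightarrow> (nat \<Rightarrow> real \<Rightarrow> real) \<Rightarrow> real" where
  "vec_Hs_norm M a b s Y = L2_set (\<lambda>i. Hs_norm a b s (Y i)) {..<M}"

definition vec_Wsinf_norm :: "nat \<Rightarrow> real \<Rightarrow> real \<Rightarrow> real \<Rightarrow> (nat \<Rightarrow> real \<Rightarrow> real) \<Rightarrow> real" where
  "vec_Wsinf_norm M a b s Y = L2_set (\<lambda>i. Wsinf_norm a b s (Y i)) {..<M}"


section \<open>The initial value problem and the continuous Galerkin method\<close>

text \<open>The equation \<open>Y' = D Y + R\<close> is understood in the sense of distributions on \<open>(0,T)\<close>, so that it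
  does not depend on the representative of \<open>R\<close>; \<open>Y\<close> is the continuous representative.\<close>

definition ivp_solution :: "real \<Rightarrow> nat \<Rightarrow> (nat \<Rightarrow> nat \<Rightarrow> real) \<Rightarrow> (nat \<Rightarrow> real) \<Rightarrow>
    (nat \<Rightarrow> real \<Rightarrow> real) \<Rightarrow> (nat \<Rightarrow> real \<Rightarrow> real) \<Rightarrow> bool" where
  "ivp_solution T M D Y0 R Y \<longleftrightarrow>
     (\<forall>i<M. continuous_on {0..T} (Y i) \<and> Y i 0 = Y0 i \<and>
        has_weak_deriv 0 T 1 (Y i) (\<lambda>x. mat_vec M D Y i x + R i x))"

definition time_partition :: "real \<Rightarrow> nat \<Rightarrow> (nat \<Rightarrow> real) \<Rightarrow> bool" where
  "time_partition T N t \<longleftrightarrow> t 0 = 0 \<and> t N = T \<and> (\<forall>n<N. t n < t (Suc n))"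

definition max_step :: "nat \<Rightarrow> (nat \<Rightarrow> real) \<Rightarrow> real" where
  "max_step N t = Max ((\<lambda>n. t (Suc n) - t n) ` {..<N})"

definition L2_proj :: "nat \<Rightarrow> real \<Rightarrow> real \<Rightarrow> (real \<Rightarrow> real) \<Rightarrow> real poly" where
  "L2_proj m a b v = (THE p. degree p \<le> m \<and>
     (\<forall>w. degree w \<le> m \<longrightarrow>
        (\<integral>x. poly p x * poly w x \<partial>lebesgue_on {a<..<b}) =
        (\<integral>x. v x * poly w x \<partial>lebesgue_on {a<..<b})))"

definition cont_piecewise_poly ::
    "real \<Rightarrow> nat \<Rightarrow> (nat \<Rightarrow> real) \<Rightarrow> nat \<Rightarrow> (real \<Rightarrow> real) \<Rightarrow> bool" where
  "cont_piecewise_poly T N t m v \<longleftrightarrow> continuous_on {0..T} v \<and>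
     (\<forall>n<N. \<exists>p. degree p \<le> m \<and> (\<forall>x\<in>{t n<..<t (Suc n)}. v x = poly p x))"

definition cg_solution :: "real \<Rightarrow> nat \<Rightarrow> (nat \<Rightarrow> real) \<Rightarrow> nat \<Rightarrow> nat \<Rightarrow> (nat \<Rightarrow> nat \<Rightarrow> real) \<Rightarrow>
    (nat \<Rightarrow> real) \<Rightarrow> (nat \<Rightarrow> real \<Rightarrow> real) \<Rightarrow> (nat \<Rightarrow> real \<Rightarrow> real) \<Rightarrow> bool" where
  "cg_solution T N t r M D Y0 R Yr \<longleftrightarrow>
     (\<forall>i<M. cont_piecewise_poly T N t r (Yr i) \<and> Yr i 0 = Y0 i) \<and>
     (\<forall>n<N. \<forall>x\<in>{t n<..<t (Suc n)}. \<forall>i<M.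
        (Yr i has_real_derivative
           (mat_vec M D (\<lambda>j. poly (L2_proj (r - 1) (t n) (t (Suc n)) (Yr j))) i x +
            poly (L2_proj (r - 1) (t n) (t (Suc n)) (R i)) x)) (at x))"

end

theory Submission
  imports Defs
begin

text \<open>On each interval let \<open>\<Pi> Y\<close> be the polynomial with \<open>(\<Pi> Y)' = P\<^sub>r\<^sub>-\<^sub>1 Y'\<close> that agrees with \<open>Y\<close> at the
  left (hence at both) end points. Then \<open>\<theta> = \<Pi> Y - Y\<^sub>r\<close> satisfies \<open>\<theta>' = D P \<theta> + P (u - \<Pi> u)\<close> with
  \<open>u = D Y\<close>, \<open>P = P\<^sub>r\<^sub>-\<^sub>1\<close>. Testing with \<open>P \<theta>\<close> bounds \<open>\<bar>\<theta>(t\<^sub>n)\<bar>\<^sup>2\<close> by \<open>2 \<parallel>u - \<Pi> u\<parallel> \<parallel>\<theta>\<parallel>\<close>, and testing with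
  \<open>(T - t) P \<theta>\<close> bounds \<open>\<parallel>\<theta>\<parallel>\<close> by \<open>2 T \<parallel>u - \<Pi> u\<parallel>\<close>, both with constants independent of \<open>r\<close> and \<open>D\<close>.
  The error \<open>u - \<Pi> u\<close> is controlled with explicit dependence on \<open>r\<close> through the Sturm--Liouville
  equation of the Legendre polynomials and duality; for fractional \<open>s\<close> the top derivative is split
  into a mollification at scale \<open>h / r\<close> and a remainder. Pointwise bounds between the nodes follow
  from the inverse inequality \<open>\<parallel>p\<parallel>\<^sub>\<infinity> \<le> C r h\<^sup>-\<^sup>1\<^sup>/\<^sup>2 \<parallel>p\<parallel>\<close> and, for \<open>u = Y' - R\<close>, from the two summands
  separately.\<close>

section \<open>Square integrable functions on an interval\<close>

text \<open>The scheme applies \<open>D\<close> to \<open>P \<theta>\<close> only, so testing with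
  \<open>P \<theta>\<close> gives the \<open>D\<close> term a sign: the size of \<open>D\<close>
  never enters and no Gronwall factor appears. Since \<open>\<theta>'\<close> has degree below
  \<open>r\<close>, it does not notice the projection. The energy identity then bounds nodal values
  by the norm of \<open>\<theta>\<close> over (0,T), which nodal values do not control uniformly in
  \<open>r\<close>; the weight T - t has a derivative of one sign and supplies that norm. Nodal
  errors are exactly values of \<open>\<theta>\<close>, because the interpolant agrees with
  \<open>Y\<close> at both ends of every interval. In the second estimate some growth of the
  constant as T tends to 0 is forced: for D = 0, M = r = 1, s = 2, one step and Y = t^2, the error
  is T^2 / 4, while the right-hand side without the constant is of order T^(5/2). The factor 1 + 1 /
  sqrt T has just this growth. Divergent integrals count as 0 in the norms, so the H^s norm of D Y
  is meaningful only once its finiteness is proved; this comes from the additional derivative of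
  \<open>Y\<close>, of order k + 1 with k the integer part of s, which is bounded.\<close>

definition ip :: "real \<Rightarrow> real \<Rightarrow> (real \<Rightarrow> real) \<Rightarrow> (real \<Rightarrow> real) \<Rightarrow> real" where
  "ip a b f g = (\<integral>x. f x * g x \<partial>lebesgue_on {a<..<b})"

definition nrm :: "real \<Rightarrow> real \<Rightarrow> (real \<Rightarrow> real) \<Rightarrow> real" where
  "nrm a b f = sqrt (ip a b f f)"

lemma finite_measure_Ioo: "finite_measure (lebesgue_on {a<..<b::real})"
  by (rule finite_measure_lebesgue_on) (metis box_real(1) lmeasurable_box)

lemma integrable_lebesgue_on_subset:
  fixes f :: "real \<Rightarrow> real"
  assumes "integrable (lebesgue_on S) f" "T \<subseteq> S" "S \<in> sets lebesgue" "T \<in> sets lebesgue"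
  shows "integrable (lebesgue_on T) f"
  using assms set_integrable_subset[of lebesgue S f T]
  by (simp add: integrable_restrict_space set_integrable_def)

lemma measure_Ioo: "a \<le> b \<Longrightarrow> measure (lebesgue_on {a<..<b}) {a<..<b::real} = b - a"
  by (simp add: measure_restrict_space)

lemma in_L2_measurable: "in_L2 a b f \<Longrightarrow> f \<in> borel_measurable (lebesgue_on {a<..<b})"
  by (simp add: in_L2_def)

lemma in_L2_mult:
  assumes "in_L2 a b f" "in_L2 a b g"
  shows "integrable (lebesgue_on {a<..<b}) (\<lambda>x. f x * g x)"
proof (rule Bochner_Integration.integrable_bound)
  show "integrable (lebesgue_on {a<..<b}) (\<lambda>x. (f x)\<^sup>2 + (g x)\<^sup>2)"
    using assms by (auto simp: in_L2_def)
  show "(\<lambda>x. f x * g x) \<in> borel_measurable (lebesgue_on {a<..<b})"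
    using assms by (auto simp: in_L2_def)
  have "\<bar>u * v\<bar> \<le> u\<^sup>2 + v\<^sup>2" for u v :: real
    using sum_squares_bound[of u v] sum_squares_bound[of u "-v"] by (simp add: abs_if) 
  then show "AE x in lebesgue_on {a<..<b}. norm (f x * g x) \<le> norm ((f x)\<^sup>2 + (g x)\<^sup>2)"
    by (intro AE_I2) simp
qed

lemma in_L2_add [intro]:
  assumes "in_L2 a b f" "in_L2 a b g" shows "in_L2 a b (\<lambda>x. f x + g x)"
  using assms in_L2_mult[OF assms]
  by (auto simp: in_L2_def power2_sum mult.assoc)

lemma in_L2_cmult [intro]: "in_L2 a b f \<Longrightarrow> in_L2 a b (\<lambda>x. c * f x)"
  by (auto simp: in_L2_def power_mult_distrib)

lemma in_L2_diff [intro]: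
  assumes "in_L2 a b f" "in_L2 a b g" shows "in_L2 a b (\<lambda>x. f x - g x)"
  using in_L2_add[OF assms(1) in_L2_cmult[OF assms(2), of "-1"]] by simp

lemma in_L2_sum [intro]:
  "(\<And>i. i \<in> A \<Longrightarrow> in_L2 a b (f i)) \<Longrightarrow> in_L2 a b (\<lambda>x. \<Sum>i\<in>A. f i x)"
proof (induction A rule: infinite_finite_induct)
  case (insert i A)
  then show ?case using in_L2_add[of a b "f i" "\<lambda>x. \<Sum>i\<in>A. f i x"] by auto
qed (auto simp: in_L2_def)

lemma in_L2_integrable:
  assumes "in_L2 a b f" shows "integrable (lebesgue_on {a<..<b}) f"
  using finite_measure.square_integrable_imp_integrable[OF finite_measure_Ioo] assms
  unfolding in_L2_def by blast

lemma integrable_continuous_Ioo: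
  fixes f :: "real \<Rightarrow> real"
  assumes "continuous_on {a..b} f" shows "integrable (lebesgue_on {a<..<b}) f"
proof -
  have "integrable (lebesgue_on {a..b}) f" by (rule continuous_imp_integrable_real[OF assms])
  then show ?thesis by (rule integrable_lebesgue_on_subset) auto
qed

lemma in_L2_continuous:
  assumes "continuous_on {a..b} f" shows "in_L2 a b f"
proof -
  have "continuous_on {a..b} (\<lambda>x. (f x)\<^sup>2)" by (intro continuous_intros assms)
  then show ?thesis
    unfolding in_L2_def using integrable_continuous_Ioo assms by blast
qed

lemma in_L2_poly [intro, simp]: "in_L2 a b (poly p)"
  by (intro in_L2_continuous continuous_intros)

lemma in_L2_const [intro, simp]: "in_L2 a b (\<lambda>x. c)"
  by (intro in_L2_continuous continuous_intros)

lemma in_L2_subinterval: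
  assumes "in_L2 a b f" "a \<le> c" "d \<le> b" shows "in_L2 c d f"
proof -
  have "{c<..<d} \<subseteq> {a<..<b}" using assms by auto
  then show ?thesis
    using assms unfolding in_L2_def
    by (auto intro: integrable_lebesgue_on_subset measurable_restrict_mono)
qed

text \<open>Lebesgue measure on the interval is complete, so measurability survives a change on a
  null set. This permits exchanging weak derivatives, which are fixed only up to null sets, for
  convenient representatives.\<close>

lemma in_L2_AE_cong:
  assumes "in_L2 a b f" "AE x in lebesgue_on {a<..<b}. f x = g x"
  shows "in_L2 a b g"
proof -
  interpret complete_measure "lebesgue_on {a<..<b}"
  proof
    fix A B assume "A \<subseteq> B" "B \<in> null_sets (lebesgue_on {a<..<b})"
    moreover have "{a<..<b} \<in> sets lebesgue" by simp
    ultimately have "A \<in> null_sets (lebesgue_on {a<..<b})"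
      using completion.complete2[of A B lborel] by (auto simp: null_sets_restrict_space)
    then show "A \<in> sets (lebesgue_on {a<..<b})" by blast
  qed
  have m: "g \<in> borel_measurable (lebesgue_on {a<..<b})"
  proof (rule measurableI)
    fix A :: "real set" assume A: "A \<in> sets borel"
    have "AE x in lebesgue_on {a<..<b}. x \<in> f -` A \<inter> {a<..<b} \<longleftrightarrow> x \<in> g -` A \<inter> {a<..<b}"
      using assms(2) by eventually_elim auto
    moreover have "f -` A \<inter> {a<..<b} \<in> sets (lebesgue_on {a<..<b})"
      using in_L2_measurable[OF assms(1)] A by (metis measurable_sets space_lebesgue_on)
    ultimately show "g -` A \<inter> space (lebesgue_on {a<..<b}) \<in> sets (lebesgue_on {a<..<b})"
      using in_sets_AE[of "f -` A \<inter> {a<..<b}" "g -` A \<inter> {a<..<b}"] by simp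
  qed auto
  have "integrable (lebesgue_on {a<..<b}) (\<lambda>x. (g x)\<^sup>2) \<longleftrightarrow> integrable (lebesgue_on {a<..<b}) (\<lambda>x. (f x)\<^sup>2)"
    using m assms by (intro integrable_cong_AE) (auto simp: in_L2_def)
  then show ?thesis using m assms by (simp add: in_L2_def)
qed

lemma in_L2_bounded:
  assumes "f \<in> borel_measurable (lebesgue_on {a<..<b})" "AE x in lebesgue_on {a<..<b}. \<bar>f x\<bar> \<le> B"
  shows "in_L2 a b f"
proof -
  have "integrable (lebesgue_on {a<..<b}) (\<lambda>x. (f x)\<^sup>2)"
  proof (rule finite_measure.integrable_const_bound[OF finite_measure_Ioo])
    show "AE x in lebesgue_on {a<..<b}. norm ((f x)\<^sup>2) \<le> B\<^sup>2"
      using assms(2) by eventually_elim (auto simp: abs_le_square_iff[symmetric])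
  qed (use assms in auto)
  then show ?thesis using assms by (simp add: in_L2_def)
qed

lemma ip_cong_AE:
  assumes "in_L2 a b f" "AE x in lebesgue_on {a<..<b}. f x = f' x" "in_L2 a b g"
    "AE x in lebesgue_on {a<..<b}. g x = g' x"
  shows "ip a b f g = ip a b f' g'"
  unfolding ip_def
proof (rule integral_cong_AE)
  show "AE x in lebesgue_on {a<..<b}. f x * g x = f' x * g' x"
    using assms(2,4) by eventually_elim simp
qed (use assms in_L2_AE_cong in_L2_measurable in \<open>blast intro: borel_measurable_times\<close>)+

lemma ip_commute: "ip a b f g = ip a b g f"
  by (simp add: ip_def mult.commute)

lemma ip_add_left:
  "in_L2 a b f \<Longrightarrow> in_L2 a b f' \<Longrightarrow> in_L2 a b g \<Longrightarrow> ip a b (\<lambda>x. f x + f' x) g = ip a b f g + ip a b f' g"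
  by (simp add: ip_def distrib_right in_L2_mult)

lemma ip_diff_left:
  "in_L2 a b f \<Longrightarrow> in_L2 a b f' \<Longrightarrow> in_L2 a b g \<Longrightarrow> ip a b (\<lambda>x. f x - f' x) g = ip a b f g - ip a b f' g"
  by (simp add: ip_def left_diff_distrib in_L2_mult)

lemma ip_cmult_left: "ip a b (\<lambda>x. c * f x) g = c * ip a b f g"
  by (simp add: ip_def mult.assoc)

lemma ip_add_right:
  "in_L2 a b f \<Longrightarrow> in_L2 a b g' \<Longrightarrow> in_L2 a b g \<Longrightarrow> ip a b f (\<lambda>x. g x + g' x) = ip a b f g + ip a b f g'"
  by (simp add: ip_def distrib_left in_L2_mult)

lemma ip_diff_right:
  "in_L2 a b f \<Longrightarrow> in_L2 a b g' \<Longrightarrow> in_L2 a b g \<Longrightarrow> ip a b f (\<lambda>x. g x - g' x) = ip a b f g - ip a b f g'"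
  by (simp add: ip_def right_diff_distrib in_L2_mult)

lemma ip_cmult_right: "ip a b f (\<lambda>x. c * g x) = c * ip a b f g"
  by (simp add: ip_commute[of a b f] ip_cmult_left)

lemma ip_sum_left:
  "(\<And>i. i \<in> A \<Longrightarrow> in_L2 a b (f i)) \<Longrightarrow> in_L2 a b g \<Longrightarrow>
    ip a b (\<lambda>x. \<Sum>i\<in>A. f i x) g = (\<Sum>i\<in>A. ip a b (f i) g)"
  unfolding ip_def by (subst Bochner_Integration.integral_sum[symmetric])
    (auto simp: sum_distrib_right in_L2_mult)

lemma ip_self_nonneg: "0 \<le> ip a b f f"
  by (simp add: ip_def)

lemma nrm_nonneg [simp]: "0 \<le> nrm a b f"
  by (simp add: nrm_def ip_self_nonneg)

lemma nrm_sq: "(nrm a b f)\<^sup>2 = ip a b f f"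
  by (simp add: nrm_def ip_self_nonneg)

lemma nrm_sq_integral: "(nrm a b f)\<^sup>2 = (\<integral>x. (f x)\<^sup>2 \<partial>lebesgue_on {a<..<b})"
  unfolding nrm_sq by (simp add: ip_def power2_eq_square)

lemma ip_Cauchy_Schwarz:
  assumes f: "in_L2 a b f" and g: "in_L2 a b g"
  shows "\<bar>ip a b f g\<bar> \<le> nrm a b f * nrm a b g"
proof -
  define A B C where "A = ip a b f f" and "B = ip a b f g" and "C = ip a b g g"
  have q: "0 \<le> A * y\<^sup>2 - 2 * B * x * y + C * x\<^sup>2" for x y
  proof -
    have 1: "in_L2 a b (\<lambda>t. y * f t)" "in_L2 a b (\<lambda>t. x * g t)" using f g by auto
    have "0 \<le> ip a b (\<lambda>t. y * f t - x * g t) (\<lambda>t. y * f t - x * g t)" by (rule ip_self_nonneg)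
    also have "\<dots> = A * y\<^sup>2 - 2 * B * x * y + C * x\<^sup>2"
      unfolding ip_diff_left[OF 1 in_L2_diff[OF 1]] ip_diff_right[OF 1(1) 1(2) 1(1)] ip_diff_right[OF 1(2) 1(2) 1(1)]
      unfolding ip_cmult_left ip_cmult_right A_def B_def C_def ip_commute[of a b g f]
      by (simp add: power2_eq_square algebra_simps)
    finally show ?thesis .
  qed
  have AC: "0 \<le> A" "0 \<le> C" by (simp_all add: A_def C_def ip_self_nonneg)
  have "B\<^sup>2 \<le> A * C"
  proof (cases "A = 0")
    case True
    have "B = 0"
    proof (rule ccontr)
      assume B: "B \<noteq> 0"
      \<comment> \<open>A function of norm zero need not vanish, hence the degenerate case. With
        \<open>A = 0\<close> the form is affine in \<open>y\<close>, and this \<open>y\<close> gives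
        it the value -1.\<close>
      have "0 \<le> - 2 * B * 1 * ((C+1)/(2*B)) + C * 1\<^sup>2" using q[of "(C+1)/(2*B)" 1] True by simp
      then show False using B by simp
    qed
    then show ?thesis using True by simp
  next
    case False
    have "0 \<le> A * B\<^sup>2 - 2 * B * A * B + C * A\<^sup>2" using q[of B A] by simp
    then have "A * B\<^sup>2 \<le> A * (A * C)" by (simp add: power2_eq_square algebra_simps)
    then show ?thesis using False AC by simp
  qed
  then have "\<bar>B\<bar> \<le> sqrt (A * C)" by (metis real_sqrt_abs real_sqrt_le_iff)
  then show ?thesis by (simp add: nrm_def A_def B_def C_def real_sqrt_mult)
qed

lemma nrm_triangle:
  assumes f: "in_L2 a b f" and g: "in_L2 a b g"
  shows "nrm a b (\<lambda>x. f x + g x) \<le> nrm a b f + nrm a b g"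
proof (rule power2_le_imp_le)
  have "(nrm a b (\<lambda>x. f x + g x))\<^sup>2 = (nrm a b f)\<^sup>2 + 2 * ip a b f g + (nrm a b g)\<^sup>2"
    using f g by (simp add: nrm_sq ip_add_left ip_add_right in_L2_add ip_commute[of a b g f])
  also have "\<dots> \<le> (nrm a b f + nrm a b g)\<^sup>2"
    using ip_Cauchy_Schwarz[OF f g] by (simp add: power2_sum)
  finally show "(nrm a b (\<lambda>x. f x + g x))\<^sup>2 \<le> (nrm a b f + nrm a b g)\<^sup>2" .
qed simp

lemma nrm_cmult: "nrm a b (\<lambda>x. c * f x) = \<bar>c\<bar> * nrm a b f"
  by (simp add: nrm_def ip_cmult_left ip_cmult_right real_sqrt_mult[symmetric] mult.assoc[symmetric])
     (simp add: real_sqrt_mult)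

lemma nrm_diff_triangle:
  assumes f: "in_L2 a b f" and g: "in_L2 a b g"
  shows "nrm a b (\<lambda>x. f x - g x) \<le> nrm a b f + nrm a b g"
  using nrm_triangle[OF f in_L2_cmult[OF g, of "-1"]] nrm_cmult[of a b "-1" g] by simp

section \<open>Splitting integrals along a partition\<close>

lemma integral_Ioo_combine:
  fixes f :: "real \<Rightarrow> real"
  assumes "integrable (lebesgue_on {a<..<c}) f" "a \<le> b" "b \<le> c"
  shows "integral\<^sup>L (lebesgue_on {a<..<c}) f
    = integral\<^sup>L (lebesgue_on {a<..<b}) f + integral\<^sup>L (lebesgue_on {b<..<c}) f"
proof -
  have i: "integrable (lebesgue_on {a<..<b}) f" "integrable (lebesgue_on {b<..<c}) f"
    using assms by (auto intro: integrable_lebesgue_on_subset)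
  have eq: "integral\<^sup>L (lebesgue_on {p<..<q}) f = integral {p..q} f"
    if "integrable (lebesgue_on {p<..<q}) f" for p q
    using lebesgue_integral_eq_integral[OF that] by (simp add: integral_open_interval_real)
  have "f absolutely_integrable_on {a<..<c}" 
    using assms(1) by (simp add: integrable_restrict_space set_integrable_def)
  then have "f integrable_on {a<..<c}" using set_lebesgue_integral_eq_integral(1) by blast
  then have "f integrable_on {a..c}" by (simp add: integrable_on_open_interval_real)
  then have "integral {a..c} f = integral {a..b} f + integral {b..c} f"
    using assms(2,3) by (simp add: Henstock_Kurzweil_Integration.integral_combine)
  then show ?thesis using i assms(1) eq by simp
qed

lemma partition_mono:
  fixes t :: "nat \<Rightarrow> real"
  assumes "\<And>n. n < N \<Longrightarrow> t n \<le> t (Suc n)" "m \<le> n" "n \<le> N"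
  shows "t m \<le> t n"
  using assms(2,3)
proof (induction n)
  case (Suc n)
  then show ?case using assms(1)[of n] by (cases "m = Suc n") auto
qed simp

lemma integral_Ioo_partition:
  fixes f :: "real \<Rightarrow> real"
  assumes "integrable (lebesgue_on {t 0<..<t N}) f" "\<And>n. n < N \<Longrightarrow> t n \<le> t (Suc n)"
  shows "integral\<^sup>L (lebesgue_on {t 0<..<t N}) f = (\<Sum>n<N. integral\<^sup>L (lebesgue_on {t n<..<t (Suc n)}) f)"
  using assms
proof (induction N)
  case 0
  have "lebesgue_on {} = (lebesgue_on {} :: real measure)" ..
  then show ?case by (simp add: Bochner_Integration.integral_empty)
next
  case (Suc N)
  have m: "t 0 \<le> t N" by (rule partition_mono[of N]) (simp_all add: Suc.prems)
  have "integrable (lebesgue_on {t 0<..<t N}) f"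
    by (rule integrable_lebesgue_on_subset[OF Suc.prems(1)]) (use Suc.prems(2)[of N] in auto)
  then show ?case
    using Suc integral_Ioo_combine[OF Suc.prems(1) m] by simp
qed

section \<open>The orthogonal projection onto polynomials\<close>

definition is_proj :: "nat \<Rightarrow> real \<Rightarrow> real \<Rightarrow> (real \<Rightarrow> real) \<Rightarrow> real poly \<Rightarrow> bool" where
  "is_proj m a b v p \<longleftrightarrow> degree p \<le> m \<and> (\<forall>w. degree w \<le> m \<longrightarrow> ip a b (poly p) (poly w) = ip a b v (poly w))"

lemma ip_poly_eq_integral: "ip a b (poly p) (poly q) = integral {a..b} (poly (p * q))"
proof -
  have "ip a b (poly p) (poly q) = (\<integral>x. poly (p * q) x \<partial>lebesgue_on {a<..<b})" by (simp add: ip_def)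
  also have "\<dots> = integral {a<..<b} (poly (p * q))"
    by (rule lebesgue_integral_eq_integral) (auto intro!: integrable_continuous_Ioo continuous_intros)
  finally show ?thesis by (simp add: integral_open_interval_real)
qed

lemma poly_integrable_on [simp]: "(poly p) integrable_on {a..b::real}"
  by (intro integrable_continuous_real continuous_intros)

text \<open>Definiteness fails for general functions but holds here: a continuous nonnegative
  function with zero integral vanishes on the whole interval, and only the zero polynomial has
  infinitely many roots.\<close>

lemma ip_poly_self_eq_0:
  assumes "a < b" "ip a b (poly p) (poly p) = 0"
  shows "p = 0"
proof (rule ccontr)
  assume p: "p \<noteq> 0"
  have "integral (cbox a b) (poly (p * p)) = 0"
    using assms(2) by (simp add: ip_poly_eq_integral)
  then have hi: "((poly (p * p)) has_integral 0) (cbox a b)"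
    by (metis has_integral_integral poly_integrable_on cbox_interval)
  have "poly (p * p) x = 0" if "x \<in> {a..b}" for x
  proof (rule has_integral_0_cbox_imp_0[of a b "poly (p * p)" x])
    show "continuous_on (cbox a b) (poly (p * p))"
      by (intro continuous_on_poly continuous_on_id)
  qed (use that assms(1) hi in auto)
  then have "{a..b} \<subseteq> {x. poly p x = 0}" by auto
  then show False
    using poly_roots_finite[OF p] assms(1) by (meson finite_subset infinite_Icc)
qed

lemma poly_fun_simps:
  "poly (p + q) = (\<lambda>x. poly p x + poly q x)" "poly (p - q) = (\<lambda>x. poly p x - poly q x)"
  "poly (smult c p) = (\<lambda>x. c * poly p x)" "poly (p * q) = (\<lambda>x. poly p x * poly q x)"
  "poly (- p) = (\<lambda>x. - poly p x)" for p q :: "real poly"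
  by auto

lemma ip_poly_add_left: "in_L2 a b v \<Longrightarrow> ip a b (poly (p + q)) v = ip a b (poly p) v + ip a b (poly q) v"
  using ip_add_left[of a b "poly p" "poly q" v] by (simp add: poly_fun_simps)

lemma ip_poly_diff_left: "in_L2 a b v \<Longrightarrow> ip a b (poly (p - q)) v = ip a b (poly p) v - ip a b (poly q) v"
  using ip_diff_left[of a b "poly p" "poly q" v] by (simp add: poly_fun_simps)

lemma ip_poly_smult_left: "ip a b (poly (smult c p)) v = c * ip a b (poly p) v"
  using ip_cmult_left[of a b c "poly p" v] by (simp add: poly_fun_simps)

lemma is_proj_unique:
  assumes "a < b" "is_proj m a b v p" "is_proj m a b v q"
  shows "p = q"
proof -
  have d: "degree (p - q) \<le> m" using assms by (auto simp: is_proj_def intro: degree_diff_le)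
  have "ip a b (poly (p - q)) (poly (p - q)) = 0"
    unfolding ip_poly_diff_left[OF in_L2_poly] using assms d by (simp add: is_proj_def)
  then show ?thesis using ip_poly_self_eq_0[OF assms(1), of "p - q"] by simp
qed

lemma degree_split_monom:
  fixes w :: "real poly"
  assumes "degree w \<le> Suc m"
  obtains u where "w = smult (coeff w (Suc m)) (monom 1 (Suc m)) + u" "degree u \<le> m"
proof -
  define u where "u = w - smult (coeff w (Suc m)) (monom 1 (Suc m))"
  have "degree u \<le> m"
  proof (rule degree_le, intro allI impI)
    fix i assume "m < i"
    then show "coeff u i = 0"
      using assms by (cases "i = Suc m") (auto simp: u_def coeff_eq_0 smult_monom)
  qed
  then show ?thesis using that[of u] by (simp add: u_def)
qed

text \<open>One Gram--Schmidt step per degree: \<open>L\<close> is the monic polynomial of degree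
  \<open>Suc m\<close> orthogonal to all lower degrees, and the projection grows by the component of
  \<open>v\<close> along \<open>L\<close>.\<close>

lemma is_proj_exists:
  assumes ab: "a < b" and v: "in_L2 a b v"
  shows "\<exists>p. is_proj m a b v p"
  using v
proof (induction m arbitrary: v)
  case 0
  define c where "c = ip a b v (poly 1) / ip a b (poly 1) (poly 1)"
  have n: "ip a b (poly 1) (poly 1) \<noteq> 0" using ip_poly_self_eq_0[OF ab, of 1] by auto
  have "is_proj 0 a b v [:c:]" unfolding is_proj_def
  proof (intro conjI allI impI)
    fix w :: "real poly" assume "degree w \<le> 0"
    then obtain d where w: "w = smult d 1" by (metis degree_eq_zeroE le_zero_eq smult_one)
    show "ip a b (poly [:c:]) (poly w) = ip a b v (poly w)"
      unfolding w smult_one[symmetric, of c] ip_poly_smult_left ip_commute[of a b _ "poly (smult d 1)"]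
      using n by (simp only: c_def ip_commute[of a b "poly 1" v]) simp
  qed simp
  then show ?case by blast
next
  case (Suc m)
  obtain e where e: "is_proj m a b (poly (monom 1 (Suc m))) e" using Suc.IH[OF in_L2_poly] by blast
  obtain p where p: "is_proj m a b v p" using Suc by blast
  define L where "L = monom 1 (Suc m) - e"
  have Lo: "ip a b (poly L) (poly w) = 0" if "degree w \<le> m" for w
    unfolding L_def ip_poly_diff_left[OF in_L2_poly] using e that by (simp add: is_proj_def)
  have "L \<noteq> 0"
  proof
    assume "L = 0"
    then have "coeff (monom (1::real) (Suc m)) (Suc m) = coeff e (Suc m)" by (simp add: L_def)
    then show False using e by (simp add: is_proj_def coeff_eq_0)
  qed
  then have n: "ip a b (poly L) (poly L) \<noteq> 0" using ip_poly_self_eq_0[OF ab] by blast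
  define c where "c = ip a b v (poly L) / ip a b (poly L) (poly L)"
  have dL: "degree L \<le> Suc m" 
    using e by (auto simp: L_def is_proj_def intro!: degree_diff_le degree_monom_le)
  have "is_proj (Suc m) a b v (p + smult c L)" unfolding is_proj_def
  proof (intro conjI allI impI)
    show "degree (p + smult c L) \<le> Suc m"
      using p dL by (intro degree_add_le) (auto simp: is_proj_def intro: order_trans[OF degree_smult_le])
    fix w :: "real poly" assume "degree w \<le> Suc m"
    then obtain d u where w: "w = smult d (monom 1 (Suc m)) + u" "degree u \<le> m"
      by (metis degree_split_monom)
    define u' where "u' = u + smult d e"
    have u': "w = smult d L + u'" "degree u' \<le> m"
      using w e by (auto simp: L_def u'_def smult_diff_right is_proj_def
          intro!: degree_add_le intro: order_trans[OF degree_smult_le])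
    have r: "ip a b x (poly w) = d * ip a b x (poly L) + ip a b x (poly u')" if "in_L2 a b x" for x
      unfolding u' using that
      by (simp only: ip_commute[of a b x] ip_poly_add_left ip_poly_smult_left)
    have pL: "ip a b (poly p) (poly L) = 0"
      using Lo[of p] p by (simp add: ip_commute[of a b "poly p"] is_proj_def)
    show "ip a b (poly (p + smult c L)) (poly w) = ip a b v (poly w)"
      unfolding r[OF in_L2_poly] r[OF Suc.prems] ip_poly_add_left[OF in_L2_poly] ip_poly_smult_left
      using n p u' Lo by (simp add: pL c_def is_proj_def)
  qed
  then show ?case by blast
qed

lemma L2_proj_is_proj:
  assumes "a < b" "in_L2 a b v"
  shows "is_proj m a b v (L2_proj m a b v)"
proof -
  have "\<exists>!p. is_proj m a b v p"
    using is_proj_exists[OF assms] is_proj_unique[OF assms(1)] by blast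
  then have "is_proj m a b v (THE p. is_proj m a b v p)" by (rule theI')
  then show ?thesis by (simp add: L2_proj_def is_proj_def ip_def)
qed

lemma degree_L2_proj: "a < b \<Longrightarrow> in_L2 a b v \<Longrightarrow> degree (L2_proj m a b v) \<le> m"
  using L2_proj_is_proj by (auto simp: is_proj_def)

lemma L2_proj_ip:
  "a < b \<Longrightarrow> in_L2 a b v \<Longrightarrow> degree w \<le> m \<Longrightarrow> ip a b (poly (L2_proj m a b v)) (poly w) = ip a b v (poly w)"
  using L2_proj_is_proj by (auto simp: is_proj_def)

lemma L2_proj_residual_orth:
  assumes "a < b" "in_L2 a b v" "degree w \<le> m"
  shows "ip a b (\<lambda>x. v x - poly (L2_proj m a b v) x) (poly w) = 0"
  using assms by (simp add: ip_diff_left L2_proj_ip)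

lemma L2_proj_eqI: "a < b \<Longrightarrow> in_L2 a b v \<Longrightarrow> is_proj m a b v p \<Longrightarrow> L2_proj m a b v = p"
  using L2_proj_is_proj is_proj_unique by blast

text \<open>The differential equation determines \<open>R\<close> only almost everywhere; this makes
  it usable inside the projection.\<close>

lemma L2_proj_cong_AE:
  assumes "a < b" "in_L2 a b v" "AE x in lebesgue_on {a<..<b}. v x = v' x"
  shows "L2_proj m a b v = L2_proj m a b v'"
proof (rule L2_proj_eqI[OF assms(1,2)])
  have "is_proj m a b v' (L2_proj m a b v')"
    using L2_proj_is_proj[OF assms(1) in_L2_AE_cong[OF assms(2,3)]] .
  then show "is_proj m a b v (L2_proj m a b v')"
    using ip_cong_AE[OF assms(2,3) in_L2_poly AE_I2] by (simp add: is_proj_def)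
qed

lemma L2_proj_poly: "a < b \<Longrightarrow> degree p \<le> m \<Longrightarrow> L2_proj m a b (poly p) = p"
  by (rule L2_proj_eqI) (auto simp: is_proj_def)

lemma L2_proj_add:
  assumes "a < b" "in_L2 a b u" "in_L2 a b v"
  shows "L2_proj m a b (\<lambda>x. u x + v x) = L2_proj m a b u + L2_proj m a b v"
proof (rule L2_proj_eqI[OF assms(1)])
  show "is_proj m a b (\<lambda>x. u x + v x) (L2_proj m a b u + L2_proj m a b v)" unfolding is_proj_def
  proof (intro conjI allI impI)
    fix w :: "real poly" assume w: "degree w \<le> m"
    show "ip a b (poly (L2_proj m a b u + L2_proj m a b v)) (poly w) = ip a b (\<lambda>x. u x + v x) (poly w)"
      using assms w by (simp only: ip_poly_add_left in_L2_poly ip_add_left L2_proj_ip)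
  qed (use assms in \<open>auto intro!: degree_add_le degree_L2_proj\<close>)
qed (use assms in auto)

lemma L2_proj_cmult:
  assumes "a < b" "in_L2 a b u"
  shows "L2_proj m a b (\<lambda>x. c * u x) = smult c (L2_proj m a b u)"
proof (rule L2_proj_eqI[OF assms(1)])
  show "is_proj m a b (\<lambda>x. c * u x) (smult c (L2_proj m a b u))" unfolding is_proj_def
  proof (intro conjI allI impI)
    fix w :: "real poly" assume w: "degree w \<le> m"
    show "ip a b (poly (smult c (L2_proj m a b u))) (poly w) = ip a b (\<lambda>x. c * u x) (poly w)"
      using assms w by (simp only: ip_poly_smult_left ip_cmult_left L2_proj_ip)
  qed (use assms in \<open>auto intro: order_trans[OF degree_smult_le] degree_L2_proj\<close>)
qed (use assms in auto)

lemma L2_proj_diff: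
  assumes "a < b" "in_L2 a b u" "in_L2 a b v"
  shows "L2_proj m a b (\<lambda>x. u x - v x) = L2_proj m a b u - L2_proj m a b v"
  using L2_proj_add[OF assms(1,2) in_L2_cmult[OF assms(3)], of m "-1"] L2_proj_cmult[OF assms(1,3), of m "-1"]
  by simp

lemma L2_proj_sum:
  assumes "a < b" "finite A" "\<And>i. i \<in> A \<Longrightarrow> in_L2 a b (f i)"
  shows "L2_proj m a b (\<lambda>x. \<Sum>i\<in>A. f i x) = (\<Sum>i\<in>A. L2_proj m a b (f i))"
  using assms(2,3)
proof (induction A)
  case empty
  show ?case using L2_proj_poly[OF assms(1), of 0 m] by (simp add: poly_0[abs_def])
next
  case (insert i A)
  then show ?case
    using L2_proj_add[OF assms(1), of "f i" "\<lambda>x. \<Sum>i\<in>A. f i x" m] by auto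
qed

text \<open>Pythagoras for the orthogonal summands v - P v and P v - q. It yields contractivity,
  best approximation, and later the comparison of projections of two different degrees.\<close>

lemma L2_proj_best:
  assumes ab: "a < b" and v: "in_L2 a b v" and q: "degree q \<le> m"
  shows "(nrm a b (\<lambda>x. v x - poly q x))\<^sup>2 =
    (nrm a b (\<lambda>x. v x - poly (L2_proj m a b v) x))\<^sup>2 + (nrm a b (poly (L2_proj m a b v - q)))\<^sup>2"
proof -
  define P where "P = L2_proj m a b v"
  have d: "degree (P - q) \<le> m" using ab v q by (auto simp: P_def intro!: degree_diff_le degree_L2_proj)
  have e: "in_L2 a b (\<lambda>x. v x - poly P x)" using v by auto
  have o: "ip a b (\<lambda>x. v x - poly P x) (poly (P - q)) = 0"
    using L2_proj_residual_orth[OF ab v d] by (simp only: P_def)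
  have "(\<lambda>x. v x - poly q x) = (\<lambda>x. (v x - poly P x) + poly (P - q) x)" by auto
  then have "(nrm a b (\<lambda>x. v x - poly q x))\<^sup>2 =
     ip a b (\<lambda>x. (v x - poly P x) + poly (P - q) x) (\<lambda>x. (v x - poly P x) + poly (P - q) x)"
    by (simp only: nrm_sq)
  also have "\<dots> = ip a b (\<lambda>x. v x - poly P x) (\<lambda>x. v x - poly P x) + ip a b (poly (P - q)) (poly (P - q))"
    using e o ip_commute[of a b "poly (P - q)" "\<lambda>x. v x - poly P x"]
    by (simp only: ip_add_left ip_add_right in_L2_add in_L2_poly)
  finally show ?thesis by (simp only: P_def nrm_sq)
qed

lemma nrm_L2_proj_le:
  assumes "a < b" "in_L2 a b v" shows "nrm a b (poly (L2_proj m a b v)) \<le> nrm a b v"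
  using L2_proj_best[OF assms, of 0 m] by (auto intro: power2_le_imp_le[OF _ nrm_nonneg])

lemma nrm_residual_le:
  assumes "a < b" "in_L2 a b v" "degree q \<le> m"
  shows "nrm a b (\<lambda>x. v x - poly (L2_proj m a b v) x) \<le> nrm a b (\<lambda>x. v x - poly q x)"
  using L2_proj_best[OF assms] by (auto intro: power2_le_imp_le[OF _ nrm_nonneg])

section \<open>Absolutely continuous functions with square integrable derivative\<close>

text \<open>Membership in H^1(a,b) for the continuous representative \<open>u\<close>, with
  derivative \<open>g\<close>. The integrated form, unlike pointwise differentiability, is
  insensitive to changes of \<open>g\<close> on null sets, just as a weak derivative is.\<close>

definition ac :: "real \<Rightarrow> real \<Rightarrow> (real \<Rightarrow> real) \<Rightarrow> (real \<Rightarrow> real) \<Rightarrow> bool" where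
  "ac a b u g \<longleftrightarrow> in_L2 a b g \<and> (\<forall>x\<in>{a..b}. u x = u a + integral {a..x} g)"

lemma absolutely_integrable_on_lebesgue_on_Ioo:
  fixes f :: "real \<Rightarrow> real"
  shows "f absolutely_integrable_on {a..b} \<longleftrightarrow> integrable (lebesgue_on {a<..<b}) f"
  by (subst absolutely_integrable_on_Icc_iff_Ioo) (simp add: integrable_restrict_space set_integrable_def)

lemma in_L2_absolutely_integrable: "in_L2 a b g \<Longrightarrow> g absolutely_integrable_on {a..b}"
  using in_L2_integrable absolutely_integrable_on_lebesgue_on_Ioo by blast

lemma in_L2_absolutely_integrable_sub:
  "in_L2 a b g \<Longrightarrow> a \<le> c \<Longrightarrow> d \<le> b \<Longrightarrow> g absolutely_integrable_on {c..d}"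
  by (rule in_L2_absolutely_integrable, rule in_L2_subinterval)

lemma in_L2_integrable_on_sub:
  "in_L2 a b g \<Longrightarrow> a \<le> c \<Longrightarrow> d \<le> b \<Longrightarrow> g integrable_on {c..d}"
  using in_L2_absolutely_integrable_sub absolutely_integrable_on_def by blast

lemma integral_lebesgue_on_Ioo:
  fixes f :: "real \<Rightarrow> real"
  assumes "integrable (lebesgue_on {a<..<b}) f"
  shows "integral\<^sup>L (lebesgue_on {a<..<b}) f = integral {a..b} f"
  using lebesgue_integral_eq_integral[OF assms] by (simp add: integral_open_interval_real)

lemma ip_eq_integral:
  "in_L2 a b f \<Longrightarrow> in_L2 a b g \<Longrightarrow> ip a b f g = integral {a..b} (\<lambda>x. f x * g x)"
  by (simp add: ip_def integral_lebesgue_on_Ioo in_L2_mult)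

lemma ac_in_L2: "ac a b u g \<Longrightarrow> in_L2 a b g"
  by (simp add: ac_def)

lemma ac_eq: "ac a b u g \<Longrightarrow> a \<le> x \<Longrightarrow> x \<le> b \<Longrightarrow> u x = u a + integral {a..x} g"
  unfolding ac_def by (meson atLeastAtMost_iff)

lemma ac_diff_eq:
  assumes "ac a b u g" "a \<le> x" "x \<le> y" "y \<le> b"
  shows "u y - u x = integral {x..y} g"
proof -
  have "integral {a..x} g + integral {x..y} g = integral {a..y} g"
    using assms by (intro Henstock_Kurzweil_Integration.integral_combine
        in_L2_integrable_on_sub[OF ac_in_L2[OF assms(1)]]) auto
  moreover have "u x = u a + integral {a..x} g" "u y = u a + integral {a..y} g"
    using ac_eq[OF assms(1)] assms(2-4) by (meson order_trans)+
  ultimately show ?thesis by simp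
qed

lemma ac_subinterval:
  assumes "ac a b u g" "a \<le> c" "d \<le> b" shows "ac c d u g"
  unfolding ac_def
proof (intro conjI ballI)
  show "in_L2 c d g" using assms in_L2_subinterval unfolding ac_def by blast
  fix x assume "x \<in> {c..d}"
  then show "u x = u c + integral {c..x} g" using ac_diff_eq[OF assms(1), of c x] assms by simp
qed

lemma ac_continuous:
  assumes "ac a b u g" shows "continuous_on {a..b} u"
proof -
  have "continuous_on {a..b} (\<lambda>x. u a + integral {a..x} g)"
    by (intro continuous_intros indefinite_integral_continuous_1
        in_L2_integrable_on_sub[OF ac_in_L2[OF assms]]) auto
  then show ?thesis
    by (rule continuous_on_eq) (metis ac_eq[OF assms] atLeastAtMost_iff)
qed

lemma ac_in_L2_self: "ac a b u g \<Longrightarrow> in_L2 a b u"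
  by (intro in_L2_continuous ac_continuous)

lemma ac_indefinite: "in_L2 a b g \<Longrightarrow> ac a b (\<lambda>x. c + integral {a..x} g) g"
  by (simp add: ac_def)

lemma ac_cmult:
  assumes "ac a b u g" shows "ac a b (\<lambda>x. c * u x) (\<lambda>x. c * g x)"
  unfolding ac_def
proof (intro conjI ballI)
  show "in_L2 a b (\<lambda>x. c * g x)" using assms by (auto simp: ac_def)
  fix x assume "x \<in> {a..b}"
  then show "c * u x = c * u a + integral {a..x} (\<lambda>x. c * g x)"
    using ac_eq[OF assms, of x] by (simp add: distrib_left)
qed

lemma ac_add:
  assumes "ac a b u g" "ac a b v h" shows "ac a b (\<lambda>x. u x + v x) (\<lambda>x. g x + h x)"
  unfolding ac_def
proof (intro conjI ballI)
  show "in_L2 a b (\<lambda>x. g x + h x)" using assms by (auto simp: ac_def)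
  fix x assume x: "x \<in> {a..b}"
  have "integral {a..x} (\<lambda>x. g x + h x) = integral {a..x} g + integral {a..x} h"
    using x by (intro Henstock_Kurzweil_Integration.integral_add
        in_L2_integrable_on_sub[OF ac_in_L2[OF assms(1)]] in_L2_integrable_on_sub[OF ac_in_L2[OF assms(2)]]) auto
  then show "u x + v x = u a + v a + integral {a..x} (\<lambda>x. g x + h x)"
    using ac_eq[OF assms(1), of x] ac_eq[OF assms(2), of x] x by simp
qed

lemma ac_diff:
  assumes "ac a b u g" "ac a b v h" shows "ac a b (\<lambda>x. u x - v x) (\<lambda>x. g x - h x)"
  using ac_add[OF assms(1) ac_cmult[OF assms(2), of "-1"]] by simp

lemma ac_const: "ac a b (\<lambda>x. c) (\<lambda>x. 0)"
  by (auto simp: ac_def)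

lemma ac_sum:
  assumes "finite A" "\<And>i. i \<in> A \<Longrightarrow> ac a b (u i) (g i)"
  shows "ac a b (\<lambda>x. \<Sum>i\<in>A. u i x) (\<lambda>x. \<Sum>i\<in>A. g i x)"
  using assms
proof (induction A)
  case (insert i A)
  then show ?case using ac_add[of a b "u i" "g i" "\<lambda>x. \<Sum>i\<in>A. u i x"] by simp
qed (simp add: ac_const)

lemma ac_C1:
  assumes "\<And>x. x \<in> {a..b} \<Longrightarrow> (u has_real_derivative g x) (at x within {a..b})" "continuous_on {a..b} g"
  shows "ac a b u g"
  unfolding ac_def
proof (intro conjI ballI)
  show "in_L2 a b g" using assms(2) by (rule in_L2_continuous)
  fix x assume x: "x \<in> {a..b}"
  have "(g has_integral u x - u a) {a..x}"
  proof (rule fundamental_theorem_of_calculus)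
    fix y assume "y \<in> {a..x}"
    then show "(u has_vector_derivative g y) (at y within {a..x})"
      using x assms(1)[of y] 
      by (auto simp: has_real_derivative_iff_has_vector_derivative intro: has_vector_derivative_within_subset)
  qed (use x in auto)
  then show "u x = u a + integral {a..x} g" by (simp add: integral_unique)
qed

lemma ac_poly: "ac a b (poly p) (poly (pderiv p))"
  by (rule ac_C1) (auto intro: poly_DERIV[THEN DERIV_subset] continuous_on_poly continuous_on_id)

text \<open>The defect \<open>H\<close> of the formula on \<open>[a, x]\<close> satisfies
  \<open>\<bar>H y - H x\<bar> \<le> 2 L (y - x) \<integral>\<^sub>x\<^sup>y \<bar>g\<bar>\<close>, so its derivative vanishes.\<close>

lemma ac_integration_by_parts:
  assumes ab: "a \<le> b" and u: "ac a b u g"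
    and d: "\<And>x. x \<in> {a..b} \<Longrightarrow> (\<phi> has_real_derivative \<phi>' x) (at x within {a..b})"
    and c: "continuous_on {a..b} \<phi>'"
  shows "ip a b g \<phi> = u b * \<phi> b - u a * \<phi> a - ip a b u \<phi>'"
proof -
  have cphi: "continuous_on {a..b} \<phi>" using d DERIV_continuous_on by blast
  have cu: "continuous_on {a..b} u" by (rule ac_continuous[OF u])
  have L2: "in_L2 a b g" "in_L2 a b \<phi>" "in_L2 a b \<phi>'" "in_L2 a b u"
    using u cphi c cu by (auto simp: ac_def intro: in_L2_continuous)
  have g: "g absolutely_integrable_on {a..b}" by (rule in_L2_absolutely_integrable[OF L2(1)])
  have i1: "(\<lambda>x. g x * \<phi> x) integrable_on {a..b}" "(\<lambda>x. u x * \<phi>' x) integrable_on {a..b}"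
    using in_L2_mult[OF L2(1,2)] in_L2_mult[OF L2(4,3)]
    by (auto simp: absolutely_integrable_on_lebesgue_on_Ioo[symmetric] absolutely_integrable_on_def)
  have sub: "f integrable_on {x..y}" if "f integrable_on {a..b}" "a \<le> x" "y \<le> b" for f :: "real \<Rightarrow> real" and x y
    using that by (auto intro: integrable_on_subinterval)
  have gi: "g integrable_on {a..b}" "(\<lambda>x. \<bar>g x\<bar>) integrable_on {a..b}"
    using g by (auto simp: absolutely_integrable_on_def)
  obtain L where L: "\<And>x. x \<in> {a..b} \<Longrightarrow> \<bar>\<phi>' x\<bar> \<le> L" "0 \<le> L"
  proof -
    have "bounded (\<phi>' ` {a..b})" by (intro compact_imp_bounded compact_continuous_image c) auto
    then show ?thesis using that by (metis bounded_pos image_eqI less_imp_le real_norm_def)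
  qed
  have Lip: "\<bar>\<phi> t - \<phi> y\<bar> \<le> L * (y - x)" if "a \<le> x" "x \<le> t" "t \<le> y" "y \<le> b" for x t y
  proof -
    have "norm (\<phi> t - \<phi> y) \<le> L * norm (t - y)"
      by (rule field_differentiable_bound[of "{a..b}" \<phi> \<phi>']) (use d L that in auto)
    also have "\<dots> \<le> L * (y - x)" using that L by (intro mult_left_mono) auto
    finally show ?thesis by simp
  qed
  define G where "G x = integral {a..x} (\<lambda>x. \<bar>g x\<bar>)" for x
  define H where "H x = integral {a..x} (\<lambda>t. g t * \<phi> t) - u x * \<phi> x + integral {a..x} (\<lambda>t. u t * \<phi>' t)" for x
  have Hd: "\<bar>H y - H x\<bar> \<le> 2 * L * (y - x) * (G y - G x)" if xy: "a \<le> x" "x \<le> y" "y \<le> b" for x y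
  proof -
    have comb: "integral {a..y} f - integral {a..x} f = integral {x..y} f"
      if "f integrable_on {a..b}" for f :: "real \<Rightarrow> real"
      using Henstock_Kurzweil_Integration.integral_combine[of a x y f] sub[OF that, of a y] xy by simp
    have Gxy: "G y - G x = integral {x..y} (\<lambda>x. \<bar>g x\<bar>)" using comb[OF gi(2)] by (simp add: G_def)
    have uxy: "\<bar>u t - u x\<bar> \<le> G y - G x" if t: "x \<le> t" "t \<le> y" for t
    proof -
      have "\<bar>u t - u x\<bar> = \<bar>integral {x..t} g\<bar>" using ac_diff_eq[OF u, of x t] xy t by simp
      also have "\<dots> \<le> integral {x..t} (\<lambda>x. \<bar>g x\<bar>)"
        using integral_norm_bound_integral[OF sub[OF gi(1), of x t] sub[OF gi(2), of x t]] xy t by simp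
      also have "\<dots> \<le> integral {x..y} (\<lambda>x. \<bar>g x\<bar>)"
        using xy t by (intro integral_subset_le sub[OF gi(2)]) auto
      finally show ?thesis using Gxy by simp
    qed
    have ip: "\<phi>' integrable_on {x..y}" using xy c by (intro integrable_continuous_real) (auto intro: continuous_on_subset)
    have fp: "integral {x..y} \<phi>' = \<phi> y - \<phi> x"
    proof (rule integral_unique, rule fundamental_theorem_of_calculus)
      fix z assume "z \<in> {x..y}"
      then show "(\<phi> has_vector_derivative \<phi>' z) (at z within {x..y})"
        using d[of z] xy
        by (auto simp: has_real_derivative_iff_has_vector_derivative intro: has_vector_derivative_within_subset)
    qed (use xy in auto)
    have ug: "u y - u x = integral {x..y} g" using ac_diff_eq[OF u] xy by simp
    have e1: "integral {x..y} (\<lambda>t. g t * (\<phi> t - \<phi> y)) = integral {x..y} (\<lambda>t. g t * \<phi> t) - \<phi> y * (u y - u x)"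
      using xy unfolding ug
      by (simp add: right_diff_distrib Henstock_Kurzweil_Integration.integral_diff sub[OF i1(1)] sub[OF gi(1)] integrable_on_mult_left)
    have e2: "integral {x..y} (\<lambda>t. (u t - u x) * \<phi>' t) = integral {x..y} (\<lambda>t. u t * \<phi>' t) - u x * (\<phi> y - \<phi> x)"
      using xy unfolding fp[symmetric]
      by (simp add: left_diff_distrib Henstock_Kurzweil_Integration.integral_diff sub[OF i1(2)] ip integrable_on_mult_right)
    \<comment> \<open>The constants subtracted in \<open>e1\<close> and \<open>e2\<close> are chosen
      so that together they give the boundary term: \<phi>(y) (u(y) - u(x)) + u(x) (\<phi>(y) -
      \<phi>(x)) = u(y) \<phi>(y) - u(x) \<phi>(x).\<close>
    have H: "H y - H x = integral {x..y} (\<lambda>t. g t * (\<phi> t - \<phi> y)) + integral {x..y} (\<lambda>t. (u t - u x) * \<phi>' t)"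
      using comb[OF i1(1)] comb[OF i1(2)] unfolding e1 e2 by (simp add: H_def algebra_simps)
    have ii: "(\<lambda>t. g t * (\<phi> t - \<phi> y)) integrable_on {x..y}" "(\<lambda>t. (u t - u x) * \<phi>' t) integrable_on {x..y}"
      unfolding right_diff_distrib left_diff_distrib using xy
      by (intro integrable_diff sub[OF i1(1)] sub[OF i1(2)] sub[OF gi(1)] ip
          integrable_on_mult_left integrable_on_mult_right; simp)+
    have b1: "\<bar>integral {x..y} (\<lambda>t. g t * (\<phi> t - \<phi> y))\<bar> \<le> integral {x..y} (\<lambda>t. L * (y - x) * \<bar>g t\<bar>)"
    proof -
      have "norm (integral {x..y} (\<lambda>t. g t * (\<phi> t - \<phi> y))) \<le> integral {x..y} (\<lambda>t. L * (y - x) * \<bar>g t\<bar>)"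
      proof (rule integral_norm_bound_integral[OF ii(1)])
        show "(\<lambda>t. L * (y - x) * \<bar>g t\<bar>) integrable_on {x..y}"
          using xy by (intro integrable_on_mult_right sub[OF gi(2)]) auto
        fix t assume "t \<in> {x..y}"
        then have "\<bar>g t\<bar> * \<bar>\<phi> t - \<phi> y\<bar> \<le> \<bar>g t\<bar> * (L * (y - x))" using Lip[of x t y] xy
          by (intro mult_left_mono) auto
        then show "norm (g t * (\<phi> t - \<phi> y)) \<le> L * (y - x) * \<bar>g t\<bar>" by (simp add: abs_mult ac_simps)
      qed
      then show ?thesis by simp
    qed
    have b2: "\<bar>integral {x..y} (\<lambda>t. (u t - u x) * \<phi>' t)\<bar> \<le> integral {x..y} (\<lambda>t. (G y - G x) * L)"
    proof -
      have "norm (integral {x..y} (\<lambda>t. (u t - u x) * \<phi>' t)) \<le> integral {x..y} (\<lambda>t. (G y - G x) * L)"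
      proof (rule integral_norm_bound_integral[OF ii(2)])
        fix t assume "t \<in> {x..y}"
        then show "norm ((u t - u x) * \<phi>' t) \<le> (G y - G x) * L"
          using uxy[of t] L(1)[of t] xy by (simp add: abs_mult mult_mono')
      qed (intro integrable_continuous_real continuous_intros)
      then show ?thesis by simp
    qed
    have r1: "integral {x..y} (\<lambda>t. L * (y - x) * \<bar>g t\<bar>) = L * (y - x) * (G y - G x)"
      unfolding Gxy by simp
    have r2: "integral {x..y} (\<lambda>t. (G y - G x) * L) = L * (y - x) * (G y - G x)"
      using xy by simp
    show ?thesis unfolding H
      using abs_triangle_ineq[of "integral {x..y} (\<lambda>t. g t * (\<phi> t - \<phi> y))" "integral {x..y} (\<lambda>t. (u t - u x) * \<phi>' t)"]
        b1 b2 unfolding r1 r2 by linarith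
  qed
  \<comment> \<open>After division by y - x the bound is 2 L times an increment of \<open>G\<close>,
    which tends to 0 by continuity of \<open>G\<close> at every point. Thus no differentiation
    theorem for integrals of L2 functions is involved.\<close>
  have "\<exists>k. \<forall>x\<in>{a..b}. H x = k"
  proof (rule has_field_derivative_zero_constant)
    fix x assume x: "x \<in> {a..b}"
    have "continuous_on {a..b} G" unfolding G_def by (rule indefinite_integral_continuous_1[OF gi(2)])
    then have "(G \<longlongrightarrow> G x) (at x within {a..b})" using x by (simp add: continuous_on_def)
    then have "((\<lambda>y. 2 * L * \<bar>G y - G x\<bar>) \<longlongrightarrow> 2 * L * \<bar>G x - G x\<bar>) (at x within {a..b})"
      by (intro tendsto_intros)
    then have lim: "((\<lambda>y. 2 * L * \<bar>G y - G x\<bar>) \<longlongrightarrow> 0) (at x within {a..b})" by simp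
    have "((\<lambda>y. (H y - H x) / (y - x)) \<longlongrightarrow> 0) (at x within {a..b})"
    proof (rule Lim_null_comparison[OF _ lim])
      show "\<forall>\<^sub>F y in at x within {a..b}. norm ((H y - H x) / (y - x)) \<le> 2 * L * \<bar>G y - G x\<bar>"
        unfolding eventually_at_filter
      proof (intro always_eventually allI impI)
        fix y assume y: "y \<noteq> x" "y \<in> {a..b}"
        have *: "\<bar>H y - H x\<bar> \<le> 2 * L * \<bar>y - x\<bar> * \<bar>G y - G x\<bar>"
        proof (cases "x \<le> y")
          case True
          have "\<bar>H y - H x\<bar> \<le> 2 * L * (y - x) * (G y - G x)" using Hd[of x y] True x y by simp
          also have "\<dots> \<le> 2 * L * (y - x) * \<bar>G y - G x\<bar>" using True L by (intro mult_left_mono) auto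
          finally show ?thesis using True by simp
        next
          case False
          have "\<bar>H x - H y\<bar> \<le> 2 * L * (x - y) * (G x - G y)" using Hd[of y x] False x y by simp
          also have "\<dots> \<le> 2 * L * (x - y) * \<bar>G y - G x\<bar>" using False L by (intro mult_left_mono) auto
          finally show ?thesis using False by (simp add: abs_minus_commute)
        qed
        then show "norm ((H y - H x) / (y - x)) \<le> 2 * L * \<bar>G y - G x\<bar>"
          using y by (simp add: abs_divide pos_divide_le_eq ac_simps)
      qed
    qed
    then show "(H has_field_derivative 0) (at x within {a..b})" by (simp add: has_field_derivative_iff)
  qed auto
  then have "H a = H b" using ab by auto
  then show ?thesis
    using ip_eq_integral[OF L2(1,2)] ip_eq_integral[OF L2(4,3)] by (simp add: H_def)
qed

section \<open>Legendre polynomials\<close>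

text \<open>The monic Legendre polynomials of [a,b]. The degree \<open>n - 1\<close> is truncated at
  0, hence the separate case.\<close>

definition leg :: "real \<Rightarrow> real \<Rightarrow> nat \<Rightarrow> real poly" where
  "leg a b n = (if n = 0 then 1 else monom 1 n - L2_proj (n - 1) a b (poly (monom 1 n)))"

lemma degree_leg_le:
  assumes "a < b" shows "degree (leg a b n) \<le> n"
proof (cases "n = 0")
  case False
  have "degree (L2_proj (n - 1) a b (poly (monom 1 n))) \<le> n - 1"
    by (rule degree_L2_proj[OF assms in_L2_poly])
  then show ?thesis using False by (auto simp: leg_def intro!: degree_diff_le degree_monom_le)
qed (simp add: leg_def)

lemma coeff_leg:
  assumes "a < b" shows "coeff (leg a b n) n = 1"
proof (cases "n = 0")
  case False
  have "degree (L2_proj (n - 1) a b (poly (monom 1 n))) \<le> n - 1"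
    by (rule degree_L2_proj[OF assms in_L2_poly])
  then have "coeff (L2_proj (n - 1) a b (poly (monom 1 n))) n = 0" using False by (intro coeff_eq_0) auto
  then show ?thesis using False by (simp add: leg_def)
qed (simp add: leg_def)

lemma leg_orth:
  assumes "a < b" "degree w < n" shows "ip a b (poly (leg a b n)) (poly w) = 0"
proof -
  have "n \<noteq> 0" "degree w \<le> n - 1" using assms by auto
  then show ?thesis
    using L2_proj_residual_orth[OF assms(1) in_L2_poly, of w "n - 1" "monom 1 n"]
    by (simp add: leg_def poly_fun_simps)
qed

lemma leg_split:
  assumes "a < b" "degree p \<le> Suc n"
  obtains c u where "p = smult c (leg a b (Suc n)) + u" "degree u \<le> n"
proof -
  define c where "c = coeff p (Suc n)"
  define u where "u = p - smult c (leg a b (Suc n))"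
  have "degree u \<le> n"
  proof (rule degree_le, intro allI impI)
    fix i assume "n < i"
    then show "coeff u i = 0"
      using assms(2) degree_leg_le[OF assms(1), of "Suc n"] coeff_leg[OF assms(1), of "Suc n"]
      by (cases "i = Suc n") (auto simp: u_def c_def coeff_eq_0)
  qed
  then show ?thesis using that[of c u] by (simp add: u_def)
qed

text \<open>The Sturm--Liouville operator \<open>p \<mapsto> - ((x - a) (b - x) p')'\<close>, whose eigenfunctions are the
  Legendre polynomials.\<close>

definition sl_weight :: "real \<Rightarrow> real \<Rightarrow> real poly" where
  "sl_weight a b = [:- (a * b), a + b, - 1:]"

definition sl :: "real \<Rightarrow> real \<Rightarrow> real poly \<Rightarrow> real poly" where
  "sl a b p = - pderiv (sl_weight a b * pderiv p)"

lemma poly_sl_weight: "poly (sl_weight a b) x = (x - a) * (b - x)"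
  by (simp add: sl_weight_def algebra_simps)

text \<open>The weight has leading term -x^2, so x^n is sent to n (n + 1) x^n plus lower order
  terms: degrees are preserved and the eigenvalue can be read off the leading coefficient.\<close>

lemma coeff_sl:
  assumes "degree p \<le> n" "n \<le> i"
  shows "coeff (sl a b p) i = real i * real (i + 1) * coeff p i"
proof -
  have 1: "coeff p (Suc i) = 0" "coeff p (Suc (Suc i)) = 0" using assms by (auto intro!: coeff_eq_0)
  show ?thesis
    using 1 by (cases i) (auto simp: sl_def sl_weight_def coeff_pderiv coeff_pCons algebra_simps)
qed

lemma degree_sl_le: "degree p \<le> n \<Longrightarrow> degree (sl a b p) \<le> n"
  by (rule degree_le) (auto simp: coeff_sl[of p n] coeff_eq_0)

text \<open>The weight vanishes at both end points, so integration by parts leaves no boundary term,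
  whatever the boundary values of \<open>u\<close>.\<close>

lemma ac_ip_sl:
  assumes "a \<le> b" "ac a b u g"
  shows "ip a b u (poly (sl a b p)) = ip a b g (poly (sl_weight a b * pderiv p))"
proof -
  define \<phi> where "\<phi> = sl_weight a b * pderiv p"
  have "ip a b g (poly \<phi>) = u b * poly \<phi> b - u a * poly \<phi> a - ip a b u (poly (pderiv \<phi>))"
    by (rule ac_integration_by_parts[OF assms])
       (auto intro: poly_DERIV[THEN DERIV_subset] continuous_on_poly continuous_on_id)
  moreover have "poly \<phi> a = 0" "poly \<phi> b = 0" by (auto simp: \<phi>_def poly_sl_weight)
  moreover have "ip a b u (poly (- pderiv \<phi>)) = - ip a b u (poly (pderiv \<phi>))"
    using ip_cmult_right[of a b u "-1" "poly (pderiv \<phi>)"] by (simp add: poly_fun_simps)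
  ultimately show ?thesis unfolding sl_def \<phi>_def[symmetric] by simp
qed

lemma ip_weight:
  "ip a b f (poly (w * p)) = ip a b (\<lambda>x. poly w x * f x) (poly p)"
  by (simp add: ip_def ac_simps)

lemma sl_selfadjoint:
  assumes "a \<le> b" shows "ip a b (poly (sl a b p)) (poly q) = ip a b (poly p) (poly (sl a b q))"
proof -
  have "ip a b (poly q) (poly (sl a b p)) = ip a b (poly (pderiv q)) (poly (sl_weight a b * pderiv p))"
    by (rule ac_ip_sl[OF assms ac_poly])
  also have "\<dots> = ip a b (poly (pderiv p)) (poly (sl_weight a b * pderiv q))"
    by (simp add: ip_def ac_simps)
  also have "\<dots> = ip a b (poly p) (poly (sl a b q))"
    by (rule ac_ip_sl[OF assms ac_poly, symmetric])
  finally show ?thesis by (simp add: ip_commute)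
qed

text \<open>Leading coefficients agree, so the difference \<open>d\<close> has degree below
  \<open>n\<close>. Self-adjointness moves the operator onto \<open>d\<close> without raising its
  degree, and orthogonality of \<open>leg\<close> then makes \<open>d\<close> orthogonal to
  itself.\<close>

lemma sl_leg:
  assumes "a < b" shows "sl a b (leg a b n) = smult (real n * real (n + 1)) (leg a b n)"
proof -
  define d where "d = sl a b (leg a b n) - smult (real n * real (n + 1)) (leg a b n)"
  have cd: "coeff d i = 0" if "n \<le> i" for i
  proof -
    have "i = n \<or> coeff (leg a b n) i = 0"
      using that degree_leg_le[OF assms, of n] by (auto intro!: coeff_eq_0)
    then show ?thesis
      unfolding d_def coeff_diff coeff_sl[OF degree_leg_le[OF assms] that] coeff_smult by auto
  qed
  show ?thesis
  proof (cases "d = 0")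
    case False
    then have dd: "degree d < n" using cd leading_coeff_0_iff not_le by blast
    have "ip a b (poly d) (poly d) = ip a b (poly (leg a b n)) (poly (sl a b d))
        - real n * real (n + 1) * ip a b (poly (leg a b n)) (poly d)"
      using assms by (subst d_def) (simp add: ip_poly_diff_left ip_poly_smult_left sl_selfadjoint)
    also have "\<dots> = 0"
      using leg_orth[OF assms dd] leg_orth[OF assms, of "sl a b d" n] degree_sl_le[of d "degree d" a b] dd by simp
    finally have "d = 0" using ip_poly_self_eq_0[OF assms] by blast
    then show ?thesis using False by blast
  qed (simp add: d_def)
qed

lemma ip_poly_add_right: "in_L2 a b v \<Longrightarrow> ip a b v (poly (p + q)) = ip a b v (poly p) + ip a b v (poly q)"
  by (simp only: ip_commute[of a b v] ip_poly_add_left)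

lemma ip_poly_diff_right: "in_L2 a b v \<Longrightarrow> ip a b v (poly (p - q)) = ip a b v (poly p) - ip a b v (poly q)"
  by (simp only: ip_commute[of a b v] ip_poly_diff_left)

lemma ip_poly_smult_right: "ip a b v (poly (smult c p)) = c * ip a b v (poly p)"
  by (simp only: ip_commute[of a b v] ip_poly_smult_left)

lemmas ip_poly_simps = ip_poly_add_left ip_poly_diff_left ip_poly_smult_left
  ip_poly_add_right ip_poly_diff_right ip_poly_smult_right

lemma sl_add: "sl a b (p + q) = sl a b p + sl a b q"
  by (simp add: sl_def pderiv_add distrib_left)

lemma sl_smult: "sl a b (smult c p) = smult c (sl a b p)"
  by (simp add: sl_def pderiv_smult)

text \<open>Spectral gap: orthogonality to degrees up to \<open>m\<close> leaves only Legendre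
  components with eigenvalue at least (m+1)(m+2). The induction peels off the top component; the
  mixed terms vanish because the operator keeps the degree of the rest.\<close>

lemma sl_lower_bound:
  assumes ab: "a < b" and "degree z \<le> N" "\<And>w. degree w \<le> m \<Longrightarrow> ip a b (poly z) (poly w) = 0"
  shows "real (m + 1) * real (m + 2) * ip a b (poly z) (poly z) \<le> ip a b (poly z) (poly (sl a b z))"
  using assms(2,3)
proof (induction N arbitrary: z)
  case 0
  then have "z = 0" using ip_poly_self_eq_0[OF ab, of z] by simp
  then show ?case by (simp add: sl_def ip_def)
next
  case (Suc n)
  show ?case
  proof (cases "Suc n \<le> m")
    case True
    then have "z = 0" using Suc.prems ip_poly_self_eq_0[OF ab, of z] by simp
    then show ?thesis by (simp add: sl_def ip_def)
  next
    case False
    define L where "L = leg a b (Suc n)"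
    obtain c u where z: "z = smult c L + u" and u: "degree u \<le> n"
      using leg_split[OF ab Suc.prems(1)] unfolding L_def by blast
    have Lo: "ip a b (poly L) (poly w) = 0" if "degree w \<le> n" for w
      using leg_orth[OF ab, of w "Suc n"] that by (simp add: L_def)
    have uo: "ip a b (poly u) (poly w) = 0" if w: "degree w \<le> m" for w
      using Suc.prems(2)[OF w] Lo[of w] w False
      unfolding z ip_poly_add_left[OF in_L2_poly] ip_poly_smult_left by simp
    have sL: "sl a b L = smult (real (Suc n) * real (Suc n + 1)) L" by (simp only: L_def sl_leg[OF ab])
    have "real (m + 1) * real (m + 2) * ip a b (poly z) (poly z)
        = c\<^sup>2 * (real (m + 1) * real (m + 2)) * ip a b (poly L) (poly L)
          + real (m + 1) * real (m + 2) * ip a b (poly u) (poly u)"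
      using Lo[OF u] by (simp add: z ip_poly_simps ip_commute[of a b "poly u" "poly L"] power2_eq_square algebra_simps)
    also have "\<dots> \<le> c\<^sup>2 * (real (Suc n) * real (Suc n + 1)) * ip a b (poly L) (poly L)
          + ip a b (poly u) (poly (sl a b u))"
    proof (intro add_mono mult_right_mono mult_left_mono mult_mono)
      show "real (m + 1) * real (m + 2) * ip a b (poly u) (poly u) \<le> ip a b (poly u) (poly (sl a b u))"
        by (rule Suc.IH[OF u uo])
    qed (use False in \<open>auto simp: ip_self_nonneg\<close>)
    also have "\<dots> = ip a b (poly z) (poly (sl a b z))"
      using Lo[OF u] Lo[OF degree_sl_le[OF u]]
      by (simp add: z sl_add sl_smult sL ip_poly_simps ip_commute[of a b "poly u" "poly L"] power2_eq_square
          del: of_nat_Suc of_nat_add)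
    finally show ?thesis .
  qed
qed

lemma weierstrass_L2:
  assumes ab: "a < b" and u: "continuous_on {a..b} u" and e: "0 < e"
  shows "\<exists>q. nrm a b (\<lambda>x. u x - poly q x) \<le> e"
proof -
  define d where "d = e / sqrt (b - a)"
  have d: "0 < d" using ab e by (simp add: d_def)
  obtain g where g: "real_polynomial_function g" "\<And>x. x \<in> {a..b} \<Longrightarrow> \<bar>u x - g x\<bar> < d"
    using Stone_Weierstrass_real_polynomial_function[OF compact_Icc u d] by blast
  obtain c n where gs: "g = (\<lambda>x. \<Sum>i\<le>n. c i * x ^ i)"
    using real_polynomial_function_imp_sum[OF g(1)] by blast
  define q where "q = (\<Sum>i\<le>n. monom (c i) i)"
  have q: "poly q x = g x" for x by (simp add: q_def gs poly_sum poly_monom)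
  have L: "in_L2 a b (\<lambda>x. u x - poly q x)" using in_L2_continuous[OF u] by auto
  have "(nrm a b (\<lambda>x. u x - poly q x))\<^sup>2 = (\<integral>x. (u x - poly q x)\<^sup>2 \<partial>lebesgue_on {a<..<b})"
    by (rule nrm_sq_integral)
  also have "\<dots> \<le> (\<integral>x. d\<^sup>2 \<partial>lebesgue_on {a<..<b})"
  proof (rule integral_mono)
    show "integrable (lebesgue_on {a<..<b}) (\<lambda>x. (u x - poly q x)\<^sup>2)" using L by (simp add: in_L2_def)
    show "integrable (lebesgue_on {a<..<b}) (\<lambda>x. d\<^sup>2)" using in_L2_integrable[OF in_L2_const] .
    fix x assume "x \<in> space (lebesgue_on {a<..<b})"
    then have "\<bar>u x - poly q x\<bar> \<le> d" using g(2)[of x] by (simp add: q)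
    then show "(u x - poly q x)\<^sup>2 \<le> d\<^sup>2" using d by (simp add: abs_le_square_iff[symmetric])
  qed
  also have "\<dots> = e\<^sup>2" using ab by (simp add: d_def power_divide measure_Ioo)
  finally show ?thesis using e by (metis less_imp_le power2_le_imp_le)
qed

text \<open>For z = P_N u - P_m u the spectral gap bounds (m+1)(m+2) times the squared norm of z by
  the energy of z, and this by the integral of W g^2. The maximum h^2 / 4 of the weight and
  (m+1)(m+2) >= (m+1)^2 give the constant h / (2 (m+1)), h being the length of the interval.\<close>

lemma proj_error_order1:
  assumes ab: "a < b" and u: "ac a b u g"
  shows "nrm a b (\<lambda>x. u x - poly (L2_proj m a b u) x) \<le> (b - a) / (2 * (real m + 1)) * nrm a b g"
proof -
  have uL: "in_L2 a b u" by (rule ac_in_L2_self[OF u])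
  have gL: "in_L2 a b g" by (rule ac_in_L2[OF u])
  define W where "W = sl_weight a b"
  define \<Lambda> where "\<Lambda> = real (m + 1) * real (m + 2)"
  have W0: "0 \<le> poly W x" if "x \<in> {a<..<b}" for x using that by (simp add: W_def poly_sl_weight)
  have W1: "poly W x \<le> (b - a)\<^sup>2 / 4" for x
  proof -
    have "(b - a)\<^sup>2 / 4 - (x - a) * (b - x) = (x - (a + b) / 2)\<^sup>2" by (simp add: power2_eq_square field_simps)
    then show ?thesis unfolding W_def poly_sl_weight by (metis diff_ge_0_iff_ge zero_le_power2)
  qed
  have WL: "in_L2 a b (\<lambda>x. poly W x * f x)" if f: "in_L2 a b f" for f
  proof -
    obtain B where B: "\<And>x. x \<in> {a..b} \<Longrightarrow> \<bar>poly W x\<bar> \<le> B"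
    proof -
      have "bounded (poly W ` {a..b})"
        by (intro compact_imp_bounded compact_continuous_image continuous_on_poly continuous_on_id) auto
      then show ?thesis using that by (metis bounded_pos image_eqI real_norm_def)
    qed
    have m: "(\<lambda>x. poly W x * f x) \<in> borel_measurable (lebesgue_on {a<..<b})"
      by (intro borel_measurable_times in_L2_measurable in_L2_poly f)
    have "integrable (lebesgue_on {a<..<b}) (\<lambda>x. (poly W x * f x)\<^sup>2)"
    proof (rule Bochner_Integration.integrable_bound)
      show "integrable (lebesgue_on {a<..<b}) (\<lambda>x. B\<^sup>2 * (f x)\<^sup>2)" using f by (auto simp: in_L2_def)
      show "AE x in lebesgue_on {a<..<b}. norm ((poly W x * f x)\<^sup>2) \<le> norm (B\<^sup>2 * (f x)\<^sup>2)"
      proof (rule AE_I2)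
        fix x assume "x \<in> space (lebesgue_on {a<..<b})"
        then have "(poly W x)\<^sup>2 \<le> B\<^sup>2" using B[of x] by (metis abs_le_square_iff abs_of_nonneg abs_ge_zero order_trans
          atLeastAtMost_iff greaterThanLessThan_iff less_imp_le space_lebesgue_on)
        then show "norm ((poly W x * f x)\<^sup>2) \<le> norm (B\<^sup>2 * (f x)\<^sup>2)"
          by (simp add: power_mult_distrib mult_right_mono)
      qed
    qed (use m in auto)
    then show ?thesis using m by (simp add: in_L2_def)
  qed
  have key: "\<Lambda> * (nrm a b (poly (L2_proj N a b u - L2_proj m a b u)))\<^sup>2 \<le> (b - a)\<^sup>2 / 4 * (nrm a b g)\<^sup>2"
    if mN: "m \<le> N" for N
  proof -
    define z where "z = L2_proj N a b u - L2_proj m a b u"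
    have dz: "degree z \<le> N"
      using degree_L2_proj[OF ab uL, of N] degree_L2_proj[OF ab uL, of m] mN
      by (auto simp: z_def intro!: degree_diff_le)
    have zo: "ip a b (poly z) (poly w) = 0" if "degree w \<le> m" for w
      using that mN L2_proj_ip[OF ab uL, of w] by (simp add: z_def ip_poly_simps)
    have dsz: "degree (sl a b z) \<le> N" by (rule degree_sl_le[OF dz])
    define S where "S = ip a b (poly z) (poly (sl a b z))"
    have "ip a b (poly (L2_proj m a b u)) (poly (sl a b z)) = 0"
      using ab zo[OF degree_sl_le[OF degree_L2_proj[OF ab uL]]]
      by (simp add: ip_commute[of a b "poly (L2_proj m a b u)"] sl_selfadjoint)
    then have "S = ip a b u (poly (sl a b z))"
      using L2_proj_ip[OF ab uL dsz] unfolding S_def by (subst z_def) (simp add: ip_poly_simps)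
    also have "\<dots> = ip a b g (poly (W * pderiv z))" using ab u by (simp add: ac_ip_sl W_def)
    finally have S1: "S = ip a b (\<lambda>x. poly W x * g x) (poly (pderiv z))" by (simp only: ip_weight)
    have S2: "S = ip a b (\<lambda>x. poly W x * poly (pderiv z) x) (poly (pderiv z))"
      unfolding S_def using ac_ip_sl[OF less_imp_le[OF ab] ac_poly, of z z] by (simp only: W_def ip_weight)
    have S3: "ip a b (\<lambda>x. poly W x * poly (pderiv z) x) g = S"
      using S1 by (simp add: ip_def ac_simps)
    have i: "in_L2 a b (\<lambda>x. poly W x * g x)" "in_L2 a b (\<lambda>x. poly W x * poly (pderiv z) x)"
      by (intro WL gL in_L2_poly)+
    \<comment> \<open>Bessel's inequality for the weight W: both the pairing of g with z' and that
      of z' with itself equal \<open>S\<close>, so expanding the square of g - z' leaves the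
      integral of W g^2 minus \<open>S\<close>.\<close>
    have "0 \<le> ip a b (\<lambda>x. poly W x * (g x - poly (pderiv z) x)) (\<lambda>x. g x - poly (pderiv z) x)"
      unfolding ip_def
    proof (rule integral_nonneg_AE, rule AE_I2)
      fix x assume "x \<in> space (lebesgue_on {a<..<b})"
      then show "0 \<le> poly W x * (g x - poly (pderiv z) x) * (g x - poly (pderiv z) x)"
        using W0[of x] by (simp add: mult.assoc)
    qed
    also have "(\<lambda>x. poly W x * (g x - poly (pderiv z) x)) = (\<lambda>x. poly W x * g x - poly W x * poly (pderiv z) x)"
      by (simp add: right_diff_distrib)
    also have "ip a b (\<lambda>x. poly W x * g x - poly W x * poly (pderiv z) x) (\<lambda>x. g x - poly (pderiv z) x)
       = ip a b (\<lambda>x. poly W x * g x) g - S"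
      using i gL S1 S2 S3 by (simp add: ip_diff_left ip_diff_right in_L2_diff)
    also have "ip a b (\<lambda>x. poly W x * g x) g \<le> (b - a)\<^sup>2 / 4 * (nrm a b g)\<^sup>2"
      unfolding nrm_sq ip_cmult_left[symmetric] unfolding ip_def
    proof (rule integral_mono)
      show "integrable (lebesgue_on {a<..<b}) (\<lambda>x. poly W x * g x * g x)" by (rule in_L2_mult[OF i(1) gL])
      show "integrable (lebesgue_on {a<..<b}) (\<lambda>x. (b - a)\<^sup>2 / 4 * g x * g x)"
        by (rule in_L2_mult[OF in_L2_cmult[OF gL] gL])
      fix x
      show "poly W x * g x * g x \<le> (b - a)\<^sup>2 / 4 * g x * g x"
        using mult_right_mono[OF W1[of x], of "g x * g x"] by (simp add: mult.assoc)
    qed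
    finally have "S \<le> (b - a)\<^sup>2 / 4 * (nrm a b g)\<^sup>2" by simp
    moreover have "\<Lambda> * (nrm a b (poly z))\<^sup>2 \<le> S"
      unfolding \<Lambda>_def S_def nrm_sq by (rule sl_lower_bound[OF ab dz zo])
    ultimately show ?thesis by (simp add: z_def)
  qed
  define E where "E = nrm a b (\<lambda>x. u x - poly (L2_proj m a b u) x)"
  \<comment> \<open>Pythagoras splits the error at a high degree \<open>N\<close>. Weierstrass
    approximation makes the tail small, and \<open>key\<close> bounds the rest uniformly in
    \<open>N\<close>.\<close>
  have "\<Lambda> * E\<^sup>2 \<le> (b - a)\<^sup>2 / 4 * (nrm a b g)\<^sup>2"
  proof (rule field_le_epsilon)
    fix e :: real assume e: "0 < e"
    have L: "0 < \<Lambda>" by (simp add: \<Lambda>_def)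
    obtain q where q: "nrm a b (\<lambda>x. u x - poly q x) \<le> sqrt (e / \<Lambda>)"
      using weierstrass_L2[OF ab ac_continuous[OF u], of "sqrt (e / \<Lambda>)"] e L by auto
    define N where "N = max m (degree q)"
    have N: "m \<le> N" "degree q \<le> N" by (auto simp: N_def)
    have "nrm a b (\<lambda>x. u x - poly (L2_proj N a b u) x) \<le> sqrt (e / \<Lambda>)"
      using nrm_residual_le[OF ab uL N(2)] q by linarith
    then have "(nrm a b (\<lambda>x. u x - poly (L2_proj N a b u) x))\<^sup>2 \<le> e / \<Lambda>"
      using e L by (metis nrm_nonneg power_mono real_sqrt_pow2 less_imp_le divide_pos_pos)
    moreover have "E\<^sup>2 = (nrm a b (\<lambda>x. u x - poly (L2_proj N a b u) x))\<^sup>2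
        + (nrm a b (poly (L2_proj N a b u - L2_proj m a b u)))\<^sup>2"
      unfolding E_def using N degree_L2_proj[OF ab uL, of m] by (intro L2_proj_best[OF ab uL]) auto
    ultimately have "E\<^sup>2 \<le> e / \<Lambda> + (nrm a b (poly (L2_proj N a b u - L2_proj m a b u)))\<^sup>2" by linarith
    then have "\<Lambda> * E\<^sup>2 \<le> \<Lambda> * (e / \<Lambda> + (nrm a b (poly (L2_proj N a b u - L2_proj m a b u)))\<^sup>2)"
      using L by (intro mult_left_mono) auto
    then have "\<Lambda> * E\<^sup>2 \<le> \<Lambda> * (e / \<Lambda>) + \<Lambda> * (nrm a b (poly (L2_proj N a b u - L2_proj m a b u)))\<^sup>2"
      by (simp only: distrib_left)
    then show "\<Lambda> * E\<^sup>2 \<le> (b - a)\<^sup>2 / 4 * (nrm a b g)\<^sup>2 + e" using key[OF N(1)] L by simp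
  qed
  moreover have "(real m + 1)\<^sup>2 * E\<^sup>2 \<le> \<Lambda> * E\<^sup>2"
    by (intro mult_right_mono) (auto simp: \<Lambda>_def power2_eq_square intro!: mult_mono)
  ultimately have "((real m + 1) * E)\<^sup>2 \<le> ((b - a) / 2 * nrm a b g)\<^sup>2"
    by (simp add: power_mult_distrib power_divide)
  then have "(real m + 1) * E \<le> (b - a) / 2 * nrm a b g"
    by (rule power2_le_imp_le) (use ab in simp)
  then show ?thesis by (simp add: E_def field_simps)
qed

section \<open>Trading derivatives for degrees\<close>

definition antideriv :: "real poly \<Rightarrow> real poly" where
  "antideriv p = (\<Sum>i\<le>degree p. monom (coeff p i / real (Suc i)) (Suc i))"

lemma pderiv_antideriv: "pderiv (antideriv p) = p"
proof (rule poly_eqI)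
  fix n
  have "coeff (antideriv p) (Suc n) = (if n \<le> degree p then coeff p n / real (Suc n) else 0)"
    by (simp add: antideriv_def coeff_sum)
  then show "coeff (pderiv (antideriv p)) n = coeff p n" 
    by (simp add: coeff_pderiv coeff_eq_0 del: of_nat_Suc)
qed

lemma degree_antideriv: "degree p \<le> m \<Longrightarrow> degree (antideriv p) \<le> Suc m"
  unfolding antideriv_def by (rule degree_sum_le) (auto intro: order_trans[OF degree_monom_le])

text \<open>Subtracting a primitive \<open>q\<close> of the projected derivative changes neither
  side of the projection error in degree \<open>Suc m\<close>, and u - q has derivative g - P g; the
  first order estimate is applied to u - q.\<close>

lemma proj_error_step:
  assumes ab: "a < b" and u: "ac a b u g"
  shows "nrm a b (\<lambda>x. u x - poly (L2_proj (Suc m) a b u) x)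
    \<le> (b - a) / (2 * (real m + 2)) * nrm a b (\<lambda>x. g x - poly (L2_proj m a b g) x)"
proof -
  have uL: "in_L2 a b u" by (rule ac_in_L2_self[OF u])
  have gL: "in_L2 a b g" by (rule ac_in_L2[OF u])
  define q where "q = antideriv (L2_proj m a b g)"
  have q: "degree q \<le> Suc m" "pderiv q = L2_proj m a b g"
    unfolding q_def by (rule degree_antideriv, rule degree_L2_proj[OF ab gL], rule pderiv_antideriv)
  have "ac a b (\<lambda>x. u x - poly q x) (\<lambda>x. g x - poly (L2_proj m a b g) x)"
    using ac_diff[OF u ac_poly[of a b q]] by (simp add: q)
  from proj_error_order1[OF ab this, of "Suc m"]
  have "nrm a b (\<lambda>x. u x - poly q x - poly (L2_proj (Suc m) a b (\<lambda>x. u x - poly q x)) x)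
    \<le> (b - a) / (2 * (real m + 2)) * nrm a b (\<lambda>x. g x - poly (L2_proj m a b g) x)"
    by (simp add: add.commute)
  moreover have "L2_proj (Suc m) a b (\<lambda>x. u x - poly q x) = L2_proj (Suc m) a b u - q"
    using L2_proj_diff[OF ab uL in_L2_poly] L2_proj_poly[OF ab q(1)] by simp
  ultimately show ?thesis by (simp add: algebra_simps)
qed

section \<open>Inverse inequality\<close>

lemma integral_pderiv:
  fixes a b :: real
  assumes "a \<le> b" shows "integral {a..b} (poly (pderiv p)) = poly p b - poly p a"
  using ac_diff_eq[OF ac_poly, of a a b b p] assms by simp

text \<open>With d the opposite end point, (x - d) L' has the same coefficient at x^n as n L, so
  their difference \<open>q\<close> has lower degree and is orthogonal to L. Integrating the
  derivative of (x - d) L^2, whose boundary term survives only at c, leaves (1 + 2 n) times the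
  squared norm of L.\<close>

lemma leg_endpoint:
  assumes ab: "a < b" and c: "c = a \<or> c = b"
  shows "(b - a) * (poly (leg a b n) c)\<^sup>2 = (2 * real n + 1) * ip a b (poly (leg a b n)) (poly (leg a b n))"
proof -
  define L where "L = leg a b n"
  define d where "d = a + b - c"
  define q where "q = [:-d, 1:] * pderiv L - smult (real n) L"
  have dL: "degree L \<le> n" "coeff L n = 1" using degree_leg_le[OF ab] coeff_leg[OF ab] by (auto simp: L_def)
  have qo: "ip a b (poly L) (poly q) = 0"
  proof (cases "q = 0")
    case False
    have "coeff q i = 0" if "n \<le> i" for i
    proof -
      have "coeff L (Suc i) = 0" using dL that by (intro coeff_eq_0) auto
      moreover have "i = n \<or> coeff L i = 0" using dL that by (auto intro!: coeff_eq_0)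
      ultimately show ?thesis by (cases i) (auto simp: q_def coeff_pderiv coeff_pCons algebra_simps)
    qed
    then have "degree q < n" using False leading_coeff_0_iff not_le by blast
    then show ?thesis using leg_orth[OF ab] by (simp add: L_def)
  qed (simp add: ip_def)
  have e: "poly ([:-d, 1:] * L * L) b - poly ([:-d, 1:] * L * L) a = (b - a) * (poly L c)\<^sup>2"
    using c by (auto simp: d_def power2_eq_square algebra_simps)
  have "pderiv ([:-d, 1:] * L * L) = L * L + smult 2 (L * q) + smult (2 * real n) (L * L)"
  proof (rule poly_eq_poly_eq_iff[THEN iffD1], rule ext)
    fix x
    show "poly (pderiv ([:-d, 1:] * L * L)) x = poly (L * L + smult 2 (L * q) + smult (2 * real n) (L * L)) x"
      by (simp add: q_def pderiv_mult pderiv_pCons pderiv_diff pderiv_add pderiv_smult algebra_simps)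
  qed
  then have "(b - a) * (poly L c)\<^sup>2 = integral {a..b} (poly (L * L + smult 2 (L * q) + smult (2 * real n) (L * L)))"
    using integral_pderiv[of a b "[:-d, 1:] * L * L"] ab e by simp
  also have "\<dots> = integral {a..b} (poly (L * L)) + 2 * integral {a..b} (poly (L * q)) + 2 * real n * integral {a..b} (poly (L * L))"
    unfolding poly_fun_simps(1,3)
    by (subst Henstock_Kurzweil_Integration.integral_add; (intro integrable_add integrable_on_mult_right poly_integrable_on)?)+
       (simp add: poly_fun_simps)
  also have "\<dots> = (2 * real n + 1) * ip a b (poly L) (poly L)"
    using qo by (simp add: ip_poly_eq_integral distrib_right del: poly_mult)
  finally show ?thesis by (simp add: L_def)
qed

text \<open>The Legendre components of degree k contribute the factors 2 k + 1, whose sum over k <=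
  n is (n + 1)^2. Each induction step is Cauchy--Schwarz for two terms with weights \<alpha> and
  \<beta>.\<close>

lemma poly_endpoint_bound:
  assumes ab: "a < b" and c: "c = a \<or> c = b" and "degree p \<le> n"
  shows "(b - a) * (poly p c)\<^sup>2 \<le> (real n + 1)\<^sup>2 * ip a b (poly p) (poly p)"
  using assms(3)
proof (induction n arbitrary: p)
  case 0
  then obtain k where p: "p = [:k:]" by (metis degree_eq_zeroE le_zero_eq)
  have "p = smult k (leg a b 0)" by (simp add: p leg_def)
  then show ?case
    using leg_endpoint[OF ab c, of 0] unfolding \<open>p = smult k (leg a b 0)\<close> ip_poly_smult_left ip_poly_smult_right
    by (simp add: power2_eq_square ac_simps)
next
  case (Suc n)
  define L where "L = leg a b (Suc n)"
  obtain k u where p: "p = smult k L + u" and u: "degree u \<le> n"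
    using leg_split[OF ab Suc.prems] unfolding L_def by blast
  have Lo: "ip a b (poly L) (poly u) = 0"
    using leg_orth[OF ab, of u "Suc n"] u by (simp add: L_def)
  define x where "x = k\<^sup>2 * ip a b (poly L) (poly L)"
  define y where "y = ip a b (poly u) (poly u)"
  have xy: "0 \<le> x" "0 \<le> y" by (auto simp: x_def y_def ip_self_nonneg)
  define \<alpha> where "\<alpha> = 2 * real (Suc n) + 1"
  define \<beta> where "\<beta> = (real n + 1)\<^sup>2"
  have ab0: "0 \<le> \<alpha>" "0 \<le> \<beta>" by (auto simp: \<alpha>_def \<beta>_def)
  define A where "A = sqrt (b - a) * (k * poly L c)"
  define B where "B = sqrt (b - a) * poly u c"
  have A: "A\<^sup>2 = \<alpha> * x"
  proof -
    have "A\<^sup>2 = k\<^sup>2 * ((b - a) * (poly L c)\<^sup>2)" using ab by (simp add: A_def power_mult_distrib)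
    also have "\<dots> = \<alpha> * x" unfolding L_def leg_endpoint[OF ab c] by (simp add: x_def \<alpha>_def L_def)
    finally show ?thesis .
  qed
  have B: "B\<^sup>2 \<le> \<beta> * y"
    using Suc.IH[OF u] ab by (simp add: B_def power_mult_distrib \<beta>_def y_def)
  have "2 * A * B \<le> \<alpha> * y + \<beta> * x"
  proof (rule power2_le_imp_le)
    have "(2 * A * B)\<^sup>2 = 4 * (A\<^sup>2 * B\<^sup>2)" by (simp add: power_mult_distrib)
    also have "\<dots> \<le> 4 * ((\<alpha> * x) * (\<beta> * y))"
      using A B xy ab0 by (simp add: mult_left_mono)
    also have "\<dots> \<le> (\<alpha> * y + \<beta> * x)\<^sup>2"
      using zero_le_power2[of "\<alpha> * y - \<beta> * x"] by (simp add: power2_eq_square algebra_simps)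
    finally show "(2 * A * B)\<^sup>2 \<le> (\<alpha> * y + \<beta> * x)\<^sup>2" .
  qed (use xy ab0 in auto)
  then have "(A + B)\<^sup>2 \<le> (\<alpha> + \<beta>) * (x + y)" using A B by (simp add: power2_sum algebra_simps)
  moreover have "(A + B)\<^sup>2 = (b - a) * (poly p c)\<^sup>2"
    using ab by (simp add: A_def B_def p distrib_left[symmetric] power_mult_distrib del: distrib_left)
  moreover have "ip a b (poly p) (poly p) = x + y"
    using Lo unfolding p x_def y_def ip_poly_add_left[OF in_L2_poly] ip_poly_add_right[OF in_L2_poly]
      ip_poly_smult_left ip_poly_smult_right
    by (simp add: ip_commute[of a b "poly u" "poly L"] power2_eq_square)
  moreover have "\<alpha> + \<beta> = (real (Suc n) + 1)\<^sup>2" by (simp add: \<alpha>_def \<beta>_def power2_eq_square algebra_simps)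
  ultimately show ?case by simp
qed

lemma ip_self_mono_interval:
  assumes "in_L2 a b f" "a \<le> c" "c \<le> d" "d \<le> b" shows "ip c d f f \<le> ip a b f f"
proof -
  have i: "integrable (lebesgue_on {a<..<b}) (\<lambda>x. f x * f x)" "integrable (lebesgue_on {a<..<d}) (\<lambda>x. f x * f x)"
    using in_L2_mult assms(1) in_L2_subinterval[OF assms(1), of a d] assms by auto
  have "ip a b f f = ip a c f f + ip c d f f + ip d b f f"
    using integral_Ioo_combine[OF i(1), of d] integral_Ioo_combine[OF i(2), of c] assms
    by (simp add: ip_def)
  then show ?thesis using ip_self_nonneg[of a c f] ip_self_nonneg[of d b f] by linarith
qed

text \<open>The point x is an end point of both [a,x] and [x,b]; the longer one has at least half
  the length, which costs the factor 2.\<close>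

lemma poly_pointwise_bound:
  assumes ab: "a < b" and x: "x \<in> {a..b}" and p: "degree p \<le> n"
  shows "(b - a) * (poly p x)\<^sup>2 \<le> 2 * (real n + 1)\<^sup>2 * ip a b (poly p) (poly p)"
proof (cases "x \<le> (a + b) / 2")
  case True
  then have xb: "x < b" "(b - a) / 2 \<le> b - x" using ab by (auto simp: field_simps)
  have "(b - a) / 2 * (poly p x)\<^sup>2 \<le> (b - x) * (poly p x)\<^sup>2" using xb by (intro mult_right_mono) auto
  also have "\<dots> \<le> (real n + 1)\<^sup>2 * ip x b (poly p) (poly p)" by (rule poly_endpoint_bound[OF xb(1) _ p]) simp
  also have "\<dots> \<le> (real n + 1)\<^sup>2 * ip a b (poly p) (poly p)"
    using x xb by (intro mult_left_mono ip_self_mono_interval) auto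
  finally show ?thesis by simp
next
  case False
  then have xb: "a < x" "(b - a) / 2 \<le> x - a" using ab by (auto simp: field_simps)
  have "(b - a) / 2 * (poly p x)\<^sup>2 \<le> (x - a) * (poly p x)\<^sup>2" using xb by (intro mult_right_mono) auto
  also have "\<dots> \<le> (real n + 1)\<^sup>2 * ip a x (poly p) (poly p)" by (rule poly_endpoint_bound[OF xb(1) _ p]) simp
  also have "\<dots> \<le> (real n + 1)\<^sup>2 * ip a b (poly p) (poly p)"
    using x xb by (intro mult_left_mono ip_self_mono_interval) auto
  finally show ?thesis by simp
qed

section \<open>The projection \<open>\<Pi>\<close> with \<open>(\<Pi> u)' = P\<^sub>r\<^sub>-\<^sub>1 u'\<close>\<close>

text \<open>The derivative is an argument because it is given only up to null sets; of
  \<open>u\<close> itself only the value at \<open>a\<close> enters.\<close>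

definition cg_interp :: "nat \<Rightarrow> real \<Rightarrow> real \<Rightarrow> (real \<Rightarrow> real) \<Rightarrow> (real \<Rightarrow> real) \<Rightarrow> real poly" where
  "cg_interp r a b u g = (let q = antideriv (L2_proj (r - 1) a b g) in [:u a - poly q a:] + q)"

lemma pderiv_cg_interp: "pderiv (cg_interp r a b u g) = L2_proj (r - 1) a b g"
  by (simp add: cg_interp_def Let_def pderiv_add pderiv_antideriv pderiv_pCons)

lemma poly_cg_interp_left: "poly (cg_interp r a b u g) a = u a"
  by (simp add: cg_interp_def Let_def)

lemma degree_cg_interp:
  assumes "a < b" "in_L2 a b g" "1 \<le> r" shows "degree (cg_interp r a b u g) \<le> r"
proof -
  have "degree (antideriv (L2_proj (r - 1) a b g)) \<le> Suc (r - 1)"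
    by (intro degree_antideriv degree_L2_proj assms)
  then show ?thesis using assms by (auto simp: cg_interp_def Let_def intro!: degree_add_le)
qed

lemma ac_cg_error:
  "ac a b u g \<Longrightarrow> ac a b (\<lambda>x. u x - poly (cg_interp r a b u g) x) (\<lambda>x. g x - poly (L2_proj (r - 1) a b g) x)"
  using ac_diff[OF _ ac_poly, of a b u g "cg_interp r a b u g"] by (simp add: pderiv_cg_interp)

text \<open>The residual of the derivative is orthogonal to constants, so its integral vanishes and
  exactness at \<open>a\<close> carries over to \<open>b\<close>.\<close>

lemma poly_cg_interp_right:
  assumes ab: "a < b" and u: "ac a b u g" shows "poly (cg_interp r a b u g) b = u b"
proof -
  let ?e = "\<lambda>x. g x - poly (L2_proj (r - 1) a b g) x"
  have L: "in_L2 a b g" by (rule ac_in_L2[OF u])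
  then have "in_L2 a b ?e" by auto
  then have "ip a b ?e (poly 1) = integral {a..b} ?e" by (subst ip_eq_integral) auto
  then have "integral {a..b} ?e = 0" using L2_proj_residual_orth[OF ab L, of 1 "r - 1"] by simp
  then show ?thesis
    using ac_diff_eq[OF ac_cg_error[OF u, of r], of a b] ab by (simp add: poly_cg_interp_left)
qed

lemma cg_interp_diff:
  assumes ab: "a < b" and "in_L2 a b g" "in_L2 a b h"
  shows "poly (cg_interp r a b (\<lambda>x. u x - v x) (\<lambda>x. g x - h x)) x
    = poly (cg_interp r a b u g) x - poly (cg_interp r a b v h) x"
proof -
  define d where "d = cg_interp r a b (\<lambda>x. u x - v x) (\<lambda>x. g x - h x) - (cg_interp r a b u g - cg_interp r a b v h)"
  have "pderiv d = 0" using L2_proj_diff[OF assms] by (simp add: d_def pderiv_diff pderiv_cg_interp)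
  then have "degree d = 0" by (simp add: pderiv_eq_0_iff)
  then obtain c where c: "d = [:c:]" by (metis degree_eq_zeroE)
  have "poly d a = 0" by (simp add: d_def poly_cg_interp_left)
  then have "d = 0" using c by simp
  then have "poly d x = 0" by simp
  then show ?thesis by (simp add: d_def)
qed

text \<open>Duality: with \<open>\<Psi>' = e = u - \<Pi> u\<close>, \<open>\<parallel>e\<parallel>\<^sup>2 = - (e', \<Psi>) = - (e', \<Psi> - P \<Psi>)\<close>.\<close>

lemma cg_interp_error_step:
  assumes ab: "a < b" and u: "ac a b u g" and r: "1 \<le> r"
  shows "nrm a b (\<lambda>x. u x - poly (cg_interp r a b u g) x)
    \<le> (b - a) / (2 * real r) * nrm a b (\<lambda>x. g x - poly (L2_proj (r - 1) a b g) x)"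
proof -
  define e where "e = (\<lambda>x. u x - poly (cg_interp r a b u g) x)"
  define e' where "e' = (\<lambda>x. g x - poly (L2_proj (r - 1) a b g) x)"
  have ee: "ac a b e e'" unfolding e_def e'_def by (rule ac_cg_error[OF u])
  have e0: "e a = 0" "e b = 0" using poly_cg_interp_left poly_cg_interp_right[OF ab u] by (auto simp: e_def)
  have ce: "continuous_on {a..b} e" by (rule ac_continuous[OF ee])
  have gL: "in_L2 a b g" by (rule ac_in_L2[OF u])
  have L: "in_L2 a b e'" "in_L2 a b e" using ac_in_L2[OF ee] ac_in_L2_self[OF ee] by auto
  define \<Psi> where "\<Psi> = (\<lambda>x. 0 + integral {a..x} e)"
  have P: "ac a b \<Psi> e" unfolding \<Psi>_def by (rule ac_indefinite[OF L(2)])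
  have PL: "in_L2 a b \<Psi>" by (rule ac_in_L2_self[OF P])
  have dP: "(\<Psi> has_real_derivative e x) (at x within {a..b})" if "x \<in> {a..b}" for x
    using integral_has_real_derivative[OF ce that] by (simp add: \<Psi>_def)
  \<comment> \<open>Interpolation at both ends removes the boundary terms. The first order estimate
    for \<Psi> then supplies one more factor h / (2 r).\<close>
  have "ip a b e e = - ip a b e' \<Psi>"
    using ac_integration_by_parts[OF less_imp_le[OF ab] ee dP ce] e0 by simp
  also have "ip a b e' \<Psi> = ip a b e' (\<lambda>x. \<Psi> x - poly (L2_proj (r - 1) a b \<Psi>) x)"
    using L2_proj_residual_orth[OF ab gL, of "L2_proj (r - 1) a b \<Psi>" "r - 1"]
      degree_L2_proj[OF ab PL, of "r - 1"] L PL unfolding e'_def[symmetric]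
    by (subst ip_diff_right) auto
  also have "- ip a b e' (\<lambda>x. \<Psi> x - poly (L2_proj (r - 1) a b \<Psi>) x)
     \<le> nrm a b e' * nrm a b (\<lambda>x. \<Psi> x - poly (L2_proj (r - 1) a b \<Psi>) x)"
    using ip_Cauchy_Schwarz[OF L(1), of "\<lambda>x. \<Psi> x - poly (L2_proj (r - 1) a b \<Psi>) x"] PL by fastforce
  also have "\<dots> \<le> nrm a b e' * ((b - a) / (2 * real r) * nrm a b e)"
    using proj_error_order1[OF ab P, of "r - 1"] r by (intro mult_left_mono) auto
  finally have "nrm a b e * nrm a b e \<le> ((b - a) / (2 * real r) * nrm a b e') * nrm a b e"
    by (simp add: nrm_sq[symmetric] power2_eq_square ac_simps)
  then have "nrm a b e \<le> (b - a) / (2 * real r) * nrm a b e'"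
  proof (cases "nrm a b e = 0")
    case False
    then have "0 < nrm a b e" by (simp add: less_le)
    then show ?thesis using \<open>nrm a b e * nrm a b e \<le> _\<close> mult_le_cancel_right_pos by blast
  qed (use ab in simp)
  then show ?thesis by (simp add: e_def e'_def)
qed

section \<open>Chains of derivatives\<close>

text \<open>H^k membership with all derivatives as concrete functions: below order \<open>k\<close>
  they are absolutely continuous, at order \<open>k\<close> merely square integrable.\<close>

definition chain :: "real \<Rightarrow> real \<Rightarrow> nat \<Rightarrow> (nat \<Rightarrow> real \<Rightarrow> real) \<Rightarrow> bool" where
  "chain a b k U \<longleftrightarrow> (\<forall>j<k. ac a b (U j) (U (Suc j))) \<and> in_L2 a b (U k)"

lemma chain_acD: "chain a b k U \<Longrightarrow> j < k \<Longrightarrow> ac a b (U j) (U (Suc j))"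
  by (simp add: chain_def)

lemma chain_in_L2: "chain a b k U \<Longrightarrow> j \<le> k \<Longrightarrow> in_L2 a b (U j)"
  using ac_in_L2_self[of a b "U j" "U (Suc j)"] by (cases "j = k") (auto simp: chain_def)

lemma chain_le: "chain a b k U \<Longrightarrow> j \<le> k \<Longrightarrow> chain a b j U"
  using chain_in_L2 by (auto simp: chain_def)

lemma chain_shift: "chain a b (Suc k) U \<Longrightarrow> chain a b k (\<lambda>j. U (Suc j))"
  by (auto simp: chain_def)

lemma chain_subinterval: "chain a b k U \<Longrightarrow> a \<le> c \<Longrightarrow> d \<le> b \<Longrightarrow> chain c d k U"
  using ac_subinterval in_L2_subinterval unfolding chain_def by blast

lemma chain_diff: "chain a b k U \<Longrightarrow> chain a b k V \<Longrightarrow> chain a b k (\<lambda>j x. U j x - V j x)"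
  by (auto simp: chain_def intro: ac_diff)

lemma chain_lincomb:
  assumes "finite A" "\<And>i. i \<in> A \<Longrightarrow> chain a b k (U i)"
  shows "chain a b k (\<lambda>j x. \<Sum>i\<in>A. c i * U i j x)"
  unfolding chain_def
proof (intro conjI allI impI)
  fix j assume "j < k"
  then show "ac a b (\<lambda>x. \<Sum>i\<in>A. c i * U i j x) (\<lambda>x. \<Sum>i\<in>A. c i * U i (Suc j) x)"
    using assms by (intro ac_sum ac_cmult) (auto simp: chain_def)
qed (intro in_L2_sum in_L2_cmult, use assms in \<open>auto simp: chain_def\<close>)

text \<open>Each step trades one derivative for one degree until degree 0 is reached, where the
  first order estimate ends the recursion; this explains the range of \<open>k\<close>.\<close>

lemma chain_proj_error:
  assumes ab: "a < b"
  shows "chain a b k U \<Longrightarrow> k \<le> Suc m \<Longrightarrow>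
    nrm a b (\<lambda>x. U 0 x - poly (L2_proj m a b (U 0)) x)
      \<le> (\<Prod>i<k. (b - a) / (2 * (real m + 1 - real i))) * nrm a b (U k)"
proof (induction k arbitrary: U m)
  case 0
  then show ?case
    using nrm_residual_le[OF ab, of "U 0" 0 m] by (simp add: chain_def)
next
  case (Suc k)
  have ac0: "ac a b (U 0) (U (Suc 0))" using Suc.prems by (auto simp: chain_def)
  show ?case
  proof (cases m)
    case 0
    then have "k = 0" using Suc.prems by simp
    then show ?thesis using proj_error_order1[OF ab ac0, of m] 0 by simp
  next
    case (Suc m')
    have "nrm a b (\<lambda>x. U (Suc 0) x - poly (L2_proj m' a b (U (Suc 0))) x)
      \<le> (\<Prod>i<k. (b - a) / (2 * (real m' + 1 - real i))) * nrm a b (U (Suc k))"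
      using Suc.IH[OF chain_shift[OF Suc.prems(1)], of m'] Suc.prems \<open>m = Suc m'\<close> by simp
    then have "(b - a) / (2 * (real m' + 2)) * nrm a b (\<lambda>x. U (Suc 0) x - poly (L2_proj m' a b (U (Suc 0))) x)
      \<le> (b - a) / (2 * (real m' + 2)) * ((\<Prod>i<k. (b - a) / (2 * (real m' + 1 - real i))) * nrm a b (U (Suc k)))"
      using ab by (intro mult_left_mono) auto
    then have "nrm a b (\<lambda>x. U 0 x - poly (L2_proj m a b (U 0)) x)
      \<le> (b - a) / (2 * (real m' + 2)) * ((\<Prod>i<k. (b - a) / (2 * (real m' + 1 - real i))) * nrm a b (U (Suc k)))"
      using proj_error_step[OF ab ac0, of m'] unfolding \<open>m = Suc m'\<close> by linarith
    also have "\<dots> = (\<Prod>i<Suc k. (b - a) / (2 * (real m + 1 - real i))) * nrm a b (U (Suc k))"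
      unfolding prod.lessThan_Suc_shift by (simp add: Suc algebra_simps)
    finally show ?thesis .
  qed
qed

text \<open>For i < r one has r <= 2 (i + 1) (r - i), hence h / (2 (r - i)) <= (i + 1) h / r. The
  factors i + 1 collect to a factorial, so the powers of r come out with a constant depending on k
  alone.\<close>

lemma chain_proj_error_power:
  assumes ab: "a < b" and U: "chain a b k U" and k: "k \<le> r" and r: "1 \<le> r"
  shows "nrm a b (\<lambda>x. U 0 x - poly (L2_proj (r - 1) a b (U 0)) x) \<le> fact k * ((b - a) / real r) ^ k * nrm a b (U k)"
proof -
  define h where "h = b - a"
  have h: "0 < h" using ab by (simp add: h_def)
  have "nrm a b (\<lambda>x. U 0 x - poly (L2_proj (r - 1) a b (U 0)) x)
      \<le> (\<Prod>i<k. h / (2 * (real (r - 1) + 1 - real i))) * nrm a b (U k)"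
    using chain_proj_error[OF ab U, of "r - 1"] k r by (simp add: h_def)
  also have "\<dots> \<le> (\<Prod>i<k. real (Suc i) * (h / real r)) * nrm a b (U k)"
  proof (intro mult_right_mono prod_mono conjI)
    fix i assume "i \<in> {..<k}"
    then have i: "i < r" using k by auto
    have *: "real r \<le> real (Suc i) * (2 * (real r - real i))"
    proof -
      have "r \<le> Suc i * (2 * (r - i))"
      proof -
        obtain d where d: "r = i + d" "1 \<le> d" using i by (metis less_iff_Suc_add add_Suc_right le_add1 plus_1_eq_Suc)
        have "i \<le> i * d" using mult_le_mono2[OF d(2), of i] by simp
        moreover have "Suc i * (2 * (r - i)) = 2 * d + 2 * (i * d)" using d by (simp add: algebra_simps)
        ultimately show ?thesis using d by linarith
      qed
      then have "real r \<le> real (Suc i) * real (2 * (r - i))" by (metis of_nat_mono of_nat_mult)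
      moreover have "real (2 * (r - i)) = 2 * (real r - real i)" using i by (simp add: of_nat_diff)
      ultimately show ?thesis by simp
    qed
    have ri: "0 < real r - real i" using i by simp
    show "h / (2 * (real (r - 1) + 1 - real i)) \<le> real (Suc i) * (h / real r)"
    proof -
      have "h * real r \<le> h * (real (Suc i) * (2 * (real r - real i)))" using * h by (intro mult_left_mono) auto
      then show ?thesis using r ri h by (simp add: field_simps of_nat_diff)
    qed
    show "0 \<le> h / (2 * (real (r - 1) + 1 - real i))" using h ri r by (simp add: of_nat_diff)
  qed simp
  also have "(\<Prod>i<k. real (Suc i) * (h / real r)) = fact k * (h / real r) ^ k"
    unfolding prod.distrib by (simp add: fact_prod_Suc lessThan_atLeast0 del: of_nat_Suc)
  finally show ?thesis by (simp only: h_def)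
qed

text \<open>One derivative is spent on passing from the interpolation error to the projection error
  of the derivative, at most r on the latter. Hence the order saturates at r + 1.\<close>

lemma chain_cg_error:
  assumes ab: "a < b" and U: "chain a b k U" and k: "1 \<le> k" "k \<le> Suc r" and r: "1 \<le> r"
  shows "nrm a b (\<lambda>x. U 0 x - poly (cg_interp r a b (U 0) (U 1)) x)
    \<le> fact k * ((b - a) / real r) ^ k * nrm a b (U k)"
proof -
  obtain k' where k': "k = Suc k'" using k by (cases k) auto
  define h where "h = b - a"
  have h: "0 < h" using ab by (simp add: h_def)
  have 1: "nrm a b (\<lambda>x. U 1 x - poly (L2_proj (r - 1) a b (U 1)) x) \<le> fact k' * (h / real r) ^ k' * nrm a b (U k)"
    using chain_proj_error_power[OF ab chain_shift, of k' U r] U k r by (simp add: k' h_def)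
  have "ac a b (U 0) (U 1)" using U k by (auto simp: chain_def)
  from cg_interp_error_step[OF ab this r]
  have "nrm a b (\<lambda>x. U 0 x - poly (cg_interp r a b (U 0) (U 1)) x)
    \<le> h / (2 * real r) * nrm a b (\<lambda>x. U 1 x - poly (L2_proj (r - 1) a b (U 1)) x)" by (simp add: h_def)
  also have "\<dots> \<le> h / (2 * real r) * (fact k' * (h / real r) ^ k' * nrm a b (U k))"
    using h by (intro mult_left_mono 1) auto
  also have "\<dots> \<le> h / real r * (fact k * (h / real r) ^ k' * nrm a b (U k))"
  proof (intro mult_mono)
    show "h / (2 * real r) \<le> h / real r" using h r by (simp add: field_simps)
    show "(fact k' :: real) \<le> fact k" by (rule fact_mono) (simp add: k')
  qed (use h in auto)
  finally show ?thesis by (simp add: k' h_def ac_simps)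
qed

section \<open>Approximation of functions of fractional regularity\<close>

text \<open>An integrated modulus of continuity: squared increments over the strip of half-width
  \<delta> about the diagonal. Gagliardo and Hoelder seminorms both control it, so the two scales of
  spaces share one approximation argument.\<close>

definition osc :: "real \<Rightarrow> real \<Rightarrow> real \<Rightarrow> (real \<Rightarrow> real) \<Rightarrow> ennreal" where
  "osc a b \<delta> w = (\<integral>\<^sup>+x. (\<integral>\<^sup>+y. ennreal ((w x - w y)\<^sup>2) *
     indicator {z. fst z \<in> {a<..<b} \<and> snd z \<in> {a<..<b} \<and> \<bar>fst z - snd z\<bar> \<le> \<delta>} (x, y) \<partial>lborel) \<partial>lborel)"

lemma ennreal_nrm_sq:
  assumes "in_L2 a b f"
  shows "ennreal ((nrm a b f)\<^sup>2) = (\<integral>\<^sup>+x. ennreal ((f x)\<^sup>2) * indicator {a<..<b} x \<partial>lebesgue)"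
proof -
  have "ennreal ((nrm a b f)\<^sup>2) = (\<integral>\<^sup>+x. ennreal ((f x)\<^sup>2) \<partial>lebesgue_on {a<..<b})"
    unfolding nrm_sq_integral using assms by (intro nn_integral_eq_integral[symmetric]) (auto simp: in_L2_def)
  then show ?thesis by (simp add: nn_integral_restrict_space)
qed

lemma window_integral_bound:
  assumes "in_L2 c d w" "c \<le> d"
  shows "(integral {c..d} (\<lambda>y. \<bar>w y - k\<bar>))\<^sup>2 \<le> (d - c) * (nrm c d (\<lambda>y. w y - k))\<^sup>2"
proof -
  have L: "in_L2 c d (\<lambda>y. w y - k)" using assms by auto
  then have La: "in_L2 c d (\<lambda>y. \<bar>w y - k\<bar>)" by (auto simp: in_L2_def)
  have "integral {c..d} (\<lambda>y. \<bar>w y - k\<bar>) = ip c d (\<lambda>y. \<bar>w y - k\<bar>) (\<lambda>x. 1)"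
    by (subst ip_eq_integral[OF La]) auto
  also have "\<bar>\<dots>\<bar> \<le> nrm c d (\<lambda>y. \<bar>w y - k\<bar>) * nrm c d (\<lambda>x. 1)"
    by (rule ip_Cauchy_Schwarz[OF La in_L2_const])
  also have "nrm c d (\<lambda>x. 1) = sqrt (d - c)"
    using assms by (simp add: nrm_def ip_def measure_Ioo)
  also have "nrm c d (\<lambda>y. \<bar>w y - k\<bar>) = nrm c d (\<lambda>y. w y - k)" by (simp add: nrm_def ip_def)
  finally have "\<bar>integral {c..d} (\<lambda>y. \<bar>w y - k\<bar>)\<bar> \<le> nrm c d (\<lambda>y. w y - k) * sqrt (d - c)" by (simp add: abs_if split: if_splits)
  then have "(integral {c..d} (\<lambda>y. \<bar>w y - k\<bar>))\<^sup>2 \<le> (nrm c d (\<lambda>y. w y - k) * sqrt (d - c))\<^sup>2"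
    using assms by (subst abs_le_square_iff[symmetric]) simp
  then show ?thesis using assms by (simp add: power_mult_distrib mult.commute)
qed

text \<open>The mollification is the second difference quotient, of step \<open>\<kappa> = \<delta> / 2\<close>, of a second
  antiderivative of \<open>w\<close>, taken at \<open>c(x) = a + (1 - \<delta> / h) (x - a)\<close>; the window
  \<open>[c(x), c(x) + \<delta>]\<close> contains \<open>x\<close> and stays inside \<open>[a, b]\<close>.\<close>

lemma mollification_pointwise:
  assumes ab: "a < b" and r: "1 \<le> r" and w: "in_L2 a b w"
  defines "\<delta> \<equiv> (b - a) / real r"
  shows "\<exists>v v'. continuous_on {a..b} v' \<and>
    (\<forall>x\<in>{a..b}. (v has_real_derivative v' x) (at x within {a..b})) \<and>
    (\<forall>x\<in>{a..b}. \<exists>c d. a \<le> c \<and> d \<le> b \<and> c \<le> x \<and> x \<le> d \<and> d - c = \<delta> \<and>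
       (v x - w x)\<^sup>2 \<le> 4 / \<delta> * (nrm c d (\<lambda>y. w y - w x))\<^sup>2 \<and>
       (v' x)\<^sup>2 \<le> 16 / \<delta> ^ 3 * (nrm c d (\<lambda>y. w y - w x))\<^sup>2)"
proof -
  define h where "h = b - a"
  define \<kappa> where "\<kappa> = \<delta> / 2"
  define \<alpha> where "\<alpha> = 1 - 1 / real r"
  have h: "0 < h" "0 < \<delta>" "0 < \<kappa>" "h = \<delta> * real r" using ab r by (auto simp: h_def \<delta>_def \<kappa>_def)
  have \<alpha>: "0 \<le> \<alpha>" "\<alpha> \<le> 1" using r by (auto simp: \<alpha>_def)
  define W where "W = (\<lambda>x. 0 + integral {a..x} w)"
  define V where "V = (\<lambda>x. 0 + integral {a..x} W)"
  define c where "c = (\<lambda>x. a + \<alpha> * (x - a))"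
  have acW: "ac a b W w" unfolding W_def by (rule ac_indefinite[OF w])
  have cW: "continuous_on {a..b} W" by (rule ac_continuous[OF acW])
  have dV: "(V has_real_derivative W x) (at x within {a..b})" if "x \<in> {a..b}" for x
    using integral_has_real_derivative[OF cW that] by (simp add: V_def)
  have win: "a \<le> c x" "c x \<le> x" "x \<le> c x + \<delta>" "c x + \<delta> \<le> b" if x: "x \<in> {a..b}" for x
  proof -
    have 1: "\<alpha> * (x - a) \<le> 1 * (x - a)" using \<alpha> x by (intro mult_right_mono) auto
    have 2: "(x - a) / real r \<le> \<delta>" using x by (auto simp: \<delta>_def divide_right_mono)
    have 3: "\<alpha> * (x - a) = (x - a) - (x - a) / real r" by (simp add: \<alpha>_def left_diff_distrib)
    have 4: "\<alpha> * (x - a) \<le> \<alpha> * (b - a)" using \<alpha> x by (intro mult_left_mono) auto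
    have 5: "\<alpha> * (b - a) = (b - a) - \<delta>" by (simp add: \<alpha>_def \<delta>_def left_diff_distrib)
    show "a \<le> c x" using \<alpha> x by (simp add: c_def)
    show "c x \<le> x" "x \<le> c x + \<delta>" "c x + \<delta> \<le> b" using 1 2 3 4 5 by (auto simp: c_def)
  qed
  \<comment> \<open>This is an average of w over the window with a hat-shaped kernel. A first
    difference of \<open>W\<close> would also average w, but its derivative would contain w itself;
    with second differences of \<open>V\<close> the derivative involves only the continuous function
    \<open>W\<close>.\<close>
  define v where "v = (\<lambda>x. (V (c x + \<delta>) - 2 * V (c x + \<kappa>) + V (c x)) / \<kappa>\<^sup>2)"
  define v' where "v' = (\<lambda>x. \<alpha> * (W (c x + \<delta>) - 2 * W (c x + \<kappa>) + W (c x)) / \<kappa>\<^sup>2)"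
  have "c x \<in> {a..b} \<and> c x + \<kappa> \<in> {a..b} \<and> c x + \<delta> \<in> {a..b}" if "x \<in> {a..b}" for x
    using win[OF that] h unfolding \<kappa>_def by auto
  then have sub: "c ` {a..b} \<subseteq> {a..b}" "(\<lambda>x. c x + \<kappa>) ` {a..b} \<subseteq> {a..b}" "(\<lambda>x. c x + \<delta>) ` {a..b} \<subseteq> {a..b}"
    by blast+
  have cc: "continuous_on {a..b} c" unfolding c_def by (intro continuous_intros)
  have cv': "continuous_on {a..b} v'"
    unfolding v'_def
    by (intro continuous_intros continuous_on_compose2[OF cW] cc sub) (use h in auto)
  have dc: "((\<lambda>x. c x + k) has_real_derivative \<alpha>) (at x within {a..b})" for x k
    unfolding c_def by (auto intro!: derivative_eq_intros)
  have dVc: "((\<lambda>x. V (c x + k)) has_real_derivative W (c x + k) * \<alpha>) (at x within {a..b})"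
    if x: "x \<in> {a..b}" and k: "(\<lambda>x. c x + k) ` {a..b} \<subseteq> {a..b}" for x k
  proof -
    have "c x + k \<in> {a..b}" using x k by (meson image_subset_iff)
    from DERIV_subset[OF dV[OF this] k] show ?thesis by (rule DERIV_image_chain[unfolded o_def, OF _ dc])
  qed
  have dv: "(v has_real_derivative v' x) (at x within {a..b})" if x: "x \<in> {a..b}" for x
  proof -
    have "(v has_real_derivative (W (c x + \<delta>) * \<alpha> - 2 * (W (c x + \<kappa>) * \<alpha>) + W (c x + 0) * \<alpha>) / \<kappa>\<^sup>2) (at x within {a..b})"
      unfolding v_def using dVc[OF x sub(3)] dVc[OF x sub(2)] dVc[OF x, of 0] sub(1)
      by (intro DERIV_cdivide DERIV_add DERIV_diff DERIV_cmult) auto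
    then show ?thesis by (simp add: v'_def algebra_simps)
  qed
  have main: "(v x - w x)\<^sup>2 \<le> 4 / \<delta> * (nrm (c x) (c x + \<delta>) (\<lambda>y. w y - w x))\<^sup>2 \<and>
       (v' x)\<^sup>2 \<le> 16 / \<delta> ^ 3 * (nrm (c x) (c x + \<delta>) (\<lambda>y. w y - w x))\<^sup>2" if x: "x \<in> {a..b}" for x
  proof -
    define d where "d = c x + \<delta>"
    define k where "k = w x"
    define J where "J = integral {c x..d} (\<lambda>y. \<bar>w y - k\<bar>)"
    define n2 where "n2 = (nrm (c x) d (\<lambda>y. w y - w x))\<^sup>2"
    have cd: "a \<le> c x" "d \<le> b" "c x \<le> d" "d - c x = \<delta>" using win[OF x] h by (auto simp: d_def)
    have wi: "w integrable_on {p..q}" if "c x \<le> p" "q \<le> d" for p q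
      using that cd by (intro in_L2_integrable_on_sub[OF w]) auto
    have wk: "(\<lambda>y. w y - k) absolutely_integrable_on {p..q}" if "c x \<le> p" "q \<le> d" for p q
      using that cd by (intro in_L2_absolutely_integrable_sub[OF in_L2_diff[OF w in_L2_const]]) auto
    have J2: "J\<^sup>2 \<le> \<delta> * n2"
      using window_integral_bound[OF in_L2_subinterval[OF w cd(1,2)] cd(3), of k] cd(4) by (simp add: J_def n2_def k_def)
    have piece: "\<bar>integral {p..q} (\<lambda>y. w y - k)\<bar> \<le> J" if "c x \<le> p" "q \<le> d" for p q
    proof -
      have "\<bar>integral {p..q} (\<lambda>y. w y - k)\<bar> \<le> integral {p..q} (\<lambda>y. \<bar>w y - k\<bar>)"
        using integral_norm_bound_integral[of "\<lambda>y. w y - k" "{p..q}" "\<lambda>y. \<bar>w y - k\<bar>"] wk[OF that]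
        by (auto simp: absolutely_integrable_on_def)
      also have "\<dots> \<le> J" unfolding J_def
        using that wk[of p q] wk[of "c x" d] by (intro integral_subset_le) (auto simp: absolutely_integrable_on_def)
      finally show ?thesis .
    qed
    have Wd: "W q - W p - k * (q - p) = integral {p..q} (\<lambda>y. w y - k)" if "c x \<le> p" "p \<le> q" "q \<le> d" for p q
    proof -
      have "integral {p..q} (\<lambda>y. w y - k) = integral {p..q} w - k * (q - p)"
        using that by (subst Henstock_Kurzweil_Integration.integral_diff) (auto intro: wi)
      then show ?thesis using ac_diff_eq[OF acW, of p q] that cd by simp
    qed
    have dk: "d = c x + \<kappa> + \<kappa>" by (simp add: d_def \<kappa>_def)
    have "J \<ge> 0" using piece[of "c x" "c x"] h cd by simp
    have n2: "0 \<le> n2" by (simp add: n2_def)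
    \<comment> \<open>The second difference of \<open>W\<close> is the integral of w over the right
      half of the window minus that over the left half; both halves have length \<kappa>, so the
      constant k may be subtracted from w.\<close>
    have "\<bar>W d - 2 * W (c x + \<kappa>) + W (c x)\<bar> \<le> J"
    proof -
      have "integral {c x..c x + \<kappa>} (\<lambda>y. \<bar>w y - k\<bar>) + integral {c x + \<kappa>..d} (\<lambda>y. \<bar>w y - k\<bar>) = J"
        unfolding J_def using wk[of "c x" d] h cd dk
        by (intro Henstock_Kurzweil_Integration.integral_combine) (auto simp: absolutely_integrable_on_def)
      moreover have "\<bar>integral {p..q} (\<lambda>y. w y - k)\<bar> \<le> integral {p..q} (\<lambda>y. \<bar>w y - k\<bar>)" if "c x \<le> p" "q \<le> d" for p q
        using integral_norm_bound_integral[of "\<lambda>y. w y - k" "{p..q}" "\<lambda>y. \<bar>w y - k\<bar>"] wk[OF that]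
        by (auto simp: absolutely_integrable_on_def)
      from this[of "c x" "c x + \<kappa>"] this[of "c x + \<kappa>" d]
      have "\<bar>integral {c x..c x + \<kappa>} (\<lambda>y. w y - k)\<bar> \<le> integral {c x..c x + \<kappa>} (\<lambda>y. \<bar>w y - k\<bar>)"
        "\<bar>integral {c x + \<kappa>..d} (\<lambda>y. w y - k)\<bar> \<le> integral {c x + \<kappa>..d} (\<lambda>y. \<bar>w y - k\<bar>)" using h dk by auto
      ultimately show ?thesis
        using Wd[of "c x" "c x + \<kappa>"] Wd[of "c x + \<kappa>" d] h dk by (simp add: algebra_simps)
    qed
    then have "\<bar>v' x\<bar> \<le> \<alpha> * J / \<kappa>\<^sup>2" using \<alpha> h
      by (simp add: v'_def abs_mult d_def[symmetric] divide_right_mono mult_left_mono)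
    also have "\<dots> \<le> J / \<kappa>\<^sup>2" using \<alpha> \<open>J \<ge> 0\<close> by (intro divide_right_mono mult_left_le_one_le) auto
    finally have "(v' x)\<^sup>2 \<le> (J / \<kappa>\<^sup>2)\<^sup>2" by (metis abs_ge_zero power2_abs power_mono)
    also have "\<dots> \<le> \<delta> * n2 / (\<kappa>\<^sup>2)\<^sup>2" using J2 by (simp add: power_divide divide_right_mono)
    also have "\<dots> = 16 / \<delta> ^ 3 * n2" using h by (simp add: \<kappa>_def field_simps eval_nat_numeral)
    finally have b1: "(v' x)\<^sup>2 \<le> 16 / \<delta> ^ 3 * n2" .
    \<comment> \<open>The increment of \<open>f\<close> over a step \<kappa> is the second
      difference of \<open>V\<close> minus \<kappa>^2 k, and its derivative is the integral of w - k
      over a subwindow. The mean value inequality turns this into a bound by J \<kappa>.\<close>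
    define f where "f = (\<lambda>z. V (z + \<kappa>) - V z - \<kappa> * k * z)"
    have "norm (f (c x + \<kappa>) - f (c x)) \<le> J * norm (c x + \<kappa> - c x)"
    proof (rule field_differentiable_bound[of "{c x..c x + \<kappa>}" f "\<lambda>z. W (z + \<kappa>) - W z - \<kappa> * k"])
      fix z assume z: "z \<in> {c x..c x + \<kappa>}"
      have zz: "z \<in> {a..b}" "z + \<kappa> \<in> {a..b}" using z cd dk h by auto
      have "((\<lambda>z. V (z + \<kappa>)) has_real_derivative W (z + \<kappa>) * 1) (at z within {c x..c x + \<kappa>})"
      proof (rule DERIV_image_chain[unfolded o_def, of _ _ "\<lambda>z. z + \<kappa>"])
        show "(V has_real_derivative W (z + \<kappa>)) (at (z + \<kappa>) within (\<lambda>z. z + \<kappa>) ` {c x..c x + \<kappa>})"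
          by (rule DERIV_subset[OF dV[OF zz(2)]]) (use cd dk h in auto)
      qed (auto intro!: derivative_eq_intros)
      moreover have "(V has_real_derivative W z) (at z within {c x..c x + \<kappa>})"
        by (rule DERIV_subset[OF dV[OF zz(1)]]) (use cd dk h in auto)
      ultimately show "(f has_real_derivative W (z + \<kappa>) - W z - \<kappa> * k) (at z within {c x..c x + \<kappa>})"
        unfolding f_def by (auto intro!: derivative_eq_intros)
      show "norm (W (z + \<kappa>) - W z - \<kappa> * k) \<le> J"
        using Wd[of z "z + \<kappa>"] piece[of z "z + \<kappa>"] z dk h by (simp add: mult.commute)
    qed (use h in auto)
    then have "\<bar>V d - 2 * V (c x + \<kappa>) + V (c x) - \<kappa>\<^sup>2 * k\<bar> \<le> J * \<kappa>"
      using h by (simp add: f_def dk power2_eq_square algebra_simps)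
    moreover have "v x - k = (V d - 2 * V (c x + \<kappa>) + V (c x) - \<kappa>\<^sup>2 * k) / \<kappa>\<^sup>2"
      using h by (simp add: v_def d_def diff_divide_distrib)
    ultimately have "\<bar>v x - k\<bar> \<le> J * \<kappa> / \<kappa>\<^sup>2" using h by (simp add: divide_right_mono)
    then have "\<bar>v x - k\<bar> \<le> J / \<kappa>" using h by (simp add: power2_eq_square)
    then have "(v x - k)\<^sup>2 \<le> (J / \<kappa>)\<^sup>2" by (metis abs_ge_zero power2_abs power_mono)
    also have "\<dots> \<le> \<delta> * n2 / \<kappa>\<^sup>2" using J2 by (simp add: power_divide divide_right_mono)
    also have "\<dots> = 4 / \<delta> * n2" using h by (simp add: \<kappa>_def field_simps eval_nat_numeral)
    finally show ?thesis using b1 by (simp add: n2_def k_def d_def)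
  qed
  have ex: "\<exists>c d. a \<le> c \<and> d \<le> b \<and> c \<le> x \<and> x \<le> d \<and> d - c = \<delta> \<and>
       (v x - w x)\<^sup>2 \<le> 4 / \<delta> * (nrm c d (\<lambda>y. w y - w x))\<^sup>2 \<and>
       (v' x)\<^sup>2 \<le> 16 / \<delta> ^ 3 * (nrm c d (\<lambda>y. w y - w x))\<^sup>2" if x: "x \<in> {a..b}" for x
    using win[OF x] main[OF x] by (intro exI[of _ "c x"] exI[of _ "c x + \<delta>"]) auto
  show ?thesis
    by (rule exI[of _ v], rule exI[of _ v'], rule conjI[OF cv' conjI]) (use dv ex in blast)+
qed

text \<open>Every window of length \<delta> containing x lies in the slice of the strip over x, so
  integrating the pointwise hypothesis over x gives the oscillation. Borel measurability of
  \<open>w\<close> makes the inner integral a measurable function of x.\<close>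

lemma nrm_sq_le_osc:
  assumes w: "w \<in> borel_measurable borel" "in_L2 a b w" and f: "in_L2 a b f" and K: "0 \<le> K"
    and "osc a b \<delta> w \<le> ennreal e" "0 \<le> e"
    and win: "\<And>x. x \<in> {a<..<b} \<Longrightarrow> \<exists>c d. a \<le> c \<and> d \<le> b \<and> c \<le> x \<and> x \<le> d \<and> d - c = \<delta> \<and>
      (f x)\<^sup>2 \<le> K * (nrm c d (\<lambda>y. w y - w x))\<^sup>2"
  shows "(nrm a b f)\<^sup>2 \<le> K * e"
proof -
  note [measurable] = w(1)
  define q where "q = (\<lambda>x. \<integral>\<^sup>+y. ennreal ((w x - w y)\<^sup>2) *
     indicator {z. fst z \<in> {a<..<b} \<and> snd z \<in> {a<..<b} \<and> \<bar>fst z - snd z\<bar> \<le> \<delta>} (x, y) \<partial>lborel)"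
  have qm [measurable]: "q \<in> borel_measurable borel"
    unfolding q_def by measurable
  have "ennreal ((f x)\<^sup>2) * indicator {a<..<b} x \<le> ennreal K * q x" for x
  proof (cases "x \<in> {a<..<b}")
    case True
    then obtain c d where cd: "a \<le> c" "d \<le> b" "c \<le> x" "x \<le> d" "d - c = \<delta>"
      "(f x)\<^sup>2 \<le> K * (nrm c d (\<lambda>y. w y - w x))\<^sup>2" using win by blast
    have L: "in_L2 c d (\<lambda>y. w y - w x)" using in_L2_subinterval[OF w(2) cd(1,2)] by auto
    have "ennreal ((nrm c d (\<lambda>y. w y - w x))\<^sup>2) = (\<integral>\<^sup>+y. ennreal ((w y - w x)\<^sup>2) * indicator {c<..<d} y \<partial>lebesgue)"
      by (rule ennreal_nrm_sq[OF L])
    also have "\<dots> = (\<integral>\<^sup>+y. ennreal ((w y - w x)\<^sup>2) * indicator {c<..<d} y \<partial>lborel)"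
      by (rule nn_integral_completion) measurable
    also have "\<dots> \<le> q x" unfolding q_def
      using True cd by (intro nn_integral_mono) (auto split: split_indicator simp: power2_commute)
    finally have "ennreal K * ennreal ((nrm c d (\<lambda>y. w y - w x))\<^sup>2) \<le> ennreal K * q x"
      by (intro mult_left_mono) auto
    moreover have "ennreal ((f x)\<^sup>2) \<le> ennreal K * ennreal ((nrm c d (\<lambda>y. w y - w x))\<^sup>2)"
      using cd(6) K by (simp add: ennreal_mult[symmetric] ennreal_leI)
    ultimately show ?thesis using True by (auto intro: order_trans)
  qed simp
  then have "(\<integral>\<^sup>+x. ennreal ((f x)\<^sup>2) * indicator {a<..<b} x \<partial>lebesgue) \<le> (\<integral>\<^sup>+x. ennreal K * q x \<partial>lebesgue)"
    by (intro nn_integral_mono)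
  also have "\<dots> = (\<integral>\<^sup>+x. ennreal K * q x \<partial>lborel)" by (rule nn_integral_completion) measurable
  also have "\<dots> = ennreal K * osc a b \<delta> w" 
    unfolding osc_def q_def[symmetric] by (rule nn_integral_cmult) measurable
  also have "\<dots> \<le> ennreal K * ennreal e" using assms by (intro mult_left_mono) auto
  finally have "ennreal ((nrm a b f)\<^sup>2) \<le> ennreal (K * e)"
    using K by (simp add: ennreal_nrm_sq[OF f] ennreal_mult' )
  then show ?thesis using K assms by (simp add: ennreal_le_iff)
qed

lemma in_L2_iterated_integral:
  "in_L2 a b f \<Longrightarrow> in_L2 a b (((\<lambda>f x. integral {a..x} f) ^^ n) f)"
proof (induction n)
  case (Suc n)
  then show ?case
    using ac_in_L2_self[OF ac_indefinite[of a b "((\<lambda>f x. integral {a..x} f) ^^ n) f" 0]] by simp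
qed simp

text \<open>\<open>U\<close> is split into \<open>U - V\<close> and \<open>V\<close>, where the k-th
  derivative of \<open>V\<close> is the mollification. The first part has k derivatives and a small
  top one, the second has k + 1 derivatives with a top one larger by 1 / \<delta>, which the
  additional factor \<delta> = h / r offsets. The constants 2 and 4 add up to 6.\<close>

lemma chain_cg_error_osc:
  assumes ab: "a < b" and U: "chain a b k U" and Ub: "U k \<in> borel_measurable borel"
    and k: "1 \<le> k" "k \<le> r" and e: "osc a b ((b - a) / real r) (U k) \<le> ennreal e" "0 \<le> e"
  shows "nrm a b (\<lambda>x. U 0 x - poly (cg_interp r a b (U 0) (U 1)) x)
    \<le> 6 * fact (Suc k) * ((b - a) / real r) ^ k * sqrt (e / ((b - a) / real r))"
proof -
  define \<delta> where "\<delta> = (b - a) / real r"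
  have r: "1 \<le> r" using k by simp
  have \<delta>: "0 < \<delta>" using ab r by (simp add: \<delta>_def)
  have UL: "in_L2 a b (U k)" using U by (simp add: chain_def)
  obtain v v' where v0: "continuous_on {a..b} v' \<and>
    (\<forall>x\<in>{a..b}. (v has_real_derivative v' x) (at x within {a..b})) \<and>
    (\<forall>x\<in>{a..b}. \<exists>c d. a \<le> c \<and> d \<le> b \<and> c \<le> x \<and> x \<le> d \<and> d - c = \<delta> \<and>
       (v x - U k x)\<^sup>2 \<le> 4 / \<delta> * (nrm c d (\<lambda>y. U k y - U k x))\<^sup>2 \<and>
       (v' x)\<^sup>2 \<le> 16 / \<delta> ^ 3 * (nrm c d (\<lambda>y. U k y - U k x))\<^sup>2)"
    using mollification_pointwise[OF ab r UL, folded \<delta>_def] by (elim exE)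
  note v = v0[THEN conjunct1] v0[THEN conjunct2, THEN conjunct1, rule_format]
  note win = v0[THEN conjunct2, THEN conjunct2, rule_format]
  have acv: "ac a b v v'" by (rule ac_C1[OF v(2,1)])
  have vL: "in_L2 a b v" "in_L2 a b v'" using ac_in_L2_self[OF acv] ac_in_L2[OF acv] .
  \<comment> \<open>Any k-fold primitive of \<open>v\<close> serves, since only its derivatives of
    order k and k + 1 enter the bounds.\<close>
  define V where "V = (\<lambda>j. if j = Suc k then v' else ((\<lambda>f x. integral {a..x} f) ^^ (k - j)) v)"
  have Vk: "V k = v" "V (Suc k) = v'" by (auto simp: V_def)
  have VL: "in_L2 a b (V j)" if "j \<le> k" for j
    using in_L2_iterated_integral[OF vL(1)] that by (simp add: V_def)
  have Vj: "ac a b (V j) (V (Suc j))" if "j < k" for j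
  proof -
    have "k - j = Suc (k - Suc j)" using that by simp
    then have "V j = (\<lambda>x. 0 + integral {a..x} (V (Suc j)))" using that by (auto simp: V_def)
    then show ?thesis using ac_indefinite[OF VL[of "Suc j"], of 0] that by simp
  qed
  have cV: "chain a b (Suc k) V"
    unfolding chain_def using Vj acv vL by (auto simp: less_Suc_eq Vk)
  have cUV: "chain a b k (\<lambda>j x. U j x - V j x)"
    by (rule chain_diff[OF U chain_le[OF cV]]) simp
  have n1: "nrm a b (\<lambda>x. U k x - V k x) \<le> 2 * sqrt (e / \<delta>)"
  proof -
    have "(nrm a b (\<lambda>x. U k x - V k x))\<^sup>2 \<le> 4 / \<delta> * e"
    proof (rule nrm_sq_le_osc[OF Ub UL _ _ e])
      show "in_L2 a b (\<lambda>x. U k x - V k x)" using UL VL by auto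
      fix x assume "x \<in> {a<..<b}"
      then show "\<exists>c d. a \<le> c \<and> d \<le> b \<and> c \<le> x \<and> x \<le> d \<and> d - c = (b - a) / real r \<and>
        (U k x - V k x)\<^sup>2 \<le> 4 / \<delta> * (nrm c d (\<lambda>y. U k y - U k x))\<^sup>2"
        using win[of x] unfolding Vk(1) \<delta>_def[symmetric] power2_commute[of "U k x" "v x"] by force
    qed (use \<delta> in auto)
    also have "\<dots> = (2 * sqrt (e / \<delta>))\<^sup>2" using e \<delta> by (simp add: power_mult_distrib)
    finally show ?thesis by (rule power2_le_imp_le) (use e \<delta> in auto)
  qed
  have n2: "nrm a b (V (Suc k)) \<le> 4 / \<delta> * sqrt (e / \<delta>)"
  proof -
    have "(nrm a b (V (Suc k)))\<^sup>2 \<le> 16 / \<delta> ^ 3 * e"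
    proof (rule nrm_sq_le_osc[OF Ub UL _ _ e])
      show "in_L2 a b (V (Suc k))" using vL by (simp add: Vk)
      fix x assume "x \<in> {a<..<b}"
      then show "\<exists>c d. a \<le> c \<and> d \<le> b \<and> c \<le> x \<and> x \<le> d \<and> d - c = (b - a) / real r \<and>
        (V (Suc k) x)\<^sup>2 \<le> 16 / \<delta> ^ 3 * (nrm c d (\<lambda>y. U k y - U k x))\<^sup>2"
        using win[of x] unfolding Vk(2) \<delta>_def[symmetric] by force
    qed (use \<delta> in auto)
    also have "\<dots> = (4 / \<delta> * sqrt (e / \<delta>))\<^sup>2" using e \<delta> by (simp add: power_mult_distrib power_divide eval_nat_numeral)
    finally show ?thesis by (rule power2_le_imp_le) (use e \<delta> in auto)
  qed
  let ?E = "\<lambda>X x. X 0 x - poly (cg_interp r a b (X 0) (X (1::nat))) x"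
  have U1: "in_L2 a b (U 1)" "in_L2 a b (V 1)" using chain_in_L2[OF U k(1)] chain_in_L2[OF cV, of 1] by auto
  have e1: "nrm a b (?E (\<lambda>j x. U j x - V j x)) \<le> fact k * \<delta> ^ k * (2 * sqrt (e / \<delta>))"
    using chain_cg_error[OF ab cUV k(1) _ r] k n1 \<delta>
    by (intro order_trans[OF _ mult_left_mono[OF n1]]) (auto simp: \<delta>_def[symmetric])
  have e2: "nrm a b (?E V) \<le> fact (Suc k) * \<delta> ^ Suc k * (4 / \<delta> * sqrt (e / \<delta>))"
    using chain_cg_error[OF ab cV _ _ r] k n2 \<delta>
    by (intro order_trans[OF _ mult_left_mono[OF n2]]) (auto simp: \<delta>_def[symmetric] simp del: fact_Suc)
  have L: "in_L2 a b (?E V)" "in_L2 a b (?E (\<lambda>j x. U j x - V j x))"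
    using chain_in_L2[OF cV, of 0] chain_in_L2[OF U, of 0] by auto
  have "?E U = (\<lambda>x. ?E (\<lambda>j x. U j x - V j x) x + ?E V x)"
    using cg_interp_diff[OF ab U1, of r "U 0" "V 0"] by auto
  then have "nrm a b (?E U) \<le> nrm a b (?E (\<lambda>j x. U j x - V j x)) + nrm a b (?E V)"
    using nrm_triangle[OF L(2,1)] by simp
  also have "\<dots> \<le> fact (Suc k) * \<delta> ^ k * (2 * sqrt (e / \<delta>)) + fact (Suc k) * \<delta> ^ k * (4 * sqrt (e / \<delta>))"
  proof (rule add_mono)
    have "fact k * \<delta> ^ k * (2 * sqrt (e / \<delta>)) \<le> fact (Suc k) * \<delta> ^ k * (2 * sqrt (e / \<delta>))"
      using \<delta> e by (intro mult_right_mono fact_mono) auto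
    then show "nrm a b (?E (\<lambda>j x. U j x - V j x)) \<le> fact (Suc k) * \<delta> ^ k * (2 * sqrt (e / \<delta>))"
      using e1 by linarith
    show "nrm a b (?E V) \<le> fact (Suc k) * \<delta> ^ k * (4 * sqrt (e / \<delta>))" using e2 \<delta> by (simp del: fact_Suc)
  qed
  also have "\<dots> = 6 * fact (Suc k) * \<delta> ^ k * sqrt (e / \<delta>)" by simp
  finally show ?thesis by (simp only: \<delta>_def)
qed

section \<open>Test functions\<close>

definition smooth_fun :: "(real \<Rightarrow> real) \<Rightarrow> bool" where
  "smooth_fun \<phi> \<longleftrightarrow> (\<forall>k x. (deriv ^^ k) \<phi> differentiable (at x))"

text \<open>Coinduction for smoothness: a class closed under differentiation consists of smooth
  functions.\<close>

lemma smooth_funI: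
  assumes "\<phi> \<in> S" "\<And>g. g \<in> S \<Longrightarrow> \<exists>g'\<in>S. \<forall>x. (g has_real_derivative g' x) (at x)"
  shows "smooth_fun \<phi>"
proof -
  have "(deriv ^^ k) \<phi> \<in> S" for k
  proof (induction k)
    case (Suc k)
    then obtain g' where g': "g' \<in> S" "\<forall>x. ((deriv ^^ k) \<phi> has_real_derivative g' x) (at x)"
      using assms(2) by blast
    then have "deriv ((deriv ^^ k) \<phi>) = g'" by (intro ext DERIV_imp_deriv) auto
    then show ?case using g' by simp
  qed (simp add: assms)
  then show ?thesis unfolding smooth_fun_def using assms(2)
    by (meson real_differentiable_def)
qed

lemma smooth_fun_DERIV:
  assumes "smooth_fun \<phi>" shows "(\<phi> has_real_derivative deriv \<phi> x) (at x)"
proof -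
  have "\<phi> differentiable (at x)" using assms unfolding smooth_fun_def by (metis funpow_0)
  then show ?thesis by (metis DERIV_imp_deriv real_differentiable_def)
qed

lemma smooth_fun_deriv:
  assumes "smooth_fun \<phi>" shows "smooth_fun (deriv \<phi>)"
  unfolding smooth_fun_def
proof (intro allI)
  fix k x
  show "(deriv ^^ k) (deriv \<phi>) differentiable at x"
    using assms unfolding smooth_fun_def by (metis funpow_Suc_right o_apply)
qed

lemma smooth_fun_iterate: "smooth_fun \<phi> \<Longrightarrow> smooth_fun ((deriv ^^ k) \<phi>)"
  by (induction k) (auto intro: smooth_fun_deriv)

lemma smooth_fun_lincomb:
  assumes "smooth_fun \<phi>" "smooth_fun \<psi>" shows "smooth_fun (\<lambda>x. \<phi> x + c * \<psi> x)"
proof (rule smooth_funI[where S = "range (\<lambda>k x. (deriv ^^ k) \<phi> x + c * (deriv ^^ k) \<psi> x)"])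
  show "(\<lambda>x. \<phi> x + c * \<psi> x) \<in> range (\<lambda>k x. (deriv ^^ k) \<phi> x + c * (deriv ^^ k) \<psi> x)"
    by (rule range_eqI[of _ _ 0]) simp
  fix g assume "g \<in> range (\<lambda>k x. (deriv ^^ k) \<phi> x + c * (deriv ^^ k) \<psi> x)"
  then obtain k where g: "g = (\<lambda>x. (deriv ^^ k) \<phi> x + c * (deriv ^^ k) \<psi> x)" by blast
  have "(g has_real_derivative (deriv ^^ Suc k) \<phi> x + c * (deriv ^^ Suc k) \<psi> x) (at x)" for x
    unfolding g using smooth_fun_DERIV[OF smooth_fun_iterate[OF assms(1)], of k x]
      smooth_fun_DERIV[OF smooth_fun_iterate[OF assms(2)], of k x]
    by (auto intro!: derivative_eq_intros)
  then show "\<exists>g'\<in>range (\<lambda>k x. (deriv ^^ k) \<phi> x + c * (deriv ^^ k) \<psi> x). \<forall>x. (g has_real_derivative g' x) (at x)"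
    by (intro bexI[of _ "\<lambda>x. (deriv ^^ Suc k) \<phi> x + c * (deriv ^^ Suc k) \<psi> x"] allI rangeI)
qed

text \<open>The derivatives of \<open>exp (-1/x)\<close> on the positive half line are of the form \<open>P (1/x) exp (-1/x)\<close>.\<close>

definition flat_fun :: "real poly \<Rightarrow> real \<Rightarrow> real" where
  "flat_fun P x = (if 0 < x then poly P (1 / x) * exp (- (1 / x)) else 0)"

lemma flat_fun_tendsto_0: "(flat_fun P \<longlongrightarrow> 0) (at 0)"
proof -
  have "((\<lambda>t. \<Sum>i\<le>degree P. coeff P i * (t ^ i / exp t)) \<longlongrightarrow> (\<Sum>i\<le>degree P. coeff P i * 0)) at_top"
    by (intro tendsto_sum tendsto_mult tendsto_const tendsto_power_div_exp_0)
  then have "((\<lambda>t. poly P t * exp (- t)) \<longlongrightarrow> 0) at_top"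
    by (simp add: poly_altdef sum_distrib_right exp_minus divide_inverse mult.assoc)
  then have "((\<lambda>x. poly P (inverse x) * exp (- (inverse x))) \<longlongrightarrow> 0) (at_right 0)"
    by (rule filterlim_compose[OF _ filterlim_inverse_at_top_right])
  then have r: "(flat_fun P \<longlongrightarrow> 0) (at_right 0)"
    by (rule Lim_transform_eventually)
      (auto simp: flat_fun_def inverse_eq_divide eventually_at_filter intro!: always_eventually)
  have l: "(flat_fun P \<longlongrightarrow> 0) (at_left 0)"
    by (rule Lim_transform_eventually[OF tendsto_const])
      (auto simp: flat_fun_def eventually_at_filter intro!: always_eventually)
  show ?thesis using l r by (simp add: filterlim_split_at_real)
qed

text \<open>With t = 1/x, differentiation in x is -t^2 d/dt, and d/dt of P(t) exp(-t) is (P' - P)(t)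
  exp(-t); this is the new polynomial. At 0 both one-sided pictures must agree.\<close>

lemma flat_fun_DERIV:
  "(flat_fun P has_real_derivative flat_fun ([:0, 0, 1:] * (P - pderiv P)) x) (at x)"
proof -
  consider "x < 0" | "x = 0" | "0 < x" by linarith
  then show ?thesis
  proof cases
    case 1
    have "((\<lambda>x. 0) has_real_derivative 0) (at x)" by simp
    then have "(flat_fun P has_real_derivative 0) (at x)"
      by (rule has_field_derivative_transform_within[where d = "-x"]) (use 1 in \<open>auto simp: flat_fun_def dist_real_def\<close>)
    then show ?thesis using 1 by (simp add: flat_fun_def)
  next
    case 2
    \<comment> \<open>Dividing by y multiplies P(1/y) by 1/y, so the difference quotient at 0 is
      again a flat function and tends to 0.\<close>
    have "((\<lambda>y. (flat_fun P y - flat_fun P 0) / (y - 0)) \<longlongrightarrow> 0) (at 0)"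
      by (rule Lim_transform_eventually[OF flat_fun_tendsto_0[of "[:0, 1:] * P"]])
        (auto simp: flat_fun_def eventually_at_filter intro!: always_eventually)
    then show ?thesis using 2 by (simp add: has_field_derivative_iff flat_fun_def)
  next
    case 3
    have "((\<lambda>x. poly P (1 / x) * exp (- (1 / x))) has_real_derivative
       poly ([:0, 0, 1:] * (P - pderiv P)) (1 / x) * exp (- (1 / x))) (at x)"
      using 3 by (auto intro!: derivative_eq_intros poly_DERIV[THEN DERIV_chain2] simp: field_simps power2_eq_square)
    then have "(flat_fun P has_real_derivative
       poly ([:0, 0, 1:] * (P - pderiv P)) (1 / x) * exp (- (1 / x))) (at x)"
      by (rule has_field_derivative_transform_within[where d = x]) (use 3 in \<open>auto simp: flat_fun_def dist_real_def abs_if split: if_splits\<close>)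
    then show ?thesis using 3 by (simp add: flat_fun_def)
  qed
qed

text \<open>The class to which \<open>smooth_funI\<close> is applied: it contains the bumps, which
  are products of two affinely transformed flat functions, and is closed under
  differentiation.\<close>

inductive_set flat_algebra :: "(real \<Rightarrow> real) set" where
  flat: "(\<lambda>x. flat_fun P (c * x + d)) \<in> flat_algebra"
| add: "f \<in> flat_algebra \<Longrightarrow> g \<in> flat_algebra \<Longrightarrow> (\<lambda>x. f x + g x) \<in> flat_algebra"
| mult: "f \<in> flat_algebra \<Longrightarrow> g \<in> flat_algebra \<Longrightarrow> (\<lambda>x. f x * g x) \<in> flat_algebra"
| scale: "f \<in> flat_algebra \<Longrightarrow> (\<lambda>x. k * f x) \<in> flat_algebra"

lemma flat_algebra_deriv:
  "f \<in> flat_algebra \<Longrightarrow> \<exists>g\<in>flat_algebra. \<forall>x. (f has_real_derivative g x) (at x)"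
proof (induction rule: flat_algebra.induct)
  case (flat P c d)
  let ?Q = "[:0, 0, 1:] * (P - pderiv P)"
  have "((\<lambda>x. flat_fun P (c * x + d)) has_real_derivative flat_fun ?Q (c * x + d) * c) (at x)" for x
    by (rule DERIV_chain2[OF flat_fun_DERIV]) (auto intro!: derivative_eq_intros)
  then show ?case
    by (intro bexI[of _ "\<lambda>x. c * flat_fun ?Q (c * x + d)"] flat_algebra.intros) (simp add: mult.commute)
next
  case (add f g)
  then obtain f' g' where "f' \<in> flat_algebra" "g' \<in> flat_algebra"
    "\<forall>x. (f has_real_derivative f' x) (at x)" "\<forall>x. (g has_real_derivative g' x) (at x)" by blast
  then show ?case
    by (intro bexI[of _ "\<lambda>x. f' x + g' x"] flat_algebra.intros) (auto intro: DERIV_add)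
next
  case (mult f g)
  then obtain f' g' where "f' \<in> flat_algebra" "g' \<in> flat_algebra"
    "\<forall>x. (f has_real_derivative f' x) (at x)" "\<forall>x. (g has_real_derivative g' x) (at x)" by blast
  then show ?case using mult.hyps
    by (intro bexI[of _ "\<lambda>x. f' x * g x + g' x * f x"] flat_algebra.intros) (auto intro: DERIV_mult)
next
  case (scale f k)
  then obtain f' where "f' \<in> flat_algebra" "\<forall>x. (f has_real_derivative f' x) (at x)" by blast
  then show ?case
    by (intro bexI[of _ "\<lambda>x. k * f' x"] flat_algebra.intros) (auto intro: DERIV_cmult)
qed

text \<open>As n grows the flanks at p and q steepen and the bumps increase to the indicator of
  (p,q), so integrals over subintervals become limits of integrals against test functions.\<close>

definition bump :: "real \<Rightarrow> real \<Rightarrow> nat \<Rightarrow> real \<Rightarrow> real" where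
  "bump p q n x = flat_fun 1 (real (Suc n) * x + (- (real (Suc n) * p))) * flat_fun 1 (- real (Suc n) * x + real (Suc n) * q)"

lemma bump_eq:
  "bump p q n x = (if p < x \<and> x < q
     then exp (- (1 / (real (Suc n) * (x - p)))) * exp (- (1 / (real (Suc n) * (q - x)))) else 0)"
proof -
  have 1: "real (Suc n) * x + (- (real (Suc n) * p)) = real (Suc n) * (x - p)"
    "- real (Suc n) * x + real (Suc n) * q = real (Suc n) * (q - x)" by (simp_all add: algebra_simps)
  show ?thesis unfolding bump_def 1 flat_fun_def by (auto simp: zero_less_mult_iff simp del: of_nat_Suc)
qed

lemma test_function_bump:
  assumes "a < p" "q < b" shows "test_function a b (bump p q n)"
proof -
  have "bump p q n \<in> flat_algebra"
    unfolding bump_def[abs_def] by (intro flat_algebra.intros)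
  then have "smooth_fun (bump p q n)" by (rule smooth_funI[OF _ flat_algebra_deriv])
  moreover have "\<forall>x. x \<notin> {p..q} \<longrightarrow> bump p q n x = 0" by (auto simp: bump_eq)
  ultimately show ?thesis unfolding test_function_def smooth_fun_def using assms by blast
qed

lemma bump_bounds: "0 \<le> bump p q n x" "bump p q n x \<le> 1"
  by (auto simp: bump_eq intro!: mult_le_one)

lemma bump_tendsto: "(\<lambda>n. bump p q n x) \<longlonglongrightarrow> indicator {p<..<q} x"
proof (cases "x \<in> {p<..<q}")
  case True
  have i: "(\<lambda>n. - (1 / (real (Suc n) * d))) \<longlonglongrightarrow> 0" for d
  proof -
    have "(\<lambda>n. - (inverse (real (Suc n)) * (1 / d))) \<longlonglongrightarrow> - (0 * (1 / d))"
      by (intro tendsto_intros LIMSEQ_inverse_real_of_nat)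
    then show ?thesis by (simp add: divide_inverse)
  qed
  have "(\<lambda>n. exp (- (1 / (real (Suc n) * (x - p)))) * exp (- (1 / (real (Suc n) * (q - x))))) \<longlonglongrightarrow> exp 0 * exp 0"
    by (intro tendsto_mult tendsto_exp i)
  then show ?thesis using True by (simp add: bump_eq del: of_nat_Suc)
qed (auto simp: bump_eq)

section \<open>Closure properties of test functions\<close>

lemma test_function_smooth: "test_function a b \<phi> \<Longrightarrow> smooth_fun \<phi>"
  by (simp add: test_function_def smooth_fun_def)

lemma test_functionE:
  assumes "test_function a b \<phi>"
  obtains c d where "a < c" "d < b" "\<And>x. x \<notin> {c..d} \<Longrightarrow> \<phi> x = 0"
  using assms unfolding test_function_def by blast

lemma test_functionI:
  "smooth_fun \<phi> \<Longrightarrow> a < c \<Longrightarrow> d < b \<Longrightarrow> (\<And>x. x \<notin> {c..d} \<Longrightarrow> \<phi> x = 0) \<Longrightarrow> test_function a b \<phi>"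
  unfolding test_function_def smooth_fun_def by blast

lemma test_function_deriv:
  assumes "test_function a b \<phi>" shows "test_function a b (deriv \<phi>)"
proof -
  obtain c d where cd: "a < c" "d < b" "\<And>x. x \<notin> {c..d} \<Longrightarrow> \<phi> x = 0" using test_functionE[OF assms] by blast
  show ?thesis
  proof (rule test_functionI[OF smooth_fun_deriv[OF test_function_smooth[OF assms]] cd(1,2)])
    fix x assume x: "x \<notin> {c..d}"
    have "((\<lambda>x. 0) has_real_derivative 0) (at x)" by simp
    then have "(\<phi> has_real_derivative 0) (at x)"
      by (rule DERIV_cong_ev[THEN iffD1, rotated -1, OF _ refl _ refl])
        (rule eventually_mono[OF eventually_nhds_in_open[of "- {c..d}"]], use x cd(3) in auto)
    then show "deriv \<phi> x = 0" by (rule DERIV_imp_deriv)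
  qed
qed

lemma test_function_iterate: "test_function a b \<phi> \<Longrightarrow> test_function a b ((deriv ^^ k) \<phi>)"
  by (induction k) (auto intro: test_function_deriv)

lemma test_function_lincomb:
  assumes "test_function a b \<phi>" "test_function a b \<psi>" shows "test_function a b (\<lambda>x. \<phi> x + k * \<psi> x)"
proof -
  obtain c d where cd: "a < c" "d < b" "\<And>x. x \<notin> {c..d} \<Longrightarrow> \<phi> x = 0" using test_functionE[OF assms(1)] by blast
  obtain c' d' where cd': "a < c'" "d' < b" "\<And>x. x \<notin> {c'..d'} \<Longrightarrow> \<psi> x = 0" using test_functionE[OF assms(2)] by blast
  show ?thesis
  proof (rule test_functionI[of _ _ "min c c'" "max d d'"])
    show "smooth_fun (\<lambda>x. \<phi> x + k * \<psi> x)" by (intro smooth_fun_lincomb test_function_smooth[OF assms(1)] test_function_smooth[OF assms(2)])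
    fix x assume "x \<notin> {min c c'..max d d'}"
    then have "x \<notin> {c..d}" "x \<notin> {c'..d'}" by auto
    then show "\<phi> x + k * \<psi> x = 0" using cd(3) cd'(3) by simp
  qed (use cd cd' in auto)
qed

lemma test_function_continuous: "test_function a b \<phi> \<Longrightarrow> continuous_on S \<phi>"
  using DERIV_isCont[OF smooth_fun_DERIV[OF test_function_smooth]] continuous_at_imp_continuous_on by blast

lemma test_function_in_L2: "test_function a b \<phi> \<Longrightarrow> in_L2 c d \<phi>"
  by (intro in_L2_continuous test_function_continuous)

lemma test_function_endpoints:
  assumes "test_function a b \<phi>" shows "\<phi> a = 0" "\<phi> b = 0"
  using assms by (auto simp: test_function_def)

text \<open>The primitive from \<open>a\<close> vanishes to the left of the support, and zero mean
  makes it vanish to the right as well, so its support stays compact in the interval.\<close>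

lemma test_function_antiderivative:
  assumes t: "test_function a b \<psi>" and z: "integral {a..b} \<psi> = 0"
  shows "\<exists>\<Phi>. test_function a b \<Phi> \<and> deriv \<Phi> = \<psi>"
proof -
  obtain c d where cd: "a < c" "d < b" "\<And>x. x \<notin> {c..d} \<Longrightarrow> \<psi> x = 0" using test_functionE[OF t] by blast
  have cont: "continuous_on S \<psi>" for S by (rule test_function_continuous[OF t])
  have int: "\<psi> integrable_on {p..q}" for p q by (rule integrable_continuous_real[OF cont])
  define \<Phi> where "\<Phi> = (\<lambda>x. integral {a..x} \<psi>)"
  have zero: "integral {p..q} \<psi> = 0" if "\<And>x. p \<le> x \<Longrightarrow> x \<le> q \<Longrightarrow> x \<notin> {c..d}" for p q
    using that cd(3) by (intro integral_unique has_integral_is_0) auto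
  have left: "\<Phi> x = 0" if "x < c" for x
    unfolding \<Phi>_def using that by (intro zero) auto
  have right: "\<Phi> x = 0" if x: "d < x" for x
  proof (cases "a \<le> x")
    case True
    \<comment> \<open>The point x may lie beyond b; on [a, max x b] both the primitive at x and the
      integral over [a,b] can be compared.\<close>
    have "integral {a..max x b} \<psi> = \<Phi> x + integral {x..max x b} \<psi>"
      using Henstock_Kurzweil_Integration.integral_combine[of a x "max x b" \<psi>] True int by (simp add: \<Phi>_def)
    moreover have "integral {x..max x b} \<psi> = 0" using x by (intro zero) auto
    moreover have "integral {a..max x b} \<psi> = integral {a..b} \<psi>"
    proof (cases "a \<le> b")
      case True
      have "integral {b..max x b} \<psi> = 0" using cd(2) by (intro zero) auto
      then show ?thesis
        using Henstock_Kurzweil_Integration.integral_combine[of a b "max x b" \<psi>] int True by simp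
    next
      case False
      then have "d < c" using cd by simp
      then show ?thesis using zero[of a "max x b"] zero[of a b] by simp
    qed
    ultimately show ?thesis using z by simp
  qed (simp add: \<Phi>_def)
  have D: "(\<Phi> has_real_derivative \<psi> x) (at x)" for x
  proof (cases "a < x")
    case True
    have "(\<Phi> has_real_derivative \<psi> x) (at x within {a..x+1})"
      unfolding \<Phi>_def by (rule integral_has_real_derivative[OF cont]) (use True in auto)
    then show ?thesis using True by (metis at_within_Icc_at less_add_one)
  next
    case False
    then have x: "x < c" using cd by simp
    have "((\<lambda>x. 0) has_real_derivative 0) (at x)" by simp
    then have "(\<Phi> has_real_derivative 0) (at x)"
      by (rule has_field_derivative_transform_within[where d = "c - x"]) (use x left in \<open>auto simp: dist_real_def\<close>)
    then show ?thesis using cd(3)[of x] x by simp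
  qed
  then have d: "deriv \<Phi> = \<psi>" by (intro ext DERIV_imp_deriv)
  have "smooth_fun \<Phi>" unfolding smooth_fun_def
  proof (intro allI)
    fix k x
    show "(deriv ^^ k) \<Phi> differentiable at x"
    proof (cases k)
      case 0
      then show ?thesis using D real_differentiable_def by auto
    next
      case (Suc j)
      have "(deriv ^^ k) \<Phi> = (deriv ^^ j) \<psi>" unfolding Suc funpow_Suc_right o_apply d ..
      then show ?thesis using test_function_smooth[OF t] by (simp add: smooth_fun_def)
    qed
  qed
  then have "test_function a b \<Phi>"
    by (rule test_functionI[OF _ cd(1,2)]) (use left right in \<open>auto simp: not_le\<close>)
  then show ?thesis using d by blast
qed

section \<open>Weak derivatives\<close>

text \<open>\<open>ennreal\<close> truncates negative values, so \<open>M\<close> and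
  \<open>N\<close> have the positive and the negative part of g as densities. They are finite and
  agree on half-lines, hence coincide, and densities are unique almost everywhere.\<close>

lemma AE_zero_if_tail_integrals_zero:
  fixes g :: "real \<Rightarrow> real"
  assumes g: "integrable lborel g" and z: "\<And>x. (\<integral>y. indicator {x<..} y * g y \<partial>lborel) = 0"
  shows "AE x in lborel. g x = 0"
proof -
  have gm [measurable]: "g \<in> borel_measurable borel" using g by auto
  define M where "M = density lborel (\<lambda>x. ennreal (g x))"
  define N where "N = density lborel (\<lambda>x. ennreal (- g x))"
  have fin: "(\<integral>\<^sup>+y. ennreal (g y) * indicator {x<..} y \<partial>lborel) < \<infinity>"
    "(\<integral>\<^sup>+y. ennreal (- g y) * indicator {x<..} y \<partial>lborel) < \<infinity>" for x
  proof -
    have "(\<integral>\<^sup>+y. ennreal (g y) * indicator {x<..} y \<partial>lborel) \<le> (\<integral>\<^sup>+y. ennreal (norm (g y)) \<partial>lborel)"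
      by (intro nn_integral_mono) (auto split: split_indicator intro!: ennreal_leI)
    also have "\<dots> < \<infinity>" using g by (simp add: integrable_iff_bounded)
    finally show "(\<integral>\<^sup>+y. ennreal (g y) * indicator {x<..} y \<partial>lborel) < \<infinity>" .
    have "(\<integral>\<^sup>+y. ennreal (- g y) * indicator {x<..} y \<partial>lborel) \<le> (\<integral>\<^sup>+y. ennreal (norm (g y)) \<partial>lborel)"
      by (intro nn_integral_mono) (auto split: split_indicator intro!: ennreal_leI)
    also have "\<dots> < \<infinity>" using g by (simp add: integrable_iff_bounded)
    finally show "(\<integral>\<^sup>+y. ennreal (- g y) * indicator {x<..} y \<partial>lborel) < \<infinity>" .
  qed
  have "M = N"
  proof (rule measure_eqI_lessThan)
    fix x
    show "emeasure M {x<..} < \<infinity>" using fin by (simp add: M_def emeasure_density)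
    have i: "integrable lborel (\<lambda>y. indicator {x<..} y * g y)"
      using integrable_mult_indicator[OF _ g, of "{x<..}"] by simp
    have e: "(\<integral>\<^sup>+y. ennreal (indicator {x<..} y * g y) \<partial>lborel) = (\<integral>\<^sup>+y. ennreal (g y) * indicator {x<..} y \<partial>lborel)"
      "(\<integral>\<^sup>+y. ennreal (- (indicator {x<..} y * g y)) \<partial>lborel) = (\<integral>\<^sup>+y. ennreal (- g y) * indicator {x<..} y \<partial>lborel)"
      by (intro nn_integral_cong; auto split: split_indicator)+
    have "enn2real (\<integral>\<^sup>+y. ennreal (g y) * indicator {x<..} y \<partial>lborel)
        = enn2real (\<integral>\<^sup>+y. ennreal (- g y) * indicator {x<..} y \<partial>lborel)"
      using z[of x] real_lebesgue_integral_def[OF i] unfolding e by simp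
    then show "emeasure M {x<..} = emeasure N {x<..}"
      using fin[of x] by (simp add: M_def N_def emeasure_density)
        (metis ennreal_enn2real less_top infinity_ennreal_def)
  qed (auto simp: M_def N_def)
  then have "AE x in lborel. ennreal (g x) = ennreal (- g x)"
    unfolding M_def N_def by (intro sigma_finite_measure.density_unique[OF lborel.sigma_finite_measure_axioms]) auto
  then show ?thesis
  proof eventually_elim
    case (elim x)
    show ?case
    proof (rule ccontr)
      assume "g x \<noteq> 0"
      then consider "0 < g x" | "0 < - g x" by linarith
      then show False using elim by cases (auto simp: ennreal_neg ennreal_eq_0_iff)
    qed
  qed
qed

lemma AE_lebesgue_on_Ioo_iff:
  "(AE x in lebesgue_on {a<..<b::real}. P x) \<longleftrightarrow> (AE x in lebesgue. a < x \<and> x < b \<longrightarrow> P x)"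
  by (subst AE_restrict_space_iff) (auto simp: conj_commute)

text \<open>The extension of u by zero is replaced by a Borel function, to which the tail criterion
  applies; each tail integral is an integral of u over a subinterval.\<close>

lemma AE_zero_if_subinterval_integrals_zero:
  fixes u :: "real \<Rightarrow> real"
  assumes u: "integrable (lebesgue_on {a<..<b}) u"
    and z: "\<And>p q. a \<le> p \<Longrightarrow> p < q \<Longrightarrow> q \<le> b \<Longrightarrow> integral\<^sup>L (lebesgue_on {p<..<q}) u = 0"
  shows "AE x in lebesgue_on {a<..<b}. u x = 0"
proof -
  define g0 where "g0 = (\<lambda>x. indicator {a<..<b} x * u x)"
  have g0: "integrable lebesgue g0" using u by (simp add: integrable_restrict_space g0_def)
  then obtain g where g [measurable]: "g \<in> borel_measurable borel" and gg: "AE x in lborel. g0 x = g x"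
    using completion_ex_borel_measurable_real[of g0 lborel] by auto
  have gl: "AE x in lebesgue. g0 x = g x" using gg by (rule AE_completion)
  have "integrable lebesgue g"
    by (rule integrable_cong_AE_imp[OF g0]) (use gl in \<open>auto elim: eventually_mono simp: measurable_completion\<close>)
  then have gi: "integrable lborel g" by (simp add: integrable_completion)
  have "AE x in lborel. g x = 0"
  proof (rule AE_zero_if_tail_integrals_zero[OF gi])
    fix x
    have "(\<integral>y. indicator {x<..} y * g y \<partial>lborel) = (\<integral>y. indicator {x<..} y * g y \<partial>lebesgue)"
      by (rule integral_completion[symmetric]) measurable
    also have "\<dots> = (\<integral>y. indicator {x<..} y * g0 y \<partial>lebesgue)"
    proof (rule integral_cong_AE)
      show "(\<lambda>y. indicator {x<..} y * g y) \<in> borel_measurable lebesgue" by (intro measurable_completion) measurable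
      show "(\<lambda>y. indicator {x<..} y * g0 y) \<in> borel_measurable lebesgue"
        using g0 by (intro borel_measurable_times borel_measurable_indicator) auto
      show "AE y in lebesgue. indicator {x<..} y * g y = indicator {x<..} y * g0 y"
        using gl by eventually_elim simp
    qed
    also have "\<dots> = (\<integral>y. indicator {max a x<..<b} y * u y \<partial>lebesgue)"
      by (rule Bochner_Integration.integral_cong) (auto simp: g0_def split: split_indicator)
    also have "\<dots> = integral\<^sup>L (lebesgue_on {max a x<..<b}) u" by (simp add: integral_restrict_space)
    also have "\<dots> = 0"
    proof (cases "max a x < b")
      case False
      then have "{max a x<..<b} = {}" by auto
      then show ?thesis by (simp add: integral_restrict_space)
    qed (use z[of "max a x" b] in auto)
    finally show "(\<integral>y. indicator {x<..} y * g y \<partial>lborel) = 0" .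
  qed
  then have "AE x in lebesgue. g x = 0" by (rule AE_completion)
  with gl have "AE x in lebesgue. a < x \<and> x < b \<longrightarrow> u x = 0"
    by eventually_elim (auto simp: g0_def)
  then show ?thesis by (simp only: AE_lebesgue_on_Ioo_iff)
qed

lemma locally_integrable_test_mult:
  assumes u: "locally_integrable a b u" and t: "test_function a b \<phi>"
  shows "integrable (lebesgue_on {a<..<b}) (\<lambda>x. u x * \<phi> x)"
proof -
  obtain c d where cd: "a < c" "d < b" "\<And>x. x \<notin> {c..d} \<Longrightarrow> \<phi> x = 0" using test_functionE[OF t] by blast
  have ui: "integrable (lebesgue_on {c..d}) u" using u cd by (simp add: locally_integrable_def)
  obtain B where B: "\<And>x. x \<in> {c..d} \<Longrightarrow> \<bar>\<phi> x\<bar> \<le> B"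
  proof -
    have "bounded (\<phi> ` {c..d})" by (intro compact_imp_bounded compact_continuous_image test_function_continuous[OF t]) auto
    then show ?thesis using that by (metis bounded_pos image_eqI real_norm_def)
  qed
  have phim: "\<phi> \<in> borel_measurable (lebesgue_on {c..d})"
    by (intro continuous_imp_measurable_on_sets_lebesgue test_function_continuous[OF t]) auto
  have "integrable (lebesgue_on {c..d}) (\<lambda>x. u x * \<phi> x)"
  proof (rule Bochner_Integration.integrable_bound)
    show "integrable (lebesgue_on {c..d}) (\<lambda>x. B * u x)" using ui by auto
    show "(\<lambda>x. u x * \<phi> x) \<in> borel_measurable (lebesgue_on {c..d})" using ui phim by auto
    show "AE x in lebesgue_on {c..d}. norm (u x * \<phi> x) \<le> norm (B * u x)"
    proof (rule AE_I2)
      fix x assume "x \<in> space (lebesgue_on {c..d})"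
      then have "\<bar>\<phi> x\<bar> \<le> \<bar>B\<bar>" using B[of x] by auto
      then show "norm (u x * \<phi> x) \<le> norm (B * u x)" by (simp add: abs_mult mult.commute mult_right_mono)
    qed
  qed
  then have "integrable lebesgue (\<lambda>x. indicator {c..d} x * (u x * \<phi> x))" by (simp add: integrable_restrict_space)
  also have "(\<lambda>x. indicator {c..d} x * (u x * \<phi> x)) = (\<lambda>x. indicator {a<..<b} x * (u x * \<phi> x))"
    using cd by (auto split: split_indicator)
  finally show ?thesis by (simp add: integrable_restrict_space)
qed

text \<open>Bumps converge to indicators, so by dominated convergence u integrates to zero over
  every subinterval that stays away from the end points.\<close>

lemma fundamental_lemma:
  assumes u: "locally_integrable a b u"
    and z: "\<And>\<phi>. test_function a b \<phi> \<Longrightarrow> (\<integral>x. u x * \<phi> x \<partial>lebesgue_on {a<..<b}) = 0"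
  shows "AE x in lebesgue_on {a<..<b}. u x = 0"
proof -
  have zi: "integral\<^sup>L (lebesgue_on {p<..<q}) u = 0" if pq: "a < p" "p < q" "q < b" for p q
  proof -
    have up: "integrable (lebesgue_on {p..q}) u" using u pq by (simp add: locally_integrable_def)
    have "(\<lambda>n. \<integral>x. indicator {p..q} x * u x * bump p q n x \<partial>lebesgue) \<longlonglongrightarrow> (\<integral>x. indicator {p..q} x * u x * indicator {p<..<q} x \<partial>lebesgue)"
    proof (rule integral_dominated_convergence)
      have m: "(\<lambda>x. indicator {p..q} x * u x) \<in> borel_measurable lebesgue"
        using up by (simp add: integrable_restrict_space borel_measurable_integrable)
      show "(\<lambda>x. indicator {p..q} x * u x * indicator {p<..<q} x) \<in> borel_measurable lebesgue"
        by (intro borel_measurable_times m borel_measurable_indicator) auto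
      show "integrable lebesgue (\<lambda>x. norm (indicator {p..q} x * u x))"
        using up by (intro integrable_norm) (simp add: integrable_restrict_space)
      fix n
      have "continuous_on UNIV (bump p q n)"
        by (rule test_function_continuous[OF test_function_bump[of "p - 1" p q "q + 1"]]) auto
      then have "bump p q n \<in> borel_measurable borel" by (rule borel_measurable_continuous_onI)
      then show "(\<lambda>x. indicator {p..q} x * u x * bump p q n x) \<in> borel_measurable lebesgue"
        by (intro borel_measurable_times m measurable_completion) auto
      show "AE x in lebesgue. norm (indicator {p..q} x * u x * bump p q n x) \<le> norm (indicator {p..q} x * u x)"
        using bump_bounds[of p q n] by (intro AE_I2) (auto simp: abs_mult intro!: mult_left_le)
    qed (intro AE_I2 tendsto_mult tendsto_const bump_tendsto)
    moreover have "(\<integral>x. indicator {p..q} x * u x * bump p q n x \<partial>lebesgue) = 0" for n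
    proof -
      have "(\<integral>x. indicator {p..q} x * u x * bump p q n x \<partial>lebesgue)
         = (\<integral>x. indicator {a<..<b} x * (u x * bump p q n x) \<partial>lebesgue)"
        using pq by (intro Bochner_Integration.integral_cong) (auto simp: bump_eq split: split_indicator)
      also have "\<dots> = (\<integral>x. u x * bump p q n x \<partial>lebesgue_on {a<..<b})" by (simp add: integral_restrict_space)
      also have "\<dots> = 0" by (rule z[OF test_function_bump[OF pq(1,3)]])
      finally show ?thesis .
    qed
    ultimately have "(\<integral>x. indicator {p..q} x * u x * indicator {p<..<q} x \<partial>lebesgue) = 0"
      by (simp add: LIMSEQ_const_iff)
    also have "(\<lambda>x. indicator {p..q} x * u x * indicator {p<..<q} x) = (\<lambda>x. indicator {p<..<q} x * u x)"
      by (auto split: split_indicator)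
    finally show ?thesis by (simp add: integral_restrict_space)
  qed
  show ?thesis
  proof (cases "a < b")
    case True
    \<comment> \<open>Countably many intervals exhaust (a,b) while keeping a positive distance from
      its ends, where u is only locally integrable.\<close>
    define p where "p n = a + (b - a) / (real n + 3)" for n :: nat
    define q where "q n = b - (b - a) / (real n + 3)" for n :: nat
    have pq: "a < p n" "q n < b" for n using True by (auto simp: p_def q_def)
    have "AE x in lebesgue_on {p n<..<q n}. u x = 0" for n
    proof (rule AE_zero_if_subinterval_integrals_zero)
      have "integrable (lebesgue_on {p n..q n}) u" using u pq by (simp add: locally_integrable_def)
      then show "integrable (lebesgue_on {p n<..<q n}) u" by (rule integrable_lebesgue_on_subset) auto
      fix p' q' assume "p n \<le> p'" "p' < q'" "q' \<le> q n"
      then show "integral\<^sup>L (lebesgue_on {p'<..<q'}) u = 0" using pq[of n] by (intro zi) auto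
    qed
    then have "AE x in lebesgue. \<forall>n. p n < x \<and> x < q n \<longrightarrow> u x = 0"
      unfolding AE_lebesgue_on_Ioo_iff by (subst AE_all_countable) auto
    then have "AE x in lebesgue. a < x \<and> x < b \<longrightarrow> u x = 0"
    proof eventually_elim
      case (elim x)
      show ?case
      proof
        assume x: "a < x \<and> x < b"
        define m where "m = min (x - a) (b - x)"
        have m: "0 < m" using x by (simp add: m_def)
        obtain n :: nat where "(b - a) / m < real n" using reals_Archimedean2 by blast
        then have "b - a < real n * m" using m by (simp only: pos_divide_less_eq)
        also have "\<dots> \<le> m * (real n + 3)" using m by (simp add: algebra_simps)
        finally have "(b - a) / (real n + 3) < m"
          using pos_divide_less_eq[of "real n + 3" "b - a" m] by linarith
        then have "p n < x" "x < q n" unfolding p_def q_def m_def by linarith+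
        then show "u x = 0" using elim by blast
      qed
    qed
    then show ?thesis by (simp only: AE_lebesgue_on_Ioo_iff)
  next
    case False
    then show ?thesis by (simp add: AE_lebesgue_on_Ioo_iff)
  qed
qed

section \<open>Uniqueness of weak derivatives and their absolutely continuous
  representatives\<close>

lemma locally_integrable_diff:
  "locally_integrable a b u \<Longrightarrow> locally_integrable a b v \<Longrightarrow> locally_integrable a b (\<lambda>x. u x - v x)"
  by (auto simp: locally_integrable_def)

lemma in_L2_locally_integrable:
  assumes "in_L2 a b u" shows "locally_integrable a b u"
  unfolding locally_integrable_def
proof (intro allI impI)
  fix c d assume "a < c" "d < b"
  then show "integrable (lebesgue_on {c..d}) u"
    by (intro integrable_lebesgue_on_subset[OF in_L2_integrable[OF assms]]) auto
qed

lemma has_weak_deriv_unique: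
  assumes "has_weak_deriv a b k u g" "has_weak_deriv a b k u h"
  shows "AE x in lebesgue_on {a<..<b}. g x = h x"
proof -
  have L: "locally_integrable a b g" "locally_integrable a b h" using assms by (auto simp: has_weak_deriv_def)
  have "AE x in lebesgue_on {a<..<b}. g x - h x = 0"
  proof (rule fundamental_lemma[OF locally_integrable_diff[OF L]])
    fix \<phi> assume t: "test_function a b \<phi>"
    have "(- 1) ^ k * (\<integral>x. g x * \<phi> x \<partial>lebesgue_on {a<..<b}) = (- 1) ^ k * (\<integral>x. h x * \<phi> x \<partial>lebesgue_on {a<..<b})"
      using assms(1)[unfolded has_weak_deriv_def, THEN conjunct2, THEN conjunct2, rule_format, OF t]
        assms(2)[unfolded has_weak_deriv_def, THEN conjunct2, THEN conjunct2, rule_format, OF t] by simp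
    then show "(\<integral>x. (g x - h x) * \<phi> x \<partial>lebesgue_on {a<..<b}) = 0"
      using locally_integrable_test_mult[OF L(1) t] locally_integrable_test_mult[OF L(2) t]
      by (simp add: left_diff_distrib)
  qed
  then show ?thesis by simp
qed

lemma ac_weak_deriv:
  assumes "a \<le> b" "ac a b u g" "test_function a b \<phi>"
  shows "ip a b u (deriv \<phi>) = - ip a b g \<phi>"
proof -
  have "ip a b g \<phi> = u b * \<phi> b - u a * \<phi> a - ip a b u (deriv \<phi>)"
  proof (rule ac_integration_by_parts[OF assms(1,2)])
    show "continuous_on {a..b} (deriv \<phi>)" using assms(3) by (intro test_function_continuous test_function_deriv)
    show "(\<phi> has_real_derivative deriv \<phi> x) (at x within {a..b})" for x
      using smooth_fun_DERIV[OF test_function_smooth[OF assms(3)]] by (rule DERIV_subset) simp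
  qed
  then show ?thesis using test_function_endpoints[OF assms(3)] by simp
qed

lemma chain_weak_deriv:
  assumes ab: "a \<le> b" and U: "chain a b k U" and u: "AE x in lebesgue_on {a<..<b}. U 0 x = u x" and j: "j \<le> k"
  shows "has_weak_deriv a b j u (U j)"
proof -
  have "ip a b (U 0) ((deriv ^^ i) \<phi>) = (- 1) ^ i * ip a b (U i) \<phi>" if "test_function a b \<phi>" "i \<le> k" for i \<phi>
    using that
  proof (induction i arbitrary: \<phi>)
    case (Suc i)
    have "ip a b (U 0) ((deriv ^^ Suc i) \<phi>) = ip a b (U 0) ((deriv ^^ i) (deriv \<phi>))"
      by (simp add: funpow_swap1)
    also have "\<dots> = (- 1) ^ i * ip a b (U i) (deriv \<phi>)"
      using Suc test_function_deriv by simp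
    also have "ip a b (U i) (deriv \<phi>) = - ip a b (U (Suc i)) \<phi>"
      using Suc.prems by (intro ac_weak_deriv[OF ab chain_acD[OF U]]) auto
    finally show ?case by simp
  qed simp
  moreover have "ip a b u ((deriv ^^ j) \<phi>) = ip a b (U 0) ((deriv ^^ j) \<phi>)" if "test_function a b \<phi>" for \<phi>
    using chain_in_L2[OF U, of 0] u test_function_in_L2[OF test_function_iterate[OF that]]
    by (intro ip_cong_AE[symmetric]) auto
  ultimately show ?thesis
    unfolding has_weak_deriv_def ip_def[symmetric]
    using in_L2_locally_integrable[OF in_L2_AE_cong[OF chain_in_L2[OF U, of 0] u]]
      in_L2_locally_integrable[OF chain_in_L2[OF U j]] j by auto
qed

lemma weak_deriv_eqI:
  assumes "has_weak_deriv a b j u g"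
  shows "AE x in lebesgue_on {a<..<b}. weak_deriv a b j u x = g x"
proof -
  have "has_weak_deriv a b j u (weak_deriv a b j u)" unfolding weak_deriv_def by (rule someI[of "has_weak_deriv a b j u" g, OF assms])
  then show ?thesis by (rule has_weak_deriv_unique[OF _ assms])
qed

text \<open>The difference v of u and a primitive of g annihilates derivatives of test functions.
  Every test function is such a derivative up to a multiple of one fixed bump \<rho>, so v acts like
  the constant \<kappa>, its \<rho>-weighted mean.\<close>

lemma du_Bois_Reymond:
  assumes ab: "a < b" and u: "in_L2 a b u" and g: "in_L2 a b g"
    and w: "\<And>\<phi>. test_function a b \<phi> \<Longrightarrow> ip a b u (deriv \<phi>) = - ip a b g \<phi>"
  shows "\<exists>c. AE x in lebesgue_on {a<..<b}. c + integral {a..x} g = u x"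
proof -
  define G where "G = (\<lambda>x. 0 + integral {a..x} g)"
  have acG: "ac a b G g" unfolding G_def by (rule ac_indefinite[OF g])
  have GL: "in_L2 a b G" by (rule ac_in_L2_self[OF acG])
  define v where "v = (\<lambda>x. u x - G x)"
  have vL: "in_L2 a b v" unfolding v_def using u GL by auto
  have v0: "ip a b v (deriv \<phi>) = 0" if t: "test_function a b \<phi>" for \<phi>
    using w[OF t] ac_weak_deriv[OF less_imp_le[OF ab] acG t] u GL test_function_in_L2[OF test_function_deriv[OF t]]
    by (simp add: v_def ip_diff_left)
  obtain p q where pq: "a < p" "p < q" "q < b" using dense[OF ab] by (metis dense)
  define \<rho> where "\<rho> = bump p q 0"
  have rt: "test_function a b \<rho>" unfolding \<rho>_def by (rule test_function_bump[OF pq(1,3)])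
  have rL: "in_L2 a b \<rho>" by (rule test_function_in_L2[OF rt])
  have r0: "integral {a..b} \<rho> \<noteq> 0"
  proof
    assume "integral {a..b} \<rho> = 0"
    then have "(\<rho> has_integral 0) (cbox a b)"
      using integrable_continuous_real[OF test_function_continuous[OF rt]] by (metis cbox_interval integrable_integral)
    then have "\<rho> ((p + q) / 2) = 0"
      by (rule has_integral_0_cbox_imp_0[rotated 2])
        (use pq bump_bounds in \<open>auto simp: \<rho>_def intro!: test_function_continuous[OF rt, unfolded \<rho>_def]\<close>)
    then show False using pq by (simp add: \<rho>_def bump_eq)
  qed
  define \<kappa> where "\<kappa> = ip a b v \<rho> / integral {a..b} \<rho>"
  have "AE x in lebesgue_on {a<..<b}. v x - \<kappa> = 0"
  proof (rule fundamental_lemma)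
    have vk: "in_L2 a b (\<lambda>x. v x - \<kappa>)" using vL by auto
    then show "locally_integrable a b (\<lambda>x. v x - \<kappa>)" by (rule in_L2_locally_integrable)
    fix \<psi> assume t: "test_function a b \<psi>"
    have pL: "in_L2 a b \<psi>" by (rule test_function_in_L2[OF t])
    \<comment> \<open>This multiple of \<rho> brings the mean to zero, which makes \<psi> + l \<rho>
      the derivative of a test function.\<close>
    define l where "l = - (integral {a..b} \<psi> / integral {a..b} \<rho>)"
    have int: "f integrable_on {a..b}" if "test_function a b f" for f
      using integrable_continuous_real[OF test_function_continuous[OF that]] .
    have "integral {a..b} (\<lambda>x. \<psi> x + l * \<rho> x) = integral {a..b} \<psi> + l * integral {a..b} \<rho>"
      using int[OF t] int[OF rt] by (subst Henstock_Kurzweil_Integration.integral_add) (auto intro: integrable_on_mult_right)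
    also have "\<dots> = 0" using r0 by (simp add: l_def)
    finally obtain \<Phi> where P: "test_function a b \<Phi>" "deriv \<Phi> = (\<lambda>x. \<psi> x + l * \<rho> x)"
      using test_function_antiderivative[OF test_function_lincomb[OF t rt]] by blast
    have "ip a b v (\<lambda>x. \<psi> x + l * \<rho> x) = 0" using v0[OF P(1)] P(2) by simp
    then have "ip a b v \<psi> = - (l * ip a b v \<rho>)"
      using vL pL rL by (simp add: ip_add_right in_L2_cmult ip_cmult_right)
    also have "\<dots> = \<kappa> * integral {a..b} \<psi>" by (simp add: l_def \<kappa>_def)
    also have "\<dots> = ip a b (\<lambda>x. \<kappa>) \<psi>" using pL by (simp add: ip_eq_integral)
    finally have "ip a b (\<lambda>x. v x - \<kappa>) \<psi> = 0" using vL pL by (simp add: ip_diff_left)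
    then show "(\<integral>x. (v x - \<kappa>) * \<psi> x \<partial>lebesgue_on {a<..<b}) = 0" by (simp add: ip_def)
  qed
  then have "AE x in lebesgue_on {a<..<b}. \<kappa> + integral {a..x} g = u x"
    by eventually_elim (auto simp: v_def G_def)
  then show ?thesis by blast
qed

text \<open>The double integrals of differences need joint measurability, which comes with Borel
  functions of one variable.\<close>

lemma borel_representative:
  assumes "in_L2 a b f"
  obtains g where "g \<in> borel_measurable borel" "in_L2 a b g" "AE x in lebesgue_on {a<..<b}. f x = g x"
proof -
  have "(\<lambda>x. indicator {a<..<b} x * f x) \<in> borel_measurable lebesgue"
    using in_L2_integrable[OF assms] by (simp add: integrable_restrict_space borel_measurable_integrable)
  then obtain g where g: "g \<in> borel_measurable borel" "AE x in lborel. indicator {a<..<b} x * f x = g x"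
    using completion_ex_borel_measurable_real[of "\<lambda>x. indicator {a<..<b} x * f x" lborel] by auto
  have "AE x in lebesgue. indicator {a<..<b} x * f x = g x" using g(2) by (rule AE_completion)
  then have "AE x in lebesgue. a < x \<and> x < b \<longrightarrow> f x = g x" by eventually_elim auto
  then have ae: "AE x in lebesgue_on {a<..<b}. f x = g x" by (simp only: AE_lebesgue_on_Ioo_iff)
  show ?thesis by (rule that[OF g(1) in_L2_AE_cong[OF assms ae] ae])
qed

lemma continuous_AE_eq:
  fixes f g :: "real \<Rightarrow> real"
  assumes ab: "a < b" and "continuous_on {a..b} f" "continuous_on {a..b} g"
    and ae: "AE x in lebesgue_on {a<..<b}. f x = g x" and x: "x \<in> {a..b}"
  shows "f x = g x"
proof -
  have c: "continuous_on {a..b} (\<lambda>x. (f x - g x)\<^sup>2)" by (intro continuous_intros assms)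
  have "(\<integral>x. (f x - g x)\<^sup>2 \<partial>lebesgue_on {a<..<b}) = 0"
    by (rule integral_eq_zero_AE) (use ae in \<open>auto elim: eventually_mono\<close>)
  then have "integral (cbox a b) (\<lambda>x. (f x - g x)\<^sup>2) = 0"
    using integral_lebesgue_on_Ioo[OF integrable_continuous_Ioo[OF c]] by simp
  then have "((\<lambda>x. (f x - g x)\<^sup>2) has_integral 0) (cbox a b)"
    using integrable_continuous_real[OF c] by (metis cbox_interval integrable_integral)
  then have "(f x - g x)\<^sup>2 = 0"
    by (rule has_integral_0_cbox_imp_0[rotated 2]) (use c x ab in auto)
  then show ?thesis by simp
qed

text \<open>Built from the top: the highest derivative gets a Borel representative, and each lower
  one is, by du Bois-Reymond, a primitive of the one above plus a constant.\<close>

lemma weak_derivs_chain: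
  assumes ab: "a < b"
    and w: "\<And>j. j \<le> k \<Longrightarrow> has_weak_deriv a b j u (v j)" "\<And>j. j \<le> k \<Longrightarrow> in_L2 a b (v j)"
  obtains U where "chain a b k U" "U k \<in> borel_measurable borel"
    "\<And>j. j \<le> k \<Longrightarrow> AE x in lebesgue_on {a<..<b}. U j x = v j x"
proof -
  \<comment> \<open>Here i counts derivatives from the top, so this chain represents the orders k -
    i to k.\<close>
  have "\<exists>U. chain a b i U \<and> U i \<in> borel_measurable borel \<and>
     (\<forall>j\<le>i. AE x in lebesgue_on {a<..<b}. U j x = v (k - i + j) x)" if "i \<le> k" for i
    using that
  proof (induction i)
    case 0
    obtain g where "g \<in> borel_measurable borel" "in_L2 a b g" "AE x in lebesgue_on {a<..<b}. v k x = g x"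
      using borel_representative[OF w(2)[of k]] by blast
    then show ?case by (intro exI[of _ "\<lambda>_. g"]) (auto simp: chain_def elim: eventually_mono)
  next
    case (Suc i)
    then obtain U where U: "chain a b i U" "U i \<in> borel_measurable borel"
      "\<And>j. j \<le> i \<Longrightarrow> AE x in lebesgue_on {a<..<b}. U j x = v (k - i + j) x" by auto
    define n where "n = k - Suc i"
    have n: "k - i = Suc n" "n < k" "k - Suc i = n" using Suc.prems by (auto simp: n_def)
    have U0: "AE x in lebesgue_on {a<..<b}. U 0 x = v (Suc n) x" using U(3)[of 0] n by simp
    have UL: "in_L2 a b (U 0)" by (rule chain_in_L2[OF U(1)]) simp
    have "ip a b (v n) (deriv \<phi>) = - ip a b (U 0) \<phi>" if t: "test_function a b \<phi>" for \<phi>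
    proof -
      have "ip a b u ((deriv ^^ n) (deriv \<phi>)) = (- 1) ^ n * ip a b (v n) (deriv \<phi>)"
        using w(1)[of n] n test_function_deriv[OF t] by (simp add: has_weak_deriv_def ip_def)
      moreover have "ip a b u ((deriv ^^ Suc n) \<phi>) = (- 1) ^ Suc n * ip a b (v (Suc n)) \<phi>"
        using w(1)[of "Suc n"] n t unfolding has_weak_deriv_def ip_def by simp
      moreover have "(deriv ^^ Suc n) \<phi> = (deriv ^^ n) (deriv \<phi>)" by (simp add: funpow_swap1)
      moreover have "ip a b (U 0) \<phi> = ip a b (v (Suc n)) \<phi>"
        using UL U0 test_function_in_L2[OF t] by (intro ip_cong_AE) auto
      ultimately have "(- 1) ^ n * (ip a b (v n) (deriv \<phi>) + ip a b (U 0) \<phi>) = 0"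
        by (simp add: distrib_left)
      then show ?thesis by simp
    qed
    then obtain c where c: "AE x in lebesgue_on {a<..<b}. c + integral {a..x} (U 0) = v n x"
      using du_Bois_Reymond[OF ab w(2)[of n] UL] n by auto
    define U' where "U' = case_nat (\<lambda>x. c + integral {a..x} (U 0)) U"
    have "chain a b (Suc i) U'"
      unfolding chain_def
    proof (intro conjI allI impI)
      fix j assume "j < Suc i"
      then show "ac a b (U' j) (U' (Suc j))"
        using chain_acD[OF U(1)] ac_indefinite[OF UL, of c] by (cases j) (auto simp: U'_def)
    next
      show "in_L2 a b (U' (Suc i))" using U(1) by (simp add: U'_def chain_def)
    qed
    moreover have "AE x in lebesgue_on {a<..<b}. U' j x = v (k - Suc i + j) x" if "j \<le> Suc i" for j
      using c U(3)[of "j - 1"] n that by (cases j) (auto simp: U'_def)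
    ultimately show ?case using U(2) by (intro exI[of _ U']) (auto simp: U'_def)
  qed
  from this[of k] show ?thesis using that by auto
qed

section \<open>Stability of the Galerkin method\<close>

lemma nrm_mono:
  assumes "in_L2 a b f" "in_L2 a b g" "\<And>x. a < x \<Longrightarrow> x < b \<Longrightarrow> \<bar>f x\<bar> \<le> \<bar>g x\<bar>"
  shows "nrm a b f \<le> nrm a b g"
  unfolding nrm_def ip_def
proof (rule real_sqrt_le_mono, rule integral_mono)
  fix x assume "x \<in> space (lebesgue_on {a<..<b})"
  then have "\<bar>f x\<bar> * \<bar>f x\<bar> \<le> \<bar>g x\<bar> * \<bar>g x\<bar>" using assms(3)[of x] by (intro mult_mono) auto
  then show "f x * f x \<le> g x * g x" by simp
qed (auto intro: in_L2_mult assms)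

text \<open>The linear weight \<open>w\<close> is chosen so that \<open>w \<theta>' + k\<^sub>1 r \<theta>\<close> has degree less than \<open>r\<close>; this makes
  the projection error in \<open>\<integral> w (\<theta>', \<theta> - P \<theta>)\<close> have a sign.\<close>

lemma weighted_energy_one:
  fixes a b k0 k1 :: real
  assumes ab: "a < b" and th: "degree \<theta> \<le> r" and r: "1 \<le> r" and k: "0 \<le> k1"
  defines "w \<equiv> [:k0, - k1:]" and "p \<equiv> L2_proj (r - 1) a b (poly \<theta>)"
  shows "poly w b * (poly \<theta> b)\<^sup>2 - poly w a * (poly \<theta> a)\<^sup>2 + k1 * ip a b (poly \<theta>) (poly \<theta>)
    \<le> 2 * ip a b (poly (w * pderiv \<theta>)) (poly p)"
proof -
  define e where "e = \<theta> - p"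
  define q where "q = w * pderiv \<theta> + smult (k1 * real r) \<theta>"
  have dp: "degree p \<le> r - 1" unfolding p_def by (rule degree_L2_proj[OF ab in_L2_poly])
  have e0: "ip a b (poly e) (poly v) = 0" if "degree v \<le> r - 1" for v
    using L2_proj_residual_orth[OF ab in_L2_poly that, of \<theta>] by (simp add: e_def p_def poly_fun_simps)
  have dq: "degree q \<le> r - 1"
  proof (rule degree_le, intro allI impI)
    fix i assume i: "r - 1 < i"
    then obtain j where j: "i = Suc j" by (cases i) auto
    have "coeff \<theta> (Suc i) = 0" "i = r \<or> coeff \<theta> i = 0" using i r th by (auto intro!: coeff_eq_0)
    then show "coeff q i = 0" by (auto simp: q_def w_def coeff_pderiv j coeff_pCons algebra_simps)
  qed
  have dd: "pderiv (w * \<theta> * \<theta>) = smult 2 (w * pderiv \<theta> * \<theta>) + smult (- k1) (\<theta> * \<theta>)"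
  proof (rule poly_eq_poly_eq_iff[THEN iffD1], rule ext)
    fix x
    show "poly (pderiv (w * \<theta> * \<theta>)) x = poly (smult 2 (w * pderiv \<theta> * \<theta>) + smult (- k1) (\<theta> * \<theta>)) x"
      by (simp add: w_def pderiv_mult pderiv_pCons pderiv_diff pderiv_add pderiv_smult pderiv_minus algebra_simps)
  qed
  have "poly (w * \<theta> * \<theta>) b - poly (w * \<theta> * \<theta>) a = integral {a..b} (poly (smult 2 (w * pderiv \<theta> * \<theta>) + smult (- k1) (\<theta> * \<theta>)))"
    using integral_pderiv[of a b "w * \<theta> * \<theta>"] ab unfolding dd by simp
  also have "\<dots> = integral {a..b} (\<lambda>x. 2 * poly (w * pderiv \<theta> * \<theta>) x + - k1 * poly (\<theta> * \<theta>) x)"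
    by (simp add: poly_fun_simps)
  also have "\<dots> = 2 * integral {a..b} (poly (w * pderiv \<theta> * \<theta>)) + - k1 * integral {a..b} (poly (\<theta> * \<theta>))"
  proof -
    have "integral {a..b} (\<lambda>x. 2 * poly (w * pderiv \<theta> * \<theta>) x + - k1 * poly (\<theta> * \<theta>) x)
      = integral {a..b} (\<lambda>x. 2 * poly (w * pderiv \<theta> * \<theta>) x) + integral {a..b} (\<lambda>x. - k1 * poly (\<theta> * \<theta>) x)"
      by (rule Henstock_Kurzweil_Integration.integral_add) (intro integrable_on_mult_right poly_integrable_on)+
    then show ?thesis by (simp only: Henstock_Kurzweil_Integration.integral_mult_right)
  qed
  finally have 1: "poly w b * (poly \<theta> b)\<^sup>2 - poly w a * (poly \<theta> a)\<^sup>2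
      = 2 * ip a b (poly (w * pderiv \<theta>)) (poly \<theta>) - k1 * ip a b (poly \<theta>) (poly \<theta>)"
    by (simp add: ip_poly_eq_integral power2_eq_square mult.assoc)
  have wq: "w * pderiv \<theta> = q - smult (k1 * real r) (e + p)" by (simp add: q_def e_def)
  \<comment> \<open>Both q and p have degree below r and are orthogonal to the residual e, so only
    the multiple of e inside w \<theta>' contributes.\<close>
  have "ip a b (poly (w * pderiv \<theta>)) (poly e) = - (k1 * real r) * ip a b (poly e) (poly e)"
    unfolding wq ip_poly_diff_left[OF in_L2_poly] ip_poly_smult_left ip_poly_add_left[OF in_L2_poly]
    using e0[OF dq] e0[OF dp] ip_commute[of a b "poly q" "poly e"] ip_commute[of a b "poly p" "poly e"] by simp
  then have "ip a b (poly (w * pderiv \<theta>)) (poly e) \<le> 0" using k by (simp add: ip_self_nonneg mult_nonneg_nonneg)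
  moreover have "\<theta> = e + p" by (simp add: e_def)
  ultimately have "ip a b (poly (w * pderiv \<theta>)) (poly \<theta>) \<le> ip a b (poly (w * pderiv \<theta>)) (poly p)"
    using ip_poly_add_right[OF in_L2_poly, of a b "w * pderiv \<theta>" e p] by simp
  then show ?thesis using 1 by simp
qed

text \<open>The affine weight k0 - k1 x covers all uses: k1 = 0 gives the plain energy inequality,
  and k1 = 1 a decreasing weight that yields the L2 norm of \<theta>. Only the sign of
  \<open>D\<close> enters.\<close>

lemma weighted_energy:
  assumes ab: "a < b" and r: "1 \<le> r" and k: "0 \<le> k1"
    and D: "\<And>x :: nat \<Rightarrow> real. (\<Sum>i<M. \<Sum>j<M. x i * D i j * x j) \<le> 0"
    and th: "\<And>i. i < M \<Longrightarrow> degree (\<theta> i) \<le> r"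
    and eq: "\<And>i. i < M \<Longrightarrow> pderiv (\<theta> i) = (\<Sum>j<M. smult (D i j) (L2_proj (r - 1) a b (poly (\<theta> j)))) + g i"
    and B: "\<And>x. a < x \<Longrightarrow> x < b \<Longrightarrow> 0 \<le> k0 - k1 * x \<and> k0 - k1 * x \<le> B" "0 \<le> B"
  shows "(k0 - k1 * b) * (\<Sum>i<M. (poly (\<theta> i) b)\<^sup>2) - (k0 - k1 * a) * (\<Sum>i<M. (poly (\<theta> i) a)\<^sup>2)
     + k1 * (L2_set (\<lambda>i. nrm a b (poly (\<theta> i))) {..<M})\<^sup>2
    \<le> 2 * B * (L2_set (\<lambda>i. nrm a b (poly (g i))) {..<M} * L2_set (\<lambda>i. nrm a b (poly (\<theta> i))) {..<M})"
proof -
  define w where "w = [:k0, - k1:]"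
  define p where "p i = L2_proj (r - 1) a b (poly (\<theta> i))" for i
  have w: "poly w x = k0 - k1 * x" for x by (simp add: w_def)
  have sq: "(L2_set (\<lambda>i. nrm a b (poly (\<theta> i))) {..<M})\<^sup>2 = (\<Sum>i<M. ip a b (poly (\<theta> i)) (poly (\<theta> i)))"
    by (simp add: L2_set_def sum_nonneg nrm_sq ip_self_nonneg)
  have "(k0 - k1 * b) * (\<Sum>i<M. (poly (\<theta> i) b)\<^sup>2) - (k0 - k1 * a) * (\<Sum>i<M. (poly (\<theta> i) a)\<^sup>2)
     + k1 * (L2_set (\<lambda>i. nrm a b (poly (\<theta> i))) {..<M})\<^sup>2
    = (\<Sum>i<M. poly w b * (poly (\<theta> i) b)\<^sup>2 - poly w a * (poly (\<theta> i) a)\<^sup>2 + k1 * ip a b (poly (\<theta> i)) (poly (\<theta> i)))"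
    unfolding sq by (simp add: sum.distrib sum_subtractf sum_distrib_left w)
  also have "\<dots> \<le> (\<Sum>i<M. 2 * ip a b (poly (w * pderiv (\<theta> i))) (poly (p i)))"
    unfolding w_def p_def by (intro sum_mono weighted_energy_one[OF ab th r k]) auto
  also have "\<dots> = 2 * ((\<Sum>i<M. \<Sum>j<M. D i j * ip a b (poly (w * p j)) (poly (p i))) + (\<Sum>i<M. ip a b (poly (w * g i)) (poly (p i))))"
  proof -
    have "ip a b (poly (w * pderiv (\<theta> i))) (poly (p i))
      = (\<Sum>j<M. D i j * ip a b (poly (w * p j)) (poly (p i))) + ip a b (poly (w * g i)) (poly (p i))" if "i < M" for i
    proof -
      have "w * pderiv (\<theta> i) = (\<Sum>j<M. smult (D i j) (w * p j)) + w * g i"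
        by (simp add: eq[OF that] p_def distrib_left sum_distrib_left)
      moreover have "poly (\<Sum>j<M. smult (D i j) (w * p j)) = (\<lambda>x. \<Sum>j<M. poly (smult (D i j) (w * p j)) x)"
        by (simp add: fun_eq_iff poly_sum)
      ultimately show ?thesis
        by (simp only: ip_poly_add_left in_L2_poly ip_sum_left ip_poly_smult_left)
    qed
    then show ?thesis by (simp add: sum.distrib sum_distrib_left[symmetric])
  qed
  \<comment> \<open>Both arguments are the projections, so at each x the integrand is the
    nonnegative weight times the quadratic form of \<open>D\<close> at the vector of values
    \<open>p i\<close>.\<close>
  also have "(\<Sum>i<M. \<Sum>j<M. D i j * ip a b (poly (w * p j)) (poly (p i))) \<le> 0"
  proof -
    have i: "integrable (lebesgue_on {a<..<b}) (\<lambda>x. D i j * (poly (w * p j) x * poly (p i) x))" for i j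
      by (intro integrable_mult_right in_L2_mult in_L2_poly)
    have "(\<Sum>i<M. \<Sum>j<M. D i j * ip a b (poly (w * p j)) (poly (p i)))
      = (\<integral>x. (\<Sum>i<M. \<Sum>j<M. D i j * (poly (w * p j) x * poly (p i) x)) \<partial>lebesgue_on {a<..<b})"
      unfolding ip_def using i by (simp del: poly_mult)
    also have "\<dots> = (\<integral>x. poly w x * (\<Sum>i<M. \<Sum>j<M. poly (p i) x * D i j * poly (p j) x) \<partial>lebesgue_on {a<..<b})"
      by (simp add: sum_distrib_left ac_simps)
    also have "\<dots> \<le> (\<integral>x. 0 \<partial>lebesgue_on {a<..<b})"
    proof (rule integral_mono_AE)
      have "(\<lambda>x. poly w x * (\<Sum>i<M. \<Sum>j<M. poly (p i) x * D i j * poly (p j) x))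
         = (\<lambda>x. (\<Sum>i<M. \<Sum>j<M. D i j * (poly (w * p j) x * poly (p i) x)))"
        by (simp add: sum_distrib_left ac_simps)
      then show "integrable (lebesgue_on {a<..<b}) (\<lambda>x. poly w x * (\<Sum>i<M. \<Sum>j<M. poly (p i) x * D i j * poly (p j) x))"
        using i by (simp del: poly_mult)
      show "AE x in lebesgue_on {a<..<b}. poly w x * (\<Sum>i<M. \<Sum>j<M. poly (p i) x * D i j * poly (p j) x) \<le> 0"
        using D B(1) by (intro AE_I2 mult_nonneg_nonpos) (auto simp: w)
    qed simp
    finally show ?thesis by simp
  qed
  also have "(\<Sum>i<M. ip a b (poly (w * g i)) (poly (p i))) \<le> (\<Sum>i<M. B * (\<bar>nrm a b (poly (g i))\<bar> * \<bar>nrm a b (poly (\<theta> i))\<bar>))"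
  proof (rule sum_mono)
    fix i
    have "ip a b (poly (w * g i)) (poly (p i)) \<le> nrm a b (poly (w * g i)) * nrm a b (poly (p i))"
      using ip_Cauchy_Schwarz[OF in_L2_poly in_L2_poly, of a b "w * g i" "p i"] by linarith
    also have "\<dots> \<le> (B * nrm a b (poly (g i))) * nrm a b (poly (\<theta> i))"
    proof (rule mult_mono)
      have "nrm a b (poly (w * g i)) \<le> nrm a b (\<lambda>x. B * poly (g i) x)"
        using B by (intro nrm_mono in_L2_poly in_L2_cmult) (auto simp: w abs_mult intro!: mult_right_mono)
      then show "nrm a b (poly (w * g i)) \<le> B * nrm a b (poly (g i))" using B by (simp add: nrm_cmult)
      show "nrm a b (poly (p i)) \<le> nrm a b (poly (\<theta> i))" unfolding p_def by (rule nrm_L2_proj_le[OF ab in_L2_poly])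
    qed (use B in auto)
    finally show "ip a b (poly (w * g i)) (poly (p i)) \<le> B * (\<bar>nrm a b (poly (g i))\<bar> * \<bar>nrm a b (poly (\<theta> i))\<bar>)" by simp
  qed
  also have "\<dots> \<le> B * (L2_set (\<lambda>i. nrm a b (poly (g i))) {..<M} * L2_set (\<lambda>i. nrm a b (poly (\<theta> i))) {..<M})"
    unfolding sum_distrib_left[symmetric] using B by (intro mult_left_mono L2_set_mult_ineq)
  finally show ?thesis by simp
qed

text \<open>With E2 bounding the squared data, the L2 bound 2 T sqrt E2 for \<theta> inserted into
  the plain energy inequality gives 2 * 2 T E2 at the nodes. Between the nodes, 24 is 2 from the
  pointwise polynomial bound times 12 from the local energy.\<close>

lemma discrete_stability:
  fixes t :: "nat \<Rightarrow> real"
  assumes t0: "t 0 = 0" and tN: "t N = T" and T: "0 < T" and tm: "\<And>n. n < N \<Longrightarrow> t n < t (Suc n)" and r: "1 \<le> r"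
    and D: "\<And>x :: nat \<Rightarrow> real. (\<Sum>i<M. \<Sum>j<M. x i * D i j * x j) \<le> 0"
    and th: "\<And>n i. n < N \<Longrightarrow> i < M \<Longrightarrow> degree (\<theta> n i) \<le> r"
    and eq: "\<And>n i. n < N \<Longrightarrow> i < M \<Longrightarrow> pderiv (\<theta> n i)
       = (\<Sum>j<M. smult (D i j) (L2_proj (r - 1) (t n) (t (Suc n)) (poly (\<theta> n j)))) + g n i"
    and e: "\<And>n i. n < N \<Longrightarrow> i < M \<Longrightarrow> poly (\<theta> n i) (t n) = e n i"
      "\<And>n i. n < N \<Longrightarrow> i < M \<Longrightarrow> poly (\<theta> n i) (t (Suc n)) = e (Suc n) i" "\<And>i. i < M \<Longrightarrow> e 0 i = 0"
    and E: "(\<Sum>n<N. \<Sum>i<M. (nrm (t n) (t (Suc n)) (poly (g n i)))\<^sup>2) \<le> E2"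
  shows "n \<le> N \<Longrightarrow> (\<Sum>i<M. (e n i)\<^sup>2) \<le> 4 * T * E2"
    and "n < N \<Longrightarrow> x \<in> {t n..t (Suc n)} \<Longrightarrow> (\<Sum>i<M. (poly (\<theta> n i) x)\<^sup>2) \<le> 24 * (real r + 1)\<^sup>2 * T * E2"
proof -
  define s where "s n = (\<Sum>i<M. (e n i)\<^sup>2)" for n
  define G where "G n = L2_set (\<lambda>i. nrm (t n) (t (Suc n)) (poly (g n i))) {..<M}" for n
  define H where "H n = L2_set (\<lambda>i. nrm (t n) (t (Suc n)) (poly (\<theta> n i))) {..<M}" for n
  define GG where "GG = L2_set G {..<N}"
  define HH where "HH = L2_set H {..<N}"
  have nn: "0 \<le> G n" "0 \<le> H n" "0 \<le> GG" "0 \<le> HH" "0 \<le> s n" for n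
    by (auto simp: G_def H_def GG_def HH_def s_def L2_set_nonneg sum_nonneg)
  have mono: "t m \<le> t n" if "m \<le> n" "n \<le> N" for m n
    by (rule partition_mono[OF _ that]) (simp add: tm less_imp_le)
  have GE: "GG\<^sup>2 \<le> E2"
    using E by (simp add: GG_def G_def L2_set_def sum_nonneg)
  have prod: "(\<Sum>m<n. G m * H m) \<le> GG * HH" if "n \<le> N" for n
  proof -
    have "(\<Sum>m<n. G m * H m) \<le> (\<Sum>m<N. G m * H m)"
      using that nn by (intro sum_mono2) auto
    also have "\<dots> \<le> GG * HH" using L2_set_mult_ineq[of G H "{..<N}"] nn by (simp add: GG_def HH_def)
    finally show ?thesis .
  qed
  have se: "(\<Sum>i<M. (poly (\<theta> n i) (t n))\<^sup>2) = s n" "(\<Sum>i<M. (poly (\<theta> n i) (t (Suc n)))\<^sup>2) = s (Suc n)" if "n < N" for n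
    using e(1,2)[OF that] by (auto simp: s_def)
  have en: "(k0 - k1 * t (Suc n)) * s (Suc n) - (k0 - k1 * t n) * s n + k1 * (H n)\<^sup>2 \<le> 2 * B * (G n * H n)"
    if n: "n < N" and "0 \<le> k1" "\<And>x. t n < x \<Longrightarrow> x < t (Suc n) \<Longrightarrow> 0 \<le> k0 - k1 * x \<and> k0 - k1 * x \<le> B" "0 \<le> B" for n k0 k1 B
    using weighted_energy[OF tm[OF n] r that(2) D th[OF n] eq[OF n] that(3,4)]
    unfolding se[OF n] G_def H_def by simp
  have tel: "(\<Sum>n<m. f (Suc n) - f n) = f m - f 0" for f :: "nat \<Rightarrow> real" and m by (rule sum_lessThan_telescope)
  have s0: "s 0 = 0" using e(3) by (simp add: s_def)
  have bnd: "0 \<le> t n" "t n \<le> T" if "n \<le> N" for n using mono[of 0 n] mono[of n N] that t0 tN by auto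
  \<comment> \<open>With weight T - t the nodal terms telescope and leave nothing: \<theta> vanishes
    at time 0 and the weight at time T.\<close>
  have HH: "HH \<le> 2 * T * GG"
  proof -
    have "(\<Sum>n<N. ((T - t (Suc n)) * s (Suc n) - (T - t n) * s n) + (H n)\<^sup>2) \<le> (\<Sum>n<N. 2 * T * (G n * H n))"
    proof (rule sum_mono)
      fix n assume "n \<in> {..<N}"
      then have n: "n < N" by simp
      show "((T - t (Suc n)) * s (Suc n) - (T - t n) * s n) + (H n)\<^sup>2 \<le> 2 * T * (G n * H n)"
        using en[OF n, of 1 T T] bnd[of n] bnd[of "Suc n"] n T by fastforce
    qed
    then have "(T - t N) * s N - (T - t 0) * s 0 + (\<Sum>n<N. (H n)\<^sup>2) \<le> 2 * T * (\<Sum>n<N. G n * H n)"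
      unfolding sum.distrib tel[of "\<lambda>n. (T - t n) * s n"] by (simp only: sum_distrib_left[symmetric])
    also have "\<dots> \<le> 2 * T * (GG * HH)" using prod[of N] T by (intro mult_left_mono) auto
    finally have "HH * HH \<le> (2 * T * GG) * HH"
      by (simp add: s0 tN HH_def L2_set_def sum_nonneg power2_eq_square[symmetric] del: power2_eq_square)
    then show ?thesis using nn(3,4) T by (cases "HH = 0") (auto simp: mult_le_cancel_right)
  qed
  have snode: "s n \<le> 4 * T * E2" if "n \<le> N" for n
  proof -
    have "(\<Sum>m<n. s (Suc m) - s m) \<le> (\<Sum>m<n. 2 * (G m * H m))"
    proof (rule sum_mono)
      fix m assume "m \<in> {..<n}"
      then show "s (Suc m) - s m \<le> 2 * (G m * H m)" using en[of m 0 1 1] that by simp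
    qed
    then have "s n \<le> 2 * (\<Sum>m<n. G m * H m)" unfolding tel by (simp add: s0 sum_distrib_left)
    also have "\<dots> \<le> 2 * (GG * (2 * T * GG))"
      using prod[OF that] HH nn(3) by (intro mult_left_mono order_trans[OF prod[OF that]]) auto
    also have "\<dots> = 4 * T * GG\<^sup>2" by (simp add: power2_eq_square)
    also have "\<dots> \<le> 4 * T * E2" using GE T by (intro mult_left_mono) auto
    finally show ?thesis .
  qed
  then show "n \<le> N \<Longrightarrow> (\<Sum>i<M. (e n i)\<^sup>2) \<le> 4 * T * E2" by (simp add: s_def)
  show "(\<Sum>i<M. (poly (\<theta> n i) x)\<^sup>2) \<le> 24 * (real r + 1)\<^sup>2 * T * E2" if n: "n < N" and x: "x \<in> {t n..t (Suc n)}"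
  proof -
    define h where "h = t (Suc n) - t n"
    have h: "0 < h" "h \<le> T" using tm[OF n] bnd[of n] bnd[of "Suc n"] n by (auto simp: h_def)
    have E0: "0 \<le> E2" using GE by (meson order_trans zero_le_power2)
    have Gn: "(G n)\<^sup>2 \<le> E2"
    proof -
      have "(G n)\<^sup>2 \<le> (\<Sum>n<N. (G n)\<^sup>2)" using n by (intro member_le_sum) auto
      also have "\<dots> = GG\<^sup>2" by (simp add: GG_def L2_set_def sum_nonneg)
      finally show ?thesis using GE by linarith
    qed
    \<comment> \<open>The local weight t_(n+1) - t vanishes at the right node and is at most h. The
      squared norm on one interval is thereby O(h), the factor that cancels 1 / h in the inverse
      inequality: Young's inequality leaves (H n)^2 / 2 <= 4 h T E2 + 2 h T E2.\<close>
    have "(H n)\<^sup>2 - h * s n \<le> 2 * h * (G n * H n)"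
      using en[OF n, of 1 "t (Suc n)" h] h by (simp add: h_def)
    moreover have "2 * h * (G n * H n) \<le> (H n)\<^sup>2 / 2 + 2 * h\<^sup>2 * (G n)\<^sup>2"
      using zero_le_power2[of "H n - 2 * h * G n"] by (simp add: power2_eq_square algebra_simps)
    moreover have "h * s n \<le> h * (4 * T * E2)" using snode[of n] n h by (intro mult_left_mono) auto
    moreover have "h\<^sup>2 * (G n)\<^sup>2 \<le> h * (T * E2)"
      using h Gn E0 by (simp add: power2_eq_square mult.assoc mult_left_mono mult_mono)
    ultimately have Hn: "(H n)\<^sup>2 \<le> 12 * h * T * E2" by linarith
    have "h * (\<Sum>i<M. (poly (\<theta> n i) x)\<^sup>2) \<le> (\<Sum>i<M. 2 * (real r + 1)\<^sup>2 * ip (t n) (t (Suc n)) (poly (\<theta> n i)) (poly (\<theta> n i)))"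
      unfolding sum_distrib_left h_def
      by (intro sum_mono poly_pointwise_bound[OF tm[OF n] x] th[OF n]) auto
    also have "\<dots> = 2 * (real r + 1)\<^sup>2 * (H n)\<^sup>2"
      by (simp add: H_def L2_set_def sum_nonneg nrm_sq ip_self_nonneg sum_distrib_left)
    also have "\<dots> \<le> 2 * (real r + 1)\<^sup>2 * (12 * h * T * E2)" using Hn by (intro mult_left_mono) auto
    finally have "h * (\<Sum>i<M. (poly (\<theta> n i) x)\<^sup>2) \<le> h * (24 * (real r + 1)\<^sup>2 * T * E2)" by (simp add: ac_simps)
    then show ?thesis using h by simp
  qed
qed

section \<open>The error equation of the Galerkin method\<close>

lemma cg_interp_eqI:
  assumes "pderiv q = L2_proj (r - 1) a b g" "poly q a = u a"
  shows "q = cg_interp r a b u g"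
proof -
  have "pderiv (q - cg_interp r a b u g) = 0" by (simp add: pderiv_diff pderiv_cg_interp assms)
  then have "degree (q - cg_interp r a b u g) = 0" by (simp add: pderiv_eq_0_iff)
  then obtain c where c: "q - cg_interp r a b u g = [:c:]" by (metis degree_eq_zeroE)
  have "poly (q - cg_interp r a b u g) a = 0" by (simp add: assms poly_cg_interp_left)
  then have "q - cg_interp r a b u g = 0" using c by simp
  then show ?thesis by simp
qed

lemma poly_eq_on_Ioo:
  fixes p q :: "real poly"
  assumes "a < b" "\<And>x. a < x \<Longrightarrow> x < b \<Longrightarrow> poly p x = poly q x" shows "p = q"
proof (rule ccontr)
  assume "p \<noteq> q"
  then have "finite {x. poly (p - q) x = 0}" by (intro poly_roots_finite) simp
  moreover have "{a<..<b} \<subseteq> {x. poly (p - q) x = 0}" using assms(2) by auto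
  ultimately show False using assms(1) by (meson finite_subset infinite_Ioo)
qed

lemma sum_pderiv: "pderiv (\<Sum>i\<in>A. f i) = (\<Sum>i\<in>A. pderiv (f i))" for f :: "'b \<Rightarrow> real poly"
  by (induction A rule: infinite_finite_induct) (auto simp: pderiv_add)

text \<open>The interpolant of Y has derivative P Y', while the scheme uses P R = P Y' - P (D Y). In
  the difference P Y' cancels, and inserting D P of the interpolant leaves D P \<theta> plus the
  projected interpolation error of D Y, the only data term.\<close>

lemma cg_error_bounds:
  assumes T: "0 < T" and D: "neg_semidef M (\<lambda>i j. D i j + D j i)" and r: "1 \<le> r"
    and tp: "time_partition T N t" and cg: "cg_solution T N t r M D Y0 R Yr"
    and Y: "\<And>i. i < M \<Longrightarrow> ac 0 T (Y i) (dY i)" "\<And>i. i < M \<Longrightarrow> Y i 0 = Y0 i"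
    and R: "\<And>i. i < M \<Longrightarrow> AE x in lebesgue_on {0<..<T}. dY i x - mat_vec M D Y i x = R i x"
    and E: "(\<Sum>n<N. \<Sum>i<M. (nrm (t n) (t (Suc n)) (\<lambda>x. mat_vec M D Y i x
       - poly (cg_interp r (t n) (t (Suc n)) (mat_vec M D Y i) (mat_vec M D dY i)) x))\<^sup>2) \<le> E2"
  shows "n \<le> N \<Longrightarrow> L2_set (\<lambda>i. Y i (t n) - Yr i (t n)) {..<M} \<le> 2 * sqrt T * sqrt E2"
    and "n < N \<Longrightarrow> x \<in> {t n..t (Suc n)} \<Longrightarrow> L2_set (\<lambda>i. Y i x - Yr i x) {..<M}
      \<le> L2_set (\<lambda>i. Y i x - poly (cg_interp r (t n) (t (Suc n)) (Y i) (dY i)) x) {..<M} + 10 * real r * sqrt T * sqrt E2"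
proof -
  have t: "t 0 = 0" "t N = T" and tm: "\<And>n. n < N \<Longrightarrow> t n < t (Suc n)" using tp by (auto simp: time_partition_def)
  have mono: "t m \<le> t n" if "m \<le> n" "n \<le> N" for m n
    by (rule partition_mono[OF _ that]) (simp add: tm less_imp_le)
  have sub: "0 \<le> t n" "t (Suc n) \<le> T" if "n < N" for n
    using mono[of 0 n] mono[of "Suc n" N] that t by auto
  \<comment> \<open>The quadratic form of the symmetrised matrix is twice that of \<open>D\<close>,
    so the sign passes to \<open>D\<close>.\<close>
  have D0: "(\<Sum>i<M. \<Sum>j<M. x i * D i j * x j) \<le> 0" for x :: "nat \<Rightarrow> real"
  proof -
    have "(\<Sum>i<M. \<Sum>j<M. x i * (D i j + D j i) * x j) = (\<Sum>i<M. \<Sum>j<M. x i * D i j * x j) + (\<Sum>i<M. \<Sum>j<M. x i * D j i * x j)"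
      by (simp add: sum.distrib distrib_left distrib_right)
    also have "(\<Sum>i<M. \<Sum>j<M. x i * D j i * x j) = (\<Sum>i<M. \<Sum>j<M. x i * D i j * x j)"
      by (subst sum.swap) (simp add: ac_simps)
    finally show ?thesis using D[unfolded neg_semidef_def, rule_format, of x] by linarith
  qed
  have "\<exists>p. degree p \<le> r \<and> (\<forall>x\<in>{t n..t (Suc n)}. Yr i x = poly p x)" if n: "n < N" and i: "i < M" for n i
  proof -
    obtain p where p: "degree p \<le> r" "\<And>x. x \<in> {t n<..<t (Suc n)} \<Longrightarrow> Yr i x = poly p x"
      and c: "continuous_on {0..T} (Yr i)"
      using cg n i unfolding cg_solution_def cont_piecewise_poly_def by blast
    have "Yr i x = poly p x" if x: "x \<in> {t n..t (Suc n)}" for x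
    proof (rule continuous_AE_eq[OF tm[OF n] _ _ _ x])
      show "continuous_on {t n..t (Suc n)} (Yr i)" using c sub[OF n] by (auto intro: continuous_on_subset)
      show "continuous_on {t n..t (Suc n)} (poly p)" by (intro continuous_on_poly continuous_on_id)
      show "AE x in lebesgue_on {t n<..<t (Suc n)}. Yr i x = poly p x" using p(2) by (intro AE_I2) auto
    qed
    then show ?thesis using p(1) by blast
  qed
  then obtain \<rho> where rho: "\<And>n i. n < N \<Longrightarrow> i < M \<Longrightarrow> degree (\<rho> n i) \<le> r"
    "\<And>n i x. n < N \<Longrightarrow> i < M \<Longrightarrow> x \<in> {t n..t (Suc n)} \<Longrightarrow> Yr i x = poly (\<rho> n i) x"
    by metis
  define Q where "Q n i = cg_interp r (t n) (t (Suc n)) (Y i) (dY i)" for n i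
  define \<theta> where "\<theta> n i = Q n i - \<rho> n i" for n i
  define U where "U n i = cg_interp r (t n) (t (Suc n)) (mat_vec M D Y i) (mat_vec M D dY i)" for n i
  define g where "g n i = L2_proj (r - 1) (t n) (t (Suc n)) (\<lambda>x. mat_vec M D Y i x - poly (U n i) x)" for n i
  have acn: "ac (t n) (t (Suc n)) (Y i) (dY i)" if "n < N" "i < M" for n i
    using ac_subinterval[OF Y(1)[OF that(2)] sub[OF that(1)]] .
  have acu: "ac (t n) (t (Suc n)) (mat_vec M D Y i) (mat_vec M D dY i)" if "n < N" for n i
    unfolding mat_vec_def using that by (intro ac_sum ac_cmult acn) auto
  have Qe: "poly (Q n i) (t n) = Y i (t n)" "poly (Q n i) (t (Suc n)) = Y i (t (Suc n))" "degree (Q n i) \<le> r"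
    if "n < N" "i < M" for n i
    unfolding Q_def using poly_cg_interp_left poly_cg_interp_right[OF tm[OF that(1)] acn[OF that]]
      degree_cg_interp[OF tm[OF that(1)] ac_in_L2[OF acn[OF that]] r] by auto
  have th: "degree (\<theta> n i) \<le> r" if "n < N" "i < M" for n i
    unfolding \<theta>_def using Qe(3)[OF that] rho(1)[OF that] by (rule degree_diff_le)
  have eq: "pderiv (\<theta> n i) = (\<Sum>j<M. smult (D i j) (L2_proj (r - 1) (t n) (t (Suc n)) (poly (\<theta> n j)))) + g n i"
    if n: "n < N" and i: "i < M" for n i
  proof -
    define a where "a = t n"
    define b where "b = t (Suc n)"
    have ab: "a < b" using tm[OF n] by (simp add: a_def b_def)
    define P where "P = L2_proj (r - 1) a b"
    have YL: "in_L2 a b (Y j)" "in_L2 a b (dY j)" if "j < M" for j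
      using ac_in_L2_self[OF acn[OF n that]] ac_in_L2[OF acn[OF n that]] by (auto simp: a_def b_def)
    have uL: "in_L2 a b (mat_vec M D Y i)" using ac_in_L2_self[OF acu[OF n]] by (simp add: a_def b_def)
    \<comment> \<open>An equation almost everywhere is enough, because R enters the scheme only
      through its projection.\<close>
    have PR: "P (R i) = P (dY i) - P (mat_vec M D Y i)"
    proof -
      have "AE x in lebesgue. 0 < x \<and> x < T \<longrightarrow> dY i x - mat_vec M D Y i x = R i x"
        using R[OF i] by (simp only: AE_lebesgue_on_Ioo_iff)
      then have "AE x in lebesgue. a < x \<and> x < b \<longrightarrow> dY i x - mat_vec M D Y i x = R i x"
        by eventually_elim (use sub[OF n] in \<open>auto simp: a_def b_def\<close>)
      then have "AE x in lebesgue_on {a<..<b}. dY i x - mat_vec M D Y i x = R i x" by (simp only: AE_lebesgue_on_Ioo_iff)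
      then have "P (\<lambda>x. dY i x - mat_vec M D Y i x) = P (R i)"
        unfolding P_def using YL(2)[OF i] uL by (intro L2_proj_cong_AE[OF ab]) auto
      then show ?thesis using L2_proj_diff[OF ab YL(2)[OF i] uL] by (simp add: P_def)
    qed
    have PYr: "P (Yr j) = P (poly (\<rho> n j))" if "j < M" for j
      unfolding P_def
      by (rule L2_proj_cong_AE[OF ab in_L2_poly, symmetric]) (use rho(2)[OF n that] in \<open>auto simp: a_def b_def intro!: AE_I2\<close>)
    have drho: "pderiv (\<rho> n i) = (\<Sum>j<M. smult (D i j) (P (poly (\<rho> n j)))) + P (R i)"
    proof (rule poly_eq_on_Ioo[OF ab])
      fix x assume x: "a < x" "x < b"
      have "(Yr i has_real_derivative (mat_vec M D (\<lambda>j. poly (P (Yr j))) i x + poly (P (R i)) x)) (at x)"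
        using cg n i x unfolding cg_solution_def P_def a_def b_def by auto
      then have "(poly (\<rho> n i) has_real_derivative (mat_vec M D (\<lambda>j. poly (P (Yr j))) i x + poly (P (R i)) x)) (at x)"
        by (rule has_field_derivative_transform_within[where d = "min (x - a) (b - x)"])
           (use x rho(2)[OF n i] in \<open>auto simp: a_def b_def dist_real_def abs_if split: if_splits\<close>)
      then have "mat_vec M D (\<lambda>j. poly (P (Yr j))) i x + poly (P (R i)) x = poly (pderiv (\<rho> n i)) x"
        using DERIV_unique poly_DERIV by blast
      then show "poly (pderiv (\<rho> n i)) x = poly ((\<Sum>j<M. smult (D i j) (P (poly (\<rho> n j)))) + P (R i)) x"
        using PYr by (simp add: mat_vec_def poly_sum)
    qed
    \<comment> \<open>Interpolation commutes with a constant matrix: both sides have the same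
      derivative and the same value at the left node.\<close>
    have UQ: "U n i = (\<Sum>j<M. smult (D i j) (Q n j))"
    proof -
      have "L2_proj (r - 1) a b (mat_vec M D dY i) = (\<Sum>j<M. smult (D i j) (L2_proj (r - 1) a b (dY j)))"
        unfolding mat_vec_def using YL(2) by (subst L2_proj_sum[OF ab]) (auto simp: L2_proj_cmult[OF ab])
      then have "pderiv (\<Sum>j<M. smult (D i j) (Q n j)) = L2_proj (r - 1) a b (mat_vec M D dY i)"
        by (simp add: sum_pderiv pderiv_smult Q_def pderiv_cg_interp a_def b_def)
      moreover have "poly (\<Sum>j<M. smult (D i j) (Q n j)) a = mat_vec M D Y i a"
        by (simp add: poly_sum Q_def poly_cg_interp_left mat_vec_def a_def)
      ultimately show ?thesis unfolding U_def a_def b_def by (intro cg_interp_eqI[symmetric])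
    qed
    have Pu: "P (mat_vec M D Y i) = (\<Sum>j<M. smult (D i j) (P (Y j)))"
      unfolding mat_vec_def P_def using YL(1) by (subst L2_proj_sum[OF ab]) (auto simp: L2_proj_cmult[OF ab])
    have PU: "P (poly (U n i)) = (\<Sum>j<M. smult (D i j) (P (poly (Q n j))))"
    proof -
      have "poly (U n i) = (\<lambda>x. \<Sum>j<M. D i j * poly (Q n j) x)" by (simp add: UQ fun_eq_iff poly_sum)
      then show ?thesis unfolding P_def by (simp add: L2_proj_sum[OF ab] in_L2_cmult L2_proj_cmult[OF ab])
    qed
    have gP: "g n i = P (mat_vec M D Y i) - P (poly (U n i))"
      unfolding g_def P_def a_def[symmetric] b_def[symmetric] by (rule L2_proj_diff[OF ab uL in_L2_poly])
    have Pth: "P (poly (\<theta> n j)) = P (poly (Q n j)) - P (poly (\<rho> n j))" for j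
      unfolding \<theta>_def P_def poly_fun_simps by (rule L2_proj_diff[OF ab in_L2_poly in_L2_poly])
    have "pderiv (\<theta> n i) = P (mat_vec M D Y i) - (\<Sum>j<M. smult (D i j) (P (poly (\<rho> n j))))"
      by (simp only: \<theta>_def pderiv_diff Q_def pderiv_cg_interp drho PR a_def[symmetric] b_def[symmetric] P_def[symmetric])
    also have "\<dots> = (\<Sum>j<M. smult (D i j) (P (poly (\<theta> n j)))) + g n i"
      unfolding gP PU Pth by (simp add: smult_diff_right sum_subtractf)
    finally show ?thesis by (simp add: P_def a_def b_def)
  qed
  have e1: "poly (\<theta> n i) (t n) = Y i (t n) - Yr i (t n)" "poly (\<theta> n i) (t (Suc n)) = Y i (t (Suc n)) - Yr i (t (Suc n))"
    if "n < N" "i < M" for n i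
    using Qe[OF that] rho(2)[OF that] tm[OF that(1)] by (auto simp: \<theta>_def)
  have e0: "Y i (t 0) - Yr i (t 0) = 0" if "i < M" for i
    using Y(2)[OF that] cg that t(1) by (simp add: cg_solution_def)
  have E': "(\<Sum>n<N. \<Sum>i<M. (nrm (t n) (t (Suc n)) (poly (g n i)))\<^sup>2) \<le> E2"
  proof (rule order_trans[OF _ E], intro sum_mono power_mono)
    fix n i assume "n \<in> {..<N}" "i \<in> {..<M}"
    then have n: "n < N" by simp
    show "nrm (t n) (t (Suc n)) (poly (g n i)) \<le> nrm (t n) (t (Suc n)) (\<lambda>x. mat_vec M D Y i x
       - poly (cg_interp r (t n) (t (Suc n)) (mat_vec M D Y i) (mat_vec M D dY i)) x)"
      unfolding g_def U_def using ac_in_L2_self[OF acu[OF n]] by (intro nrm_L2_proj_le tm[OF n]) auto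
  qed simp
  have stab1: "(\<Sum>i<M. (Y i (t n) - Yr i (t n))\<^sup>2) \<le> 4 * T * E2" if "n \<le> N" for n
    by (rule discrete_stability(1)[where t = t and N = N and T = T and r = r and M = M and D = D
          and \<theta> = \<theta> and g = g and e = "\<lambda>n i. Y i (t n) - Yr i (t n)"])
      (rule t T r D0 E' that | (rule tm th eq e1 e0; assumption))+
  have stab2: "(\<Sum>i<M. (poly (\<theta> n i) x)\<^sup>2) \<le> 24 * (real r + 1)\<^sup>2 * T * E2"
    if "n < N" "x \<in> {t n..t (Suc n)}" for n x
    by (rule discrete_stability(2)[where t = t and N = N and T = T and r = r and M = M and D = D
          and \<theta> = \<theta> and g = g and e = "\<lambda>n i. Y i (t n) - Yr i (t n)"])
      (rule t T r D0 E' that | (rule tm th eq e1 e0; assumption))+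
  show "L2_set (\<lambda>i. Y i (t n) - Yr i (t n)) {..<M} \<le> 2 * sqrt T * sqrt E2" if "n \<le> N"
  proof -
    have "sqrt (\<Sum>i<M. (Y i (t n) - Yr i (t n))\<^sup>2) \<le> sqrt (4 * T * E2)"
      using stab1[OF that] by (rule real_sqrt_le_mono)
    then show ?thesis by (simp add: L2_set_def real_sqrt_mult)
  qed
  show "L2_set (\<lambda>i. Y i x - Yr i x) {..<M}
      \<le> L2_set (\<lambda>i. Y i x - poly (cg_interp r (t n) (t (Suc n)) (Y i) (dY i)) x) {..<M} + 10 * real r * sqrt T * sqrt E2"
    if n: "n < N" and x: "x \<in> {t n..t (Suc n)}"
  proof -
    have E0: "0 \<le> E2" using E by (rule order_trans[rotated]) (intro sum_nonneg zero_le_power2)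
    have "L2_set (\<lambda>i. Y i x - Yr i x) {..<M} = L2_set (\<lambda>i. (Y i x - poly (Q n i) x) + poly (\<theta> n i) x) {..<M}"
      using rho(2)[OF n _ x] by (intro L2_set_cong) (auto simp: \<theta>_def)
    also have "\<dots> \<le> L2_set (\<lambda>i. Y i x - poly (Q n i) x) {..<M} + L2_set (\<lambda>i. poly (\<theta> n i) x) {..<M}"
      by (rule L2_set_triangle_ineq)
    also have "L2_set (\<lambda>i. poly (\<theta> n i) x) {..<M} \<le> 10 * real r * sqrt T * sqrt E2"
    proof -
      \<comment> \<open>As r >= 1, r + 1 is at most 2 r, and 24 (2 r)^2 = 96 r^2 is at most (10
        r)^2.\<close>
      have "(real r + 1)\<^sup>2 \<le> (2 * real r)\<^sup>2" using r by (intro power_mono) auto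
      then have "24 * (real r + 1)\<^sup>2 \<le> (10 * real r)\<^sup>2"
      proof -
        have "(2 * real r)\<^sup>2 = 4 * (real r)\<^sup>2" "(10 * real r)\<^sup>2 = 100 * (real r)\<^sup>2"
          by (simp_all add: power_mult_distrib)
        then show ?thesis using \<open>(real r + 1)\<^sup>2 \<le> (2 * real r)\<^sup>2\<close> zero_le_power2[of "real r"] by linarith
      qed
      then have "24 * (real r + 1)\<^sup>2 * (T * E2) \<le> (10 * real r)\<^sup>2 * (T * E2)"
        using T E0 by (intro mult_right_mono) auto
      then have "(\<Sum>i<M. (poly (\<theta> n i) x)\<^sup>2) \<le> (10 * real r)\<^sup>2 * (T * E2)"
        using stab2[OF n x] by (simp only: mult.assoc)
      then have "sqrt (\<Sum>i<M. (poly (\<theta> n i) x)\<^sup>2) \<le> sqrt ((10 * real r)\<^sup>2 * (T * E2))" by (rule real_sqrt_le_mono)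
      then show ?thesis by (simp add: L2_set_def real_sqrt_mult)
    qed
    finally show ?thesis by (simp add: Q_def)
  qed
qed

section \<open>Gagliardo and Hoelder seminorms\<close>

text \<open>The square of the Gagliardo seminorm, allowed to be infinite and taken over
  Borel--Lebesgue measure on the plane so that Tonelli applies.\<close>

definition gag :: "real \<Rightarrow> real \<Rightarrow> real \<Rightarrow> (real \<Rightarrow> real) \<Rightarrow> ennreal" where
  "gag a b \<sigma> w = (\<integral>\<^sup>+z. ennreal (gagliardo_quot \<sigma> w z) * indicator ({a<..<b} \<times> {a<..<b}) z \<partial>lborel)"

lemma gagliardo_quot_nonneg: "0 \<le> gagliardo_quot \<sigma> w z"
  by (simp add: gagliardo_quot_def split: prod.split)

lemma gagliardo_quot_measurable [measurable]:
  assumes [measurable]: "w \<in> borel_measurable borel"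
  shows "gagliardo_quot \<sigma> w \<in> borel_measurable borel"
proof -
  have "gagliardo_quot \<sigma> w = (\<lambda>z. (w (fst z) - w (snd z))\<^sup>2 / \<bar>fst z - snd z\<bar> powr (1 + 2 * \<sigma>))"
    by (auto simp: gagliardo_quot_def)
  also have "\<dots> \<in> borel_measurable borel"
    unfolding borel_prod[symmetric] by measurable
  finally show ?thesis .
qed

lemma nn_integral_lborel_prod:
  fixes f :: "real \<times> real \<Rightarrow> ennreal"
  assumes "f \<in> borel_measurable borel"
  shows "(\<integral>\<^sup>+z. f z \<partial>lborel) = (\<integral>\<^sup>+x. (\<integral>\<^sup>+y. f (x, y) \<partial>lborel) \<partial>lborel)"
proof -
  have "f \<in> borel_measurable (lborel \<Otimes>\<^sub>M lborel)" using assms by (simp add: lborel_prod)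
  from lborel.nn_integral_fst[OF this] show ?thesis by (simp add: lborel_prod)
qed

lemma osc_eq_prod:
  assumes [measurable]: "w \<in> borel_measurable borel"
  shows "osc a b \<delta> w = (\<integral>\<^sup>+z. ennreal ((w (fst z) - w (snd z))\<^sup>2) *
     indicator {z. fst z \<in> {a<..<b} \<and> snd z \<in> {a<..<b} \<and> \<bar>fst z - snd z\<bar> \<le> \<delta>} z \<partial>lborel)"
proof -
  have "(\<lambda>z. ennreal ((w (fst z) - w (snd z))\<^sup>2) *
     indicator {z. fst z \<in> {a<..<b} \<and> snd z \<in> {a<..<b} \<and> \<bar>fst z - snd z\<bar> \<le> \<delta>} z) \<in> borel_measurable borel"
    unfolding borel_prod[symmetric] by measurable
  from nn_integral_lborel_prod[OF this] show ?thesis by (simp add: osc_def)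
qed

text \<open>Inside the strip the denominator of the Gagliardo quotient is at most \<delta>^(1 + 2
  \<sigma>).\<close>

lemma osc_le_gag:
  assumes w [measurable]: "w \<in> borel_measurable borel" and d: "0 < \<delta>" and \<sigma>: "0 \<le> \<sigma>"
  shows "osc a b \<delta> w \<le> ennreal (\<delta> powr (1 + 2 * \<sigma>)) * gag a b \<sigma> w"
proof -
  have "osc a b \<delta> w \<le> (\<integral>\<^sup>+z. ennreal (\<delta> powr (1 + 2 * \<sigma>)) * (ennreal (gagliardo_quot \<sigma> w z) * indicator ({a<..<b} \<times> {a<..<b}) z) \<partial>lborel)"
    unfolding osc_eq_prod[OF w]
  proof (rule nn_integral_mono)
    fix z :: "real \<times> real"
    obtain x y where z: "z = (x, y)" by (cases z)
    show "ennreal ((w (fst z) - w (snd z))\<^sup>2) *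
       indicator {z. fst z \<in> {a<..<b} \<and> snd z \<in> {a<..<b} \<and> \<bar>fst z - snd z\<bar> \<le> \<delta>} z
      \<le> ennreal (\<delta> powr (1 + 2 * \<sigma>)) * (ennreal (gagliardo_quot \<sigma> w z) * indicator ({a<..<b} \<times> {a<..<b}) z)"
    proof (cases "x \<in> {a<..<b} \<and> y \<in> {a<..<b} \<and> \<bar>x - y\<bar> \<le> \<delta>")
      case True
      have "(w x - w y)\<^sup>2 \<le> \<delta> powr (1 + 2 * \<sigma>) * gagliardo_quot \<sigma> w (x, y)"
      proof (cases "x = y")
        case False
        define p where "p = \<bar>x - y\<bar> powr (1 + 2 * \<sigma>)"
        have p: "0 < p" "p \<le> \<delta> powr (1 + 2 * \<sigma>)" using False True \<sigma> by (auto simp: p_def intro!: powr_mono2)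
        have "(w x - w y)\<^sup>2 = p * ((w x - w y)\<^sup>2 / p)" using p by simp
        also have "\<dots> \<le> \<delta> powr (1 + 2 * \<sigma>) * ((w x - w y)\<^sup>2 / p)" using p by (intro mult_right_mono) auto
        finally show ?thesis by (simp add: gagliardo_quot_def p_def)
      qed (simp add: gagliardo_quot_def)
      then show ?thesis using True
        by (simp add: z ennreal_mult'[symmetric] gagliardo_quot_nonneg ennreal_leI)
    qed (auto simp: z)
  qed
  also have "\<dots> = ennreal (\<delta> powr (1 + 2 * \<sigma>)) * gag a b \<sigma> w"
    unfolding gag_def by (rule nn_integral_cmult)
      (auto intro!: borel_measurable_times_ennreal borel_measurable_indicator borel_open open_Times)
  finally show ?thesis .
qed

text \<open>The squares over the subintervals are disjoint blocks along the diagonal of the large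
  square. Nonlocality of the seminorm therefore does no harm when local bounds are added up.\<close>

lemma gag_partition:
  assumes w [measurable]: "w \<in> borel_measurable borel" and tm: "\<And>n. n < N \<Longrightarrow> t n \<le> t (Suc n)"
  shows "(\<Sum>n<N. gag (t n) (t (Suc n)) \<sigma> w) \<le> gag (t 0) (t N) \<sigma> w"
proof -
  have mono: "t m \<le> t n" if "m \<le> n" "n \<le> N" for m n
    by (rule partition_mono[OF _ that]) (simp add: tm less_imp_le)
  define S where "S n = {t n<..<t (Suc n)} \<times> {t n<..<t (Suc n)}" for n
  have dis: "disjoint_family_on S {..<N}"
    unfolding disjoint_family_on_def
  proof (intro ballI impI)
    fix m n assume mn: "m \<in> {..<N}" "n \<in> {..<N}" "m \<noteq> n"
    have "t (Suc m) \<le> t n \<or> t (Suc n) \<le> t m"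
      using mn mono[of "Suc m" n] mono[of "Suc n" m] by (cases "m < n") auto
    then show "S m \<inter> S n = {}" by (auto simp: S_def)
  qed
  have "(\<Sum>n<N. gag (t n) (t (Suc n)) \<sigma> w)
      = (\<integral>\<^sup>+z. (\<Sum>n<N. ennreal (gagliardo_quot \<sigma> w z) * indicator (S n) z) \<partial>lborel)"
    unfolding gag_def S_def by (subst nn_integral_sum) (auto intro!: borel_measurable_times_ennreal borel_measurable_indicator borel_open open_Times)
  also have "\<dots> \<le> gag (t 0) (t N) \<sigma> w"
    unfolding gag_def
  proof (rule nn_integral_mono)
    fix z :: "real \<times> real"
    have "(\<Sum>n<N. indicator (S n) z) = (indicator (\<Union>(S ` {..<N})) z :: ennreal)"
      by (rule indicator_UN_disjoint[symmetric, OF _ dis]) simp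
    also have "\<dots> \<le> indicator ({t 0<..<t N} \<times> {t 0<..<t N}) z"
    proof (rule indicator_leI)
      assume "z \<in> \<Union>(S ` {..<N})"
      then obtain n where n: "n < N" "z \<in> S n" by auto
      then show "z \<in> {t 0<..<t N} \<times> {t 0<..<t N}"
        using mono[of 0 n] mono[of "Suc n" N] by (auto simp: S_def)
    qed
    finally show "(\<Sum>n<N. ennreal (gagliardo_quot \<sigma> w z) * indicator (S n) z)
      \<le> ennreal (gagliardo_quot \<sigma> w z) * indicator ({t 0<..<t N} \<times> {t 0<..<t N}) z"
      unfolding sum_distrib_left[symmetric] by (rule mult_left_mono) simp
  qed
  finally show ?thesis .
qed

lemma AE_prod_eq:
  fixes v w :: "real \<Rightarrow> real"
  assumes "AE x in lebesgue_on {a<..<b}. v x = w x"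
  shows "AE z in lborel :: (real \<times> real) measure. z \<in> {a<..<b} \<times> {a<..<b} \<longrightarrow> v (fst z) = w (fst z) \<and> v (snd z) = w (snd z)"
proof -
  have "AE x in lebesgue. a < x \<and> x < b \<longrightarrow> v x = w x" using assms by (simp only: AE_lebesgue_on_Ioo_iff)
  then have "AE x in lborel. a < x \<and> x < b \<longrightarrow> v x = w x" by (simp add: AE_completion_iff)
  then obtain N where N: "{x \<in> space lborel. \<not> (a < x \<and> x < b \<longrightarrow> v x = w x)} \<subseteq> N" "N \<in> null_sets lborel"
    by (rule AE_E3) auto
  have "N \<times> UNIV \<in> null_sets (lborel \<Otimes>\<^sub>M lborel)" "UNIV \<times> N \<in> null_sets (lborel \<Otimes>\<^sub>M lborel)"
    using N(2) by (auto simp: null_sets_def lborel.emeasure_pair_measure_Times)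
  then have n: "N \<times> UNIV \<union> UNIV \<times> N \<in> null_sets (lborel :: (real \<times> real) measure)"
    unfolding lborel_prod by (rule null_sets.Un)
  show ?thesis by (rule AE_I'[OF n]) (use N(1) in auto)
qed

text \<open>The bridge between the seminorm in \<open>Hs_norm\<close>, formed with an arbitrary
  Lebesgue measurable representative, and the Borel version \<open>gag\<close>.\<close>

lemma gag_eq_lebesgue:
  assumes w [measurable]: "w \<in> borel_measurable borel" and ae: "AE x in lebesgue_on {a<..<b}. v x = w x"
  shows "gagliardo_quot \<sigma> v \<in> borel_measurable (lebesgue_on ({a<..<b} \<times> {a<..<b}))"
    and "(\<integral>\<^sup>+z. ennreal (gagliardo_quot \<sigma> v z) \<partial>lebesgue_on ({a<..<b} \<times> {a<..<b})) = gag a b \<sigma> w"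
proof -
  let ?S = "{a<..<b} \<times> {a<..<b}"
  have S: "?S \<in> sets borel" by (intro borel_open open_Times) auto
  then have Sl: "?S \<in> sets lebesgue" by simp
  have "AE z in lebesgue. z \<in> ?S \<longrightarrow> v (fst z) = w (fst z) \<and> v (snd z) = w (snd z)"
    using AE_prod_eq[OF ae] by (rule AE_completion)
  then have q: "AE z in lebesgue. z \<in> ?S \<longrightarrow> gagliardo_quot \<sigma> v z = gagliardo_quot \<sigma> w z"
    by eventually_elim (auto simp: gagliardo_quot_def split: prod.splits)
  have qm: "(\<lambda>z. indicator ?S z * gagliardo_quot \<sigma> w z) \<in> borel_measurable lborel"
    using S by (intro borel_measurable_times borel_measurable_indicator) auto
  have "(\<lambda>z. indicator ?S z * gagliardo_quot \<sigma> v z) \<in> borel_measurable lebesgue"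
  proof (rule measurableI)
    fix A :: "real set" assume A: "A \<in> sets borel"
    have "(\<lambda>z. indicator ?S z * gagliardo_quot \<sigma> w z) -` A \<inter> space lebesgue \<in> sets lebesgue"
      by (rule measurable_sets[OF measurable_completion[OF qm] A])
    moreover have "AE z in lebesgue. z \<in> (\<lambda>z. indicator ?S z * gagliardo_quot \<sigma> w z) -` A \<inter> space lebesgue
       \<longleftrightarrow> z \<in> (\<lambda>z. indicator ?S z * gagliardo_quot \<sigma> v z) -` A \<inter> space lebesgue"
      using q by eventually_elim (auto split: split_indicator)
    ultimately show "(\<lambda>z. indicator ?S z * gagliardo_quot \<sigma> v z) -` A \<inter> space lebesgue \<in> sets lebesgue"
      using completion.in_sets_AE by blast
  qed auto
  then show "gagliardo_quot \<sigma> v \<in> borel_measurable (lebesgue_on ?S)"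
    using Sl by (subst borel_measurable_restrict_space_iff) (auto simp: mult.commute)
  have "(\<integral>\<^sup>+z. ennreal (gagliardo_quot \<sigma> v z) \<partial>lebesgue_on ?S)
     = (\<integral>\<^sup>+z. ennreal (gagliardo_quot \<sigma> v z) * indicator ?S z \<partial>lebesgue)"
    using Sl by (simp add: nn_integral_restrict_space)
  also have "\<dots> = (\<integral>\<^sup>+z. ennreal (gagliardo_quot \<sigma> w z) * indicator ?S z \<partial>lebesgue)"
    by (rule nn_integral_cong_AE) (use q in \<open>eventually_elim, auto split: split_indicator\<close>)
  also have "\<dots> = gag a b \<sigma> w"
    unfolding gag_def using S
    by (auto intro!: nn_integral_completion borel_measurable_times_ennreal borel_measurable_indicator)
  finally show "(\<integral>\<^sup>+z. ennreal (gagliardo_quot \<sigma> v z) \<partial>lebesgue_on ?S) = gag a b \<sigma> w" .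
qed

lemma gag_eq_integral:
  assumes "w \<in> borel_measurable borel" "AE x in lebesgue_on {a<..<b}. v x = w x" "gag a b \<sigma> w < \<infinity>"
  shows "gag a b \<sigma> w = ennreal (\<integral>z. gagliardo_quot \<sigma> v z \<partial>lebesgue_on ({a<..<b} \<times> {a<..<b}))"
proof -
  let ?M = "lebesgue_on ({a<..<b} \<times> {a<..<b})"
  have "integrable ?M (gagliardo_quot \<sigma> v)"
    using gag_eq_lebesgue[OF assms(1,2), of \<sigma>] assms(3)
    by (auto simp: integrable_iff_bounded gagliardo_quot_nonneg)
  then show ?thesis
    using nn_integral_eq_integral[of ?M "gagliardo_quot \<sigma> v"] gag_eq_lebesgue(2)[OF assms(1,2), of \<sigma>]
    by (simp add: gagliardo_quot_nonneg)
qed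

lemma gag_finite_if_integrable:
  assumes "w \<in> borel_measurable borel" "AE x in lebesgue_on {a<..<b}. v x = w x"
    "integrable (lebesgue_on ({a<..<b} \<times> {a<..<b})) (gagliardo_quot \<sigma> v)"
  shows "gag a b \<sigma> w < \<infinity>"
  unfolding gag_eq_lebesgue(2)[OF assms(1,2), symmetric]
  using assms(3) by (simp add: integrable_iff_bounded gagliardo_quot_nonneg)

lemma nn_integral_abs_powr_finite:
  fixes p T :: real
  assumes p: "-1 < p" and T: "0 \<le> T"
  shows "(\<integral>\<^sup>+z. ennreal (\<bar>z\<bar> powr p) * indicator {-T..T} z \<partial>lborel) < \<infinity>"
proof -
  define I where "I = (\<integral>\<^sup>+z. ennreal (z powr p) * indicator {0..T} z \<partial>lborel)"
  have I: "I = ennreal (T powr (p + 1) / (p + 1))"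
    unfolding I_def by (rule nn_integral_has_integral_lebesgue'[OF _ has_integral_powr_from_0[OF p T]]) auto
  have m: "(\<lambda>z. ennreal (z powr p) * indicator {0..T} z) \<in> borel_measurable borel" by measurable
  have I': "(\<integral>\<^sup>+z. ennreal ((- z) powr p) * indicator {0..T} (- z) \<partial>lborel) = I"
    using nn_integral_real_affine[OF m, of "-1" 0] by (simp add: I_def)
  have "(\<integral>\<^sup>+z. ennreal (\<bar>z\<bar> powr p) * indicator {-T..T} z \<partial>lborel)
    \<le> (\<integral>\<^sup>+z. ennreal (z powr p) * indicator {0..T} z + ennreal ((- z) powr p) * indicator {0..T} (- z) \<partial>lborel)"
    by (intro nn_integral_mono) (auto split: split_indicator simp: abs_if)
  also have "\<dots> = I + I"
    by (subst nn_integral_add) (auto simp: I' I_def[symmetric])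
  also have "\<dots> < \<infinity>" by (simp add: I)
  finally show ?thesis .
qed

text \<open>The quotient is at most B^2 |x - y|^(1 - 2 \<sigma>), and this exponent exceeds -1. It
  yields finiteness of the fractional part of the H^s norm of D Y, without which that norm could
  take a default value.\<close>

lemma gag_finite_if_Lipschitz:
  assumes w [measurable]: "w \<in> borel_measurable borel" and ae: "AE x in lebesgue_on {0<..<T}. u x = w x"
    and L: "\<And>x y. x \<in> {0<..<T} \<Longrightarrow> y \<in> {0<..<T} \<Longrightarrow> \<bar>u x - u y\<bar> \<le> B * \<bar>x - y\<bar>" and \<sigma>: "\<sigma> < 1" and T: "0 < T"
  shows "gag 0 T \<sigma> w < \<infinity>"
proof -
  define p where "p = 1 - 2 * \<sigma>"
  have p: "-1 < p" using \<sigma> by (simp add: p_def)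
  define J where "J = (\<integral>\<^sup>+z. ennreal (\<bar>z\<bar> powr p) * indicator {-T..T} z \<partial>lborel)"
  have J: "J < \<infinity>" unfolding J_def by (rule nn_integral_abs_powr_finite[OF p]) (use T in simp)
  have m: "(\<lambda>z. ennreal (\<bar>z\<bar> powr p) * indicator {-T..T} z) \<in> borel_measurable borel" by measurable
  have "gag 0 T \<sigma> w \<le> (\<integral>\<^sup>+z. ennreal (B\<^sup>2 * \<bar>fst z - snd z\<bar> powr p) * indicator ({0..T} \<times> {0..T}) z \<partial>lborel)"
    unfolding gag_def
  proof (rule nn_integral_mono_AE)
    show "AE z in lborel. ennreal (gagliardo_quot \<sigma> w z) * indicator ({0<..<T} \<times> {0<..<T}) z
      \<le> ennreal (B\<^sup>2 * \<bar>fst z - snd z\<bar> powr p) * indicator ({0..T} \<times> {0..T}) z"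
      using AE_prod_eq[OF ae]
    proof eventually_elim
      case (elim z)
      obtain x y where z: "z = (x, y)" by (cases z)
      show ?case
      proof (cases "x \<in> {0<..<T} \<and> y \<in> {0<..<T}")
        case True
        then have wu: "w x = u x" "w y = u y" using elim by (auto simp: z)
        have "gagliardo_quot \<sigma> w (x, y) \<le> B\<^sup>2 * \<bar>x - y\<bar> powr p"
        proof (cases "x = y")
          case False
          have "(u x - u y)\<^sup>2 \<le> (B * \<bar>x - y\<bar>)\<^sup>2"
            using L[of x y] True by (metis abs_ge_zero power2_abs power_mono)
          also have "\<dots> = B\<^sup>2 * \<bar>x - y\<bar> powr 2" using False by (simp add: power_mult_distrib powr_numeral)
          finally have "(u x - u y)\<^sup>2 / \<bar>x - y\<bar> powr (1 + 2 * \<sigma>) \<le> B\<^sup>2 * \<bar>x - y\<bar> powr 2 / \<bar>x - y\<bar> powr (1 + 2 * \<sigma>)"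
            by (intro divide_right_mono) auto
          also have "\<dots> = B\<^sup>2 * \<bar>x - y\<bar> powr p"
            unfolding p_def using powr_diff[of "\<bar>x - y\<bar>" 2 "1 + 2 * \<sigma>"] by (simp add: algebra_simps)
          finally show ?thesis by (simp add: gagliardo_quot_def wu)
        qed (simp add: gagliardo_quot_def)
        then show ?thesis using True by (simp add: z ennreal_leI)
      qed (simp add: z)
    qed
  qed
  also have "\<dots> = (\<integral>\<^sup>+x. (\<integral>\<^sup>+y. ennreal (B\<^sup>2 * \<bar>x - y\<bar> powr p) * indicator ({0..T} \<times> {0..T}) (x, y) \<partial>lborel) \<partial>lborel)"
  proof -
    have "(\<lambda>z::real \<times> real. ennreal (B\<^sup>2 * \<bar>fst z - snd z\<bar> powr p) * indicator ({0..T} \<times> {0..T}) z) \<in> borel_measurable borel"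
      unfolding borel_prod[symmetric] by measurable
    from nn_integral_lborel_prod[OF this] show ?thesis by simp
  qed
  also have "\<dots> \<le> (\<integral>\<^sup>+x. ennreal (B\<^sup>2) * J * indicator {0..T} x \<partial>lborel)"
  proof (rule nn_integral_mono)
    fix x :: real
    show "(\<integral>\<^sup>+y. ennreal (B\<^sup>2 * \<bar>x - y\<bar> powr p) * indicator ({0..T} \<times> {0..T}) (x, y) \<partial>lborel)
      \<le> ennreal (B\<^sup>2) * J * indicator {0..T} x"
    proof (cases "x \<in> {0..T}")
      case True
      have "(\<integral>\<^sup>+y. ennreal (B\<^sup>2 * \<bar>x - y\<bar> powr p) * indicator ({0..T} \<times> {0..T}) (x, y) \<partial>lborel)
        \<le> (\<integral>\<^sup>+y. ennreal (B\<^sup>2) * (ennreal (\<bar>- x + 1 * y\<bar> powr p) * indicator {-T..T} (- x + 1 * y)) \<partial>lborel)"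
        using True by (intro nn_integral_mono)
          (auto split: split_indicator simp: ennreal_mult' abs_minus_commute[of x] mult.assoc)
      also have "\<dots> = ennreal (B\<^sup>2) * (\<integral>\<^sup>+y. ennreal (\<bar>- x + 1 * y\<bar> powr p) * indicator {-T..T} (- x + 1 * y) \<partial>lborel)"
        by (rule nn_integral_cmult) measurable
      also have "(\<integral>\<^sup>+y. ennreal (\<bar>- x + 1 * y\<bar> powr p) * indicator {-T..T} (- x + 1 * y) \<partial>lborel) = J"
        using nn_integral_real_affine[OF m, of 1 "-x"] by (simp add: J_def)
      finally show ?thesis using True by simp
    next
      case False
      then have "indicator ({0..T} \<times> {0..T}) (x, y) = (0::ennreal)" for y by auto
      then show ?thesis by simp
    qed
  qed
  also have "\<dots> = ennreal (B\<^sup>2) * J * ennreal T"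
    using T by (simp add: nn_integral_cmult_indicator)
  also have "\<dots> < \<infinity>" using J by (auto simp: ennreal_mult_less_top)
  finally show ?thesis .
qed

text \<open>On the strip increments are at most H \<delta>^\<sigma>, and its area is at most 2
  \<delta> (b - a). Grouping sqrt (b - a) with H gives the same form as the Gagliardo bound.\<close>

lemma osc_le_hoelder:
  assumes w [measurable]: "w \<in> borel_measurable borel" and ae: "AE x in lebesgue_on {0<..<T}. v x = w x"
    and fin: "hoelder_eseminorm 0 T \<sigma> v < \<infinity>" and H: "enn2real (hoelder_eseminorm 0 T \<sigma> v) \<le> H"
    and \<sigma>: "0 < \<sigma>" and ab: "0 \<le> a" "a < b" "b \<le> T" and d: "0 < \<delta>"
  shows "osc a b \<delta> w \<le> ennreal (2 * \<delta> powr (1 + 2 * \<sigma>) * (sqrt (b - a) * H)\<^sup>2)"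
proof -
  let ?S = "{0<..<T} \<times> {0<..<T}"
  have Sl: "?S \<in> sets lebesgue" by (simp add: borel_open open_Times)
  have H0: "0 \<le> H" using H enn2real_nonneg order_trans by blast
  have "AE z in lebesgue_on ?S. (case z of (x, y) \<Rightarrow> ennreal (\<bar>v x - v y\<bar> / \<bar>x - y\<bar> powr \<sigma>)) \<le> hoelder_eseminorm 0 T \<sigma> v"
    unfolding hoelder_eseminorm_def by (rule esssup_AE)
  then have "AE z in lebesgue. z \<in> ?S \<longrightarrow> (case z of (x, y) \<Rightarrow> ennreal (\<bar>v x - v y\<bar> / \<bar>x - y\<bar> powr \<sigma>)) \<le> hoelder_eseminorm 0 T \<sigma> v"
    using Sl by (subst (asm) AE_restrict_space_iff) auto
  moreover have "AE z in lebesgue. z \<in> ?S \<longrightarrow> v (fst z) = w (fst z) \<and> v (snd z) = w (snd z)"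
    using AE_prod_eq[OF ae] by (rule AE_completion)
  ultimately have "AE z in lebesgue. z \<in> ?S \<longrightarrow> \<bar>w (fst z) - w (snd z)\<bar> \<le> H * \<bar>fst z - snd z\<bar> powr \<sigma>"
  proof eventually_elim
    case (elim z)
    obtain x y where z: "z = (x, y)" by (cases z)
    show ?case
    proof
      assume S: "z \<in> ?S"
      have "ennreal (\<bar>w x - w y\<bar> / \<bar>x - y\<bar> powr \<sigma>) \<le> ennreal H"
      proof -
        have "ennreal (\<bar>w x - w y\<bar> / \<bar>x - y\<bar> powr \<sigma>) \<le> hoelder_eseminorm 0 T \<sigma> v" using elim S by (simp add: z)
        also have "\<dots> = ennreal (enn2real (hoelder_eseminorm 0 T \<sigma> v))" using fin by (simp add: less_top)
        also have "\<dots> \<le> ennreal H" using H by (rule ennreal_leI)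
        finally show ?thesis .
      qed
      then have "\<bar>w x - w y\<bar> / \<bar>x - y\<bar> powr \<sigma> \<le> H" using H0 by (simp add: ennreal_le_iff)
      then show "\<bar>w (fst z) - w (snd z)\<bar> \<le> H * \<bar>fst z - snd z\<bar> powr \<sigma>"
        by (cases "x = y") (auto simp: z pos_divide_le_eq)
    qed
  qed
  then have ae2: "AE z in lborel :: (real \<times> real) measure. z \<in> ?S \<longrightarrow> \<bar>w (fst z) - w (snd z)\<bar> \<le> H * \<bar>fst z - snd z\<bar> powr \<sigma>"
    by (simp add: AE_completion_iff)
  have "osc a b \<delta> w \<le> (\<integral>\<^sup>+z. ennreal (H\<^sup>2 * \<delta> powr (2 * \<sigma>)) *
     indicator {z. fst z \<in> {a..b} \<and> \<bar>fst z - snd z\<bar> \<le> \<delta>} z \<partial>lborel)"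
    unfolding osc_eq_prod[OF w]
  proof (rule nn_integral_mono_AE)
    show "AE z in lborel. ennreal ((w (fst z) - w (snd z))\<^sup>2) *
       indicator {z. fst z \<in> {a<..<b} \<and> snd z \<in> {a<..<b} \<and> \<bar>fst z - snd z\<bar> \<le> \<delta>} z
      \<le> ennreal (H\<^sup>2 * \<delta> powr (2 * \<sigma>)) * indicator {z. fst z \<in> {a..b} \<and> \<bar>fst z - snd z\<bar> \<le> \<delta>} z"
      using ae2
    proof eventually_elim
      case (elim z)
      show ?case
      proof (cases "fst z \<in> {a<..<b} \<and> snd z \<in> {a<..<b} \<and> \<bar>fst z - snd z\<bar> \<le> \<delta>")
        case True
        then have "\<bar>w (fst z) - w (snd z)\<bar> \<le> H * \<bar>fst z - snd z\<bar> powr \<sigma>" using elim ab by (cases z) auto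
        also have "\<dots> \<le> H * \<delta> powr \<sigma>" using True H0 \<sigma> by (intro mult_left_mono powr_mono2) auto
        finally have "(w (fst z) - w (snd z))\<^sup>2 \<le> (H * \<delta> powr \<sigma>)\<^sup>2"
          by (metis abs_ge_zero power2_abs power_mono)
        also have "\<dots> = H\<^sup>2 * \<delta> powr (2 * \<sigma>)"
          by (simp add: power_mult_distrib power2_eq_square powr_add[symmetric])
        finally show ?thesis using True by (simp add: ennreal_leI)
      qed simp
    qed
  qed
  also have "\<dots> = (\<integral>\<^sup>+x. (\<integral>\<^sup>+y. ennreal (H\<^sup>2 * \<delta> powr (2 * \<sigma>)) *
     indicator {z. fst z \<in> {a..b} \<and> \<bar>fst z - snd z\<bar> \<le> \<delta>} (x, y) \<partial>lborel) \<partial>lborel)"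
  proof -
    have "(\<lambda>z::real \<times> real. ennreal (H\<^sup>2 * \<delta> powr (2 * \<sigma>)) * indicator {z. fst z \<in> {a..b} \<and> \<bar>fst z - snd z\<bar> \<le> \<delta>} z) \<in> borel_measurable borel"
      unfolding borel_prod[symmetric] by measurable
    from nn_integral_lborel_prod[OF this] show ?thesis .
  qed
  also have "\<dots> = (\<integral>\<^sup>+x. ennreal (H\<^sup>2 * \<delta> powr (2 * \<sigma>) * (2 * \<delta>)) * indicator {a..b} x \<partial>lborel)"
  proof (rule nn_integral_cong)
    fix x :: real
    have "(\<integral>\<^sup>+y. ennreal (H\<^sup>2 * \<delta> powr (2 * \<sigma>)) * indicator {z. fst z \<in> {a..b} \<and> \<bar>fst z - snd z\<bar> \<le> \<delta>} (x, y) \<partial>lborel)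
      = (\<integral>\<^sup>+y. ennreal (H\<^sup>2 * \<delta> powr (2 * \<sigma>)) * indicator {a..b} x * indicator {x - \<delta>..x + \<delta>} y \<partial>lborel)"
      by (intro nn_integral_cong) (auto split: split_indicator)
    also have "\<dots> = ennreal (H\<^sup>2 * \<delta> powr (2 * \<sigma>)) * indicator {a..b} x * ennreal (2 * \<delta>)"
      using d by (simp add: nn_integral_cmult_indicator)
    also have "\<dots> = ennreal (H\<^sup>2 * \<delta> powr (2 * \<sigma>) * (2 * \<delta>)) * indicator {a..b} x"
      using d by (simp add: ennreal_mult' split: split_indicator)
    finally show "(\<integral>\<^sup>+y. ennreal (H\<^sup>2 * \<delta> powr (2 * \<sigma>)) * indicator {z. fst z \<in> {a..b} \<and> \<bar>fst z - snd z\<bar> \<le> \<delta>} (x, y) \<partial>lborel)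
      = ennreal (H\<^sup>2 * \<delta> powr (2 * \<sigma>) * (2 * \<delta>)) * indicator {a..b} x" .
  qed
  also have "\<dots> = ennreal (H\<^sup>2 * \<delta> powr (2 * \<sigma>) * (2 * \<delta>)) * ennreal (b - a)"
    using ab by (simp add: nn_integral_cmult_indicator)
  also have "\<dots> = ennreal (2 * \<delta> powr (1 + 2 * \<sigma>) * (sqrt (b - a) * H)\<^sup>2)"
    using ab d by (subst ennreal_mult''[symmetric]) (auto simp: power_mult_distrib powr_add ac_simps)
  finally show ?thesis .
qed

section \<open>Error of \<open>\<Pi>\<close> in terms of Sobolev norms\<close>

lemma AE_Ioo_subinterval:
  assumes "AE x in lebesgue_on {a<..<b::real}. P x" "a \<le> c" "d \<le> b"
  shows "AE x in lebesgue_on {c<..<d}. P x"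
proof -
  have "AE x in lebesgue. a < x \<and> x < b \<longrightarrow> P x" using assms(1) by (simp only: AE_lebesgue_on_Ioo_iff)
  then have "AE x in lebesgue. c < x \<and> x < d \<longrightarrow> P x" by eventually_elim (use assms(2,3) in auto)
  then show ?thesis by (simp only: AE_lebesgue_on_Ioo_iff)
qed

lemma ac_cong_AE:
  assumes u: "ac a b u g" and ae: "AE x in lebesgue_on {a<..<b}. g x = g' x"
  shows "ac a b u g'"
  unfolding ac_def
proof (intro conjI ballI)
  have gL: "in_L2 a b g" by (rule ac_in_L2[OF u])
  show g'L: "in_L2 a b g'" by (rule in_L2_AE_cong[OF gL ae])
  fix x assume x: "x \<in> {a..b}"
  have i: "integrable (lebesgue_on {a<..<x}) g" "integrable (lebesgue_on {a<..<x}) g'"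
    using in_L2_integrable[OF in_L2_subinterval[OF gL]] in_L2_integrable[OF in_L2_subinterval[OF g'L]] x by auto
  have "integral {a..x} g = integral {a..x} g'"
    unfolding integral_lebesgue_on_Ioo[OF i(1), symmetric] integral_lebesgue_on_Ioo[OF i(2), symmetric]
    using i AE_Ioo_subinterval[OF ae, of a x] x by (intro integral_cong_AE) auto
  then show "u x = u a + integral {a..x} g'" using ac_eq[OF u, of x] x by simp
qed

lemma cg_interp_cong_AE:
  "a < b \<Longrightarrow> in_L2 a b g \<Longrightarrow> AE x in lebesgue_on {a<..<b}. g x = g' x \<Longrightarrow>
    cg_interp r a b u g = cg_interp r a b u g'"
  by (simp only: cg_interp_def L2_proj_cong_AE)

text \<open>Overwriting the top derivative by a Borel function keeps the chain. For k = 1 the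
  overwritten function is the one that enters the interpolant, whose projection does not see the
  change.\<close>

lemma chain_cg_error_osc_AE:
  assumes ab: "a < b" and U: "chain a b k U"
    and w: "w \<in> borel_measurable borel" "AE x in lebesgue_on {a<..<b}. U k x = w x"
    and k: "1 \<le> k" "k \<le> r" and e: "osc a b ((b - a) / real r) w \<le> ennreal e" "0 \<le> e"
  shows "nrm a b (\<lambda>x. U 0 x - poly (cg_interp r a b (U 0) (U 1)) x)
    \<le> 6 * fact (Suc k) * ((b - a) / real r) ^ k * sqrt (e / ((b - a) / real r))"
proof -
  define U' where "U' = U(k := w)"
  have U0: "U' 0 = U 0" using k by (simp add: U'_def)
  have "chain a b k U'"
    unfolding chain_def
  proof (intro conjI allI impI)
    fix j assume j: "j < k"
    show "ac a b (U' j) (U' (Suc j))"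
      using chain_acD[OF U j] ac_cong_AE[of a b "U j" "U k" w] w(2) j
      by (cases "Suc j = k") (auto simp: U'_def)
  next
    show "in_L2 a b (U' k)" using in_L2_AE_cong[OF chain_in_L2[OF U order_refl] w(2)] by (simp add: U'_def)
  qed
  moreover have "cg_interp r a b (U' 0) (U' 1) = cg_interp r a b (U 0) (U 1)"
  proof (cases "k = 1")
    case True
    then show ?thesis
      using cg_interp_cong_AE[OF ab chain_in_L2[OF U order_refl] w(2), of r "U 0"] by (simp add: U0) (simp add: U'_def)
  qed (simp add: U0, simp add: U'_def)
  ultimately show ?thesis
    using chain_cg_error_osc[OF ab, of k U' r e] w(1) k e by (simp add: U0) (simp add: U'_def)
qed

text \<open>12 bounds the 6 sqrt 2 of the fractional case. The factor s^s pays for saturation: if r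
  + 1 <= s, only r^(-r-1) is available where r^(-s) is asked for, and the quotient r^(s-r-1) is at
  most s^s.\<close>

definition err_const :: "real \<Rightarrow> real" where
  "err_const s = 12 * fact (Suc (nat \<lfloor>s\<rfloor>)) * s powr s"

lemma nat_floor_bounds:
  fixes s :: real
  assumes "1 \<le> s" shows "1 \<le> nat \<lfloor>s\<rfloor>" "real (nat \<lfloor>s\<rfloor>) \<le> s" "s < real (nat \<lfloor>s\<rfloor>) + 1"
    "s = real (nat \<lfloor>s\<rfloor>) + frac s"
  using assms by (auto simp: frac_def) linarith+

lemma powr_self_ge_1: "1 \<le> s \<Longrightarrow> 1 \<le> s powr s" for s :: real
  by (rule ge_one_powr_ge_zero) auto

text \<open>If r is below the integer part k of s, the first r + 1 derivatives give the saturated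
  order. Otherwise the full order s is reached, by k derivatives for integral s and by oscillation
  of the k-th derivative for fractional s. The factor 2 in the oscillation hypothesis lets both
  Gagliardo and Hoelder bounds satisfy it.\<close>

lemma local_error:
  fixes s :: real
  assumes s: "1 \<le> s" and r: "1 \<le> r" and ab: "a < b" and tau: "b - a \<le> \<tau>"
    and U: "chain a b (nat \<lfloor>s\<rfloor>) U" and A: "0 \<le> A"
    and nr: "\<And>j. j \<le> nat \<lfloor>s\<rfloor> \<Longrightarrow> nrm a b (U j) \<le> A"
    and os: "s \<notin> \<int> \<Longrightarrow> \<exists>w\<in>borel_measurable borel. (AE x in lebesgue_on {a<..<b}. U (nat \<lfloor>s\<rfloor>) x = w x) \<and>
      (\<forall>\<delta>>0. osc a b \<delta> w \<le> ennreal (2 * \<delta> powr (1 + 2 * frac s) * A\<^sup>2))"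
  shows "nrm a b (\<lambda>x. U 0 x - poly (cg_interp r a b (U 0) (U 1)) x)
    \<le> err_const s * (\<tau> powr min (real r + 1) s / real r powr s) * A"
proof -
  define k where "k = nat \<lfloor>s\<rfloor>"
  define h where "h = b - a"
  define \<delta> where "\<delta> = h / real r"
  have k: "1 \<le> k" "real k \<le> s" "s < real k + 1" "s = real k + frac s"
    using nat_floor_bounds[OF s] by (auto simp: k_def)
  have h: "0 < h" "h \<le> \<tau>" "0 < \<delta>" using ab tau r by (auto simp: h_def \<delta>_def)
  have ss: "1 \<le> s powr s" by (rule powr_self_ge_1[OF s])
  have rr: "0 < real r powr p" for p using r by simp
  let ?e = "nrm a b (\<lambda>x. U 0 x - poly (cg_interp r a b (U 0) (U 1)) x)"
  show ?thesis
  proof (cases "Suc r \<le> k")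
    case True
    have m: "min (real r + 1) s = real (Suc r)" using True k by simp
    have "?e \<le> fact (Suc r) * \<delta> ^ Suc r * nrm a b (U (Suc r))"
      using chain_cg_error[OF ab chain_le[OF U[folded k_def] True] _ _ r] by (simp add: \<delta>_def h_def del: fact_Suc)
    also have "\<dots> \<le> fact (Suc k) * (\<tau> powr real (Suc r) * (s powr s / real r powr s)) * A"
    proof (intro mult_mono)
      show "(fact (Suc r) :: real) \<le> fact (Suc k)" using True by (intro fact_mono) auto
      have "\<delta> ^ Suc r = h powr real (Suc r) / real r powr real (Suc r)"
      proof -
        have "\<delta> ^ Suc r = \<delta> powr real (Suc r)" using h(3) by (simp only: powr_realpow)
        also have "\<dots> = h powr real (Suc r) / real r powr real (Suc r)"
          unfolding \<delta>_def by (rule powr_divide)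
        finally show ?thesis .
      qed
      also have "\<dots> \<le> \<tau> powr real (Suc r) * (s powr s / real r powr s)"
      proof -
        have "real r powr (s - real (Suc r)) \<le> real r powr s" using r by (intro powr_mono) auto
        also have "\<dots> \<le> s powr s" using True k s by (intro powr_mono2) auto
        finally have "real r powr s / real r powr real (Suc r) \<le> s powr s" by (simp add: powr_diff)
        then have "1 / real r powr real (Suc r) \<le> s powr s / real r powr s"
          using rr[of s] by (simp add: field_simps)
        moreover have "h powr real (Suc r) \<le> \<tau> powr real (Suc r)" using h by (intro powr_mono2) auto
        ultimately have "h powr real (Suc r) * (1 / real r powr real (Suc r)) \<le> \<tau> powr real (Suc r) * (s powr s / real r powr s)"
          by (intro mult_mono) auto
        then show ?thesis by simp
      qed
      finally show "\<delta> ^ Suc r \<le> \<tau> powr real (Suc r) * (s powr s / real r powr s)" .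
      show "nrm a b (U (Suc r)) \<le> A" using nr True by (simp add: k_def)
    qed (use A h in auto)
    also have "\<dots> = (fact (Suc k) * s powr s) * (\<tau> powr real (Suc r) / real r powr s) * A" by simp
    also have "\<dots> \<le> err_const s * (\<tau> powr real (Suc r) / real r powr s) * A"
      using A by (intro mult_right_mono) (auto simp: err_const_def k_def[symmetric] simp del: fact_Suc)
    finally show ?thesis by (simp add: m)
  next
    case False
    then have kr: "k \<le> r" by simp
    have m: "min (real r + 1) s = s" using kr k by simp
    have ds: "\<delta> powr s \<le> \<tau> powr s / real r powr s"
    proof -
      have "\<delta> powr s = h powr s / real r powr s" using h r by (simp add: \<delta>_def powr_divide)
      also have "\<dots> \<le> \<tau> powr s / real r powr s" using h s by (intro divide_right_mono powr_mono2) auto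
      finally show ?thesis .
    qed
    have "?e \<le> 12 * fact (Suc k) * \<delta> powr s * A"
    proof (cases "s \<in> \<int>")
      case True
      then have "frac s = 0" by (simp add: frac_eq_0_iff)
      then have sk: "s = real k" using k(4) by linarith
      have "?e \<le> fact k * \<delta> ^ k * nrm a b (U k)"
        using chain_cg_error[OF ab U[folded k_def] k(1) _ r] kr by (simp add: \<delta>_def h_def)
      also have "\<dots> = fact k * \<delta> powr s * nrm a b (U k)" using h by (simp add: sk powr_realpow)
      also have "\<dots> \<le> 12 * fact (Suc k) * \<delta> powr s * A"
      proof (intro mult_mono)
        have "(fact k :: real) \<le> fact (Suc k)" by (rule fact_mono) simp
        then show "(fact k :: real) \<le> 12 * fact (Suc k)" using fact_ge_zero[of "Suc k", where 'a = real] by linarith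
        show "nrm a b (U k) \<le> A" using nr by (simp add: k_def)
      qed auto
      finally show ?thesis .
    next
      case False
      then obtain w where w: "w \<in> borel_measurable borel" "AE x in lebesgue_on {a<..<b}. U k x = w x"
        "osc a b \<delta> w \<le> ennreal (2 * \<delta> powr (1 + 2 * frac s) * A\<^sup>2)"
        using os h(3) by (auto simp: k_def)
      have "?e \<le> 6 * fact (Suc k) * \<delta> ^ k * sqrt (2 * \<delta> powr (1 + 2 * frac s) * A\<^sup>2 / \<delta>)"
        using chain_cg_error_osc_AE[OF ab U[folded k_def] w(1,2) k(1) kr w(3)[unfolded \<delta>_def h_def]] by (simp add: \<delta>_def h_def del: fact_Suc)
      \<comment> \<open>The strip width contributes one power of \<delta>; once it is divided out,
        the square root is of order \<delta>^(frac s), completing \<delta>^k to \<delta>^s.\<close>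
      also have "2 * \<delta> powr (1 + 2 * frac s) * A\<^sup>2 / \<delta> = 2 * (\<delta> powr frac s * A)\<^sup>2"
        using h by (simp add: powr_add power_mult_distrib power2_eq_square powr_add[symmetric])
      also have "sqrt (2 * (\<delta> powr frac s * A)\<^sup>2) = sqrt 2 * (\<delta> powr frac s * A)"
        using A by (simp add: real_sqrt_mult)
      also have "6 * fact (Suc k) * \<delta> ^ k * (sqrt 2 * (\<delta> powr frac s * A))
          \<le> 6 * fact (Suc k) * \<delta> ^ k * (2 * (\<delta> powr frac s * A))"
        using h A real_sqrt_le_mono[of 2 4] by (intro mult_left_mono mult_right_mono) auto
      also have "\<dots> = 12 * fact (Suc k) * (\<delta> powr real k * \<delta> powr frac s) * A"
        using h by (simp add: powr_realpow del: fact_Suc)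
      also have "\<delta> powr real k * \<delta> powr frac s = \<delta> powr s" by (metis k(4) powr_add)
      finally show ?thesis .
    qed
    also have "\<dots> \<le> err_const s * (\<tau> powr s / real r powr s) * A"
    proof (intro mult_mono ds)
      show "12 * fact (Suc k) \<le> err_const s"
        using ss mult_left_mono[OF ss, of "12 * fact (Suc k)"] by (simp add: err_const_def k_def del: fact_Suc)
      show ec: "0 \<le> err_const s" by (simp add: err_const_def)
      then show "0 \<le> err_const s * (\<tau> powr s / real r powr s)" by simp
    qed (use A in auto)
    finally show ?thesis by (simp add: m)
  qed
qed

text \<open>One number per interval dominating all norms that the local error estimate consumes, so
  that squares can be summed over the partition.\<close>

definition local_bounds :: "real \<Rightarrow> nat \<Rightarrow> (nat \<Rightarrow> real) \<Rightarrow> (nat \<Rightarrow> real \<Rightarrow> real) \<Rightarrow> (nat \<Rightarrow> real) \<Rightarrow> bool" where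
  "local_bounds s N t U A \<longleftrightarrow> (\<forall>n<N. 0 \<le> A n \<and> (\<forall>j\<le>nat \<lfloor>s\<rfloor>. nrm (t n) (t (Suc n)) (U j) \<le> A n) \<and>
      (s \<notin> \<int> \<longrightarrow> (\<exists>w\<in>borel_measurable borel. (AE x in lebesgue_on {t n<..<t (Suc n)}. U (nat \<lfloor>s\<rfloor>) x = w x) \<and>
      (\<forall>\<delta>>0. osc (t n) (t (Suc n)) \<delta> w \<le> ennreal (2 * \<delta> powr (1 + 2 * frac s) * (A n)\<^sup>2)))))"

lemma local_error_bounds:
  fixes s :: real
  assumes "1 \<le> s" "1 \<le> r" "t n < t (Suc n)" "t (Suc n) - t n \<le> \<tau>" "chain (t n) (t (Suc n)) (nat \<lfloor>s\<rfloor>) U"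
    and A: "local_bounds s N t U A" and n: "n < N"
  shows "nrm (t n) (t (Suc n)) (\<lambda>x. U 0 x - poly (cg_interp r (t n) (t (Suc n)) (U 0) (U 1)) x)
    \<le> err_const s * (\<tau> powr min (real r + 1) s / real r powr s) * A n"
  by (rule local_error[OF assms(1-5)]) (use A n in \<open>auto simp: local_bounds_def\<close>)

text \<open>\<open>A n\<close> is the local H^s norm on the n-th interval. Integrals are additive
  and the Gagliardo part is superadditive over the partition, so the squares sum to at most the
  square of the global norm.\<close>

lemma Hs_local_bounds:
  fixes s :: real and t :: "nat \<Rightarrow> real"
  assumes s: "1 \<le> s" and t0: "t 0 = 0" "t N = T" and T: "0 < T" and tm: "\<And>n. n < N \<Longrightarrow> t n < t (Suc n)"
    and U: "chain 0 T (nat \<lfloor>s\<rfloor>) U" and v: "AE x in lebesgue_on {0<..<T}. U 0 x = v x"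
    and fin: "s \<notin> \<int> \<Longrightarrow> \<exists>w\<in>borel_measurable borel. (AE x in lebesgue_on {0<..<T}. U (nat \<lfloor>s\<rfloor>) x = w x) \<and> gag 0 T (frac s) w < \<infinity>"
  shows "\<exists>A. local_bounds s N t U A \<and> (\<Sum>n<N. (A n)\<^sup>2) \<le> (Hs_norm 0 T s v)\<^sup>2"
proof -
  define k where "k = nat \<lfloor>s\<rfloor>"
  note U = U[folded k_def]
  have mono: "t m \<le> t n" if "m \<le> n" "n \<le> N" for m n
    by (rule partition_mono[OF _ that]) (simp add: tm less_imp_le)
  have sub: "0 \<le> t n" "t (Suc n) \<le> T" if "n < N" for n
    using mono[of 0 n] mono[of "Suc n" N] that t0 by auto
  obtain w where w: "s \<notin> \<int> \<Longrightarrow> w \<in> borel_measurable borel" "s \<notin> \<int> \<Longrightarrow> AE x in lebesgue_on {0<..<T}. U k x = w x"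
    "s \<notin> \<int> \<Longrightarrow> gag 0 T (frac s) w < \<infinity>"
    using fin unfolding k_def by blast
  define \<gamma> where "\<gamma> n = (if s \<in> \<int> then 0 else enn2real (gag (t n) (t (Suc n)) (frac s) w))" for n
  define A where "A n = sqrt ((\<Sum>j\<le>k. (nrm (t n) (t (Suc n)) (U j))\<^sup>2) + \<gamma> n)" for n
  have g0: "0 \<le> \<gamma> n" for n by (simp add: \<gamma>_def)
  have A2: "(A n)\<^sup>2 = (\<Sum>j\<le>k. (nrm (t n) (t (Suc n)) (U j))\<^sup>2) + \<gamma> n" for n
    unfolding A_def using g0[of n] by (simp add: sum_nonneg add_nonneg_nonneg)
  have wd: "AE x in lebesgue_on {0<..<T}. U j x = weak_deriv 0 T j v x" if "j \<le> k" for j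
    using weak_deriv_eqI[OF chain_weak_deriv[OF less_imp_le[OF T] U v that]] by (auto elim: eventually_mono)
  have part: "(\<Sum>n<N. (nrm (t n) (t (Suc n)) (U j))\<^sup>2) = (\<integral>x. (weak_deriv 0 T j v x)\<^sup>2 \<partial>lebesgue_on {0<..<T})" if "j \<le> k" for j
  proof -
    have L: "in_L2 0 T (U j)" by (rule chain_in_L2[OF U that])
    have "(\<Sum>n<N. (nrm (t n) (t (Suc n)) (U j))\<^sup>2) = (\<integral>x. (U j x)\<^sup>2 \<partial>lebesgue_on {t 0<..<t N})"
      unfolding nrm_sq_integral using L tm
      by (intro integral_Ioo_partition[symmetric]) (auto simp: in_L2_def t0 less_imp_le)
    also have "\<dots> = (\<integral>x. (weak_deriv 0 T j v x)\<^sup>2 \<partial>lebesgue_on {0<..<T})"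
      unfolding t0
    proof (rule integral_cong_AE)
      show "AE x in lebesgue_on {0<..<T}. (U j x)\<^sup>2 = (weak_deriv 0 T j v x)\<^sup>2"
        using wd[OF that] by eventually_elim simp
    qed (use in_L2_measurable[OF L] in_L2_measurable[OF in_L2_AE_cong[OF L wd[OF that]]] in auto)
    finally show ?thesis .
  qed
  have gsum: "(\<Sum>n<N. \<gamma> n) \<le> (if s \<in> \<int> then 0
      else \<integral>z. gagliardo_quot (frac s) (weak_deriv 0 T k v) z \<partial>lebesgue_on ({0<..<T} \<times> {0<..<T}))"
    and gfin: "s \<notin> \<int> \<Longrightarrow> n < N \<Longrightarrow> gag (t n) (t (Suc n)) (frac s) w = ennreal (\<gamma> n)" for n
  proof -
    have *: "(\<forall>n<N. gag (t n) (t (Suc n)) (frac s) w = ennreal (\<gamma> n)) \<and> (\<Sum>n<N. \<gamma> n) \<le>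
       (\<integral>z. gagliardo_quot (frac s) (weak_deriv 0 T k v) z \<partial>lebesgue_on ({0<..<T} \<times> {0<..<T}))" if ni: "s \<notin> \<int>"
    proof -
      have p: "(\<Sum>n<N. gag (t n) (t (Suc n)) (frac s) w) \<le> gag 0 T (frac s) w"
        using gag_partition[OF w(1)[OF ni], of N t "frac s"] tm t0 by (simp add: less_imp_le)
      have fn: "gag (t n) (t (Suc n)) (frac s) w = ennreal (\<gamma> n)" if n: "n < N" for n
      proof -
        have "gag (t n) (t (Suc n)) (frac s) w \<le> (\<Sum>n<N. gag (t n) (t (Suc n)) (frac s) w)"
          using n by (intro member_le_sum) auto
        then have "gag (t n) (t (Suc n)) (frac s) w < \<infinity>" using p w(3)[OF ni] by (meson le_less_trans)
        then show ?thesis using ni by (simp add: \<gamma>_def less_top)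
      qed
      have ae: "AE x in lebesgue_on {0<..<T}. weak_deriv 0 T k v x = w x"
        using wd[OF order_refl] w(2)[OF ni] by eventually_elim simp
      have "ennreal (\<Sum>n<N. \<gamma> n) = (\<Sum>n<N. gag (t n) (t (Suc n)) (frac s) w)"
        using fn g0 by (simp add: sum_ennreal)
      also have "\<dots> \<le> ennreal (\<integral>z. gagliardo_quot (frac s) (weak_deriv 0 T k v) z \<partial>lebesgue_on ({0<..<T} \<times> {0<..<T}))"
        using p gag_eq_integral[OF w(1)[OF ni] ae w(3)[OF ni]] by simp
      finally have "(\<Sum>n<N. \<gamma> n) \<le> (\<integral>z. gagliardo_quot (frac s) (weak_deriv 0 T k v) z \<partial>lebesgue_on ({0<..<T} \<times> {0<..<T}))"
        by (subst (asm) ennreal_le_iff) (auto intro!: integral_nonneg_AE simp: gagliardo_quot_nonneg)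
      then show ?thesis using fn by blast
    qed
    show "(\<Sum>n<N. \<gamma> n) \<le> (if s \<in> \<int> then 0
      else \<integral>z. gagliardo_quot (frac s) (weak_deriv 0 T k v) z \<partial>lebesgue_on ({0<..<T} \<times> {0<..<T}))"
      using * by (simp add: \<gamma>_def)
    show "s \<notin> \<int> \<Longrightarrow> n < N \<Longrightarrow> gag (t n) (t (Suc n)) (frac s) w = ennreal (\<gamma> n)" using * by blast
  qed
  have "(\<Sum>n<N. (A n)\<^sup>2) = (\<Sum>j\<le>k. \<Sum>n<N. (nrm (t n) (t (Suc n)) (U j))\<^sup>2) + (\<Sum>n<N. \<gamma> n)"
    unfolding A2 sum.distrib by (subst sum.swap) simp
  also have "\<dots> \<le> (\<Sum>j\<le>k. \<integral>x. (weak_deriv 0 T j v x)\<^sup>2 \<partial>lebesgue_on {0<..<T}) + (if s \<in> \<int> then 0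
      else \<integral>z. gagliardo_quot (frac s) (weak_deriv 0 T k v) z \<partial>lebesgue_on ({0<..<T} \<times> {0<..<T}))"
    using part gsum by (intro add_mono) auto
  also have "\<dots> = (Hs_norm 0 T s v)\<^sup>2"
    unfolding Hs_norm_def k_def
    by (subst real_sqrt_pow2) (auto intro!: add_nonneg_nonneg sum_nonneg integral_nonneg_AE simp: gagliardo_quot_nonneg)
  finally have sum: "(\<Sum>n<N. (A n)\<^sup>2) \<le> (Hs_norm 0 T s v)\<^sup>2" .
  have A0: "0 \<le> A n" for n by (simp add: A_def g0 sum_nonneg add_nonneg_nonneg)
  have An: "nrm (t n) (t (Suc n)) (U j) \<le> A n" if "j \<le> k" for j n
  proof (rule power2_le_imp_le[OF _ A0])
    have "(nrm (t n) (t (Suc n)) (U j))\<^sup>2 \<le> (\<Sum>j\<le>k. (nrm (t n) (t (Suc n)) (U j))\<^sup>2)"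
      using that by (intro member_le_sum) auto
    then show "(nrm (t n) (t (Suc n)) (U j))\<^sup>2 \<le> (A n)\<^sup>2" using A2[of n] g0[of n] by linarith
  qed
  have Ao: "osc (t n) (t (Suc n)) \<delta> w \<le> ennreal (2 * \<delta> powr (1 + 2 * frac s) * (A n)\<^sup>2)"
    if ni: "s \<notin> \<int>" and n: "n < N" and d: "0 < \<delta>" for n \<delta>
  proof -
    have "osc (t n) (t (Suc n)) \<delta> w \<le> ennreal (\<delta> powr (1 + 2 * frac s)) * gag (t n) (t (Suc n)) (frac s) w"
      by (rule osc_le_gag[OF w(1)[OF ni] d]) simp
    also have "\<dots> = ennreal (\<delta> powr (1 + 2 * frac s) * \<gamma> n)"
      unfolding gfin[OF ni n] by (rule ennreal_mult'[symmetric]) simp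
    also have "\<dots> \<le> ennreal (2 * \<delta> powr (1 + 2 * frac s) * (A n)\<^sup>2)"
    proof (rule ennreal_leI, rule mult_mono)
      show "\<gamma> n \<le> (A n)\<^sup>2" unfolding A2 by (simp add: sum_nonneg)
    qed (auto simp: g0)
    finally show ?thesis .
  qed
  show ?thesis
    unfolding local_bounds_def k_def[symmetric]
  proof (rule exI[of _ A], intro conjI allI impI sum A0 An)
    fix n assume n: "n < N" and ni: "s \<notin> \<int>"
    show "\<exists>w\<in>borel_measurable borel. (AE x in lebesgue_on {t n<..<t (Suc n)}. U k x = w x) \<and>
      (\<forall>\<delta>>0. osc (t n) (t (Suc n)) \<delta> w \<le> ennreal (2 * \<delta> powr (1 + 2 * frac s) * (A n)\<^sup>2))"
      using w(1)[OF ni] AE_Ioo_subinterval[OF w(2)[OF ni] sub[OF n]] Ao[OF ni n] by blast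
  qed
qed

section \<open>Local bounds from essential suprema and Hoelder seminorms\<close>

lemma nrm_le_bound:
  assumes f: "in_L2 a b f" and ab: "a \<le> b" and B: "AE x in lebesgue_on {a<..<b}. \<bar>f x\<bar> \<le> B" "0 \<le> B"
  shows "nrm a b f \<le> sqrt (b - a) * B"
proof (rule power2_le_imp_le)
  have "(nrm a b f)\<^sup>2 = (\<integral>x. (f x)\<^sup>2 \<partial>lebesgue_on {a<..<b})" by (rule nrm_sq_integral)
  also have "\<dots> \<le> (\<integral>x. B\<^sup>2 \<partial>lebesgue_on {a<..<b})"
  proof (rule integral_mono_AE)
    show "integrable (lebesgue_on {a<..<b}) (\<lambda>x. (f x)\<^sup>2)" using f by (simp add: in_L2_def)
    show "integrable (lebesgue_on {a<..<b}) (\<lambda>x. B\<^sup>2)" by (rule in_L2_integrable[OF in_L2_const])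
    show "AE x in lebesgue_on {a<..<b}. (f x)\<^sup>2 \<le> B\<^sup>2"
      using B(1) by eventually_elim (metis abs_ge_zero power2_abs power_mono)
  qed
  also have "\<dots> = (sqrt (b - a) * B)\<^sup>2" using ab by (simp add: measure_Ioo power_mult_distrib)
  finally show "(nrm a b f)\<^sup>2 \<le> (sqrt (b - a) * B)\<^sup>2" .
qed (use ab B in auto)

lemma Linf_enorm_bound:
  assumes "Linf_enorm a b u < \<infinity>"
  shows "AE x in lebesgue_on {a<..<b}. \<bar>u x\<bar> \<le> enn2real (Linf_enorm a b u)"
proof -
  have "AE x in lebesgue_on {a<..<b}. ennreal \<bar>u x\<bar> \<le> Linf_enorm a b u"
    unfolding Linf_enorm_def by (rule esssup_AE)
  then show ?thesis
  proof eventually_elim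
    case (elim x)
    then have "ennreal \<bar>u x\<bar> \<le> ennreal (enn2real (Linf_enorm a b u))" using assms by (simp add: less_top)
    then show ?case by (simp add: ennreal_le_iff)
  qed
qed

lemma nat_floor_add_1: "1 \<le> s \<Longrightarrow> nat \<lfloor>s + 1\<rfloor> = Suc (nat \<lfloor>s\<rfloor>)" for s :: real
  by (simp add: nat_add_distrib)

lemma frac_add_1: "frac (s + 1) = frac s" for s :: real
  by (simp add: frac_def)

lemma add_1_in_Ints_iff: "s + 1 \<in> \<int> \<longleftrightarrow> s \<in> \<int>" for s :: real
  by (metis Ints_1 Ints_add Ints_diff add_diff_cancel_right')

lemma Wsinf_bounds:
  fixes s :: real
  assumes s: "1 \<le> s" and y: "in_Wsinf 0 T (s + 1) y" and j: "j \<le> Suc (nat \<lfloor>s\<rfloor>)"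
  shows "AE x in lebesgue_on {0<..<T}. \<bar>weak_deriv 0 T j y x\<bar> \<le> Wsinf_norm 0 T (s + 1) y"
    and "0 \<le> Wsinf_norm 0 T (s + 1) y"
    and "s \<notin> \<int> \<Longrightarrow> enn2real (hoelder_eseminorm 0 T (frac s) (weak_deriv 0 T (Suc (nat \<lfloor>s\<rfloor>)) y)) \<le> Wsinf_norm 0 T (s + 1) y"
proof -
  note simps = nat_floor_add_1[OF s] frac_add_1 add_1_in_Ints_iff
  have sum0: "0 \<le> (\<Sum>j\<le>Suc (nat \<lfloor>s\<rfloor>). enn2real (Linf_enorm 0 T (weak_deriv 0 T j y)))" by (intro sum_nonneg) simp
  have "enn2real (Linf_enorm 0 T (weak_deriv 0 T j y)) \<le> (\<Sum>j\<le>Suc (nat \<lfloor>s\<rfloor>). enn2real (Linf_enorm 0 T (weak_deriv 0 T j y)))"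
    using j by (intro member_le_sum) auto
  also have "\<dots> \<le> Wsinf_norm 0 T (s + 1) y" by (simp only: Wsinf_norm_def simps) simp
  finally have 1: "enn2real (Linf_enorm 0 T (weak_deriv 0 T j y)) \<le> Wsinf_norm 0 T (s + 1) y" .
  have "Linf_enorm 0 T (weak_deriv 0 T j y) < \<infinity>" using y j unfolding in_Wsinf_def simps by blast
  from Linf_enorm_bound[OF this] show "AE x in lebesgue_on {0<..<T}. \<bar>weak_deriv 0 T j y x\<bar> \<le> Wsinf_norm 0 T (s + 1) y"
    by eventually_elim (use 1 in linarith)
  show "0 \<le> Wsinf_norm 0 T (s + 1) y" using 1 enn2real_nonneg order_trans by blast
  show "s \<notin> \<int> \<Longrightarrow> enn2real (hoelder_eseminorm 0 T (frac s) (weak_deriv 0 T (Suc (nat \<lfloor>s\<rfloor>)) y)) \<le> Wsinf_norm 0 T (s + 1) y"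
    using sum0 by (simp only: Wsinf_norm_def simps) simp
qed

text \<open>The chain starts with \<open>y\<close> itself, not merely with a function equal to it
  almost everywhere, since the estimates concern point values. Continuity of both functions permits
  the replacement.\<close>

lemma Wsinf_chain:
  fixes s :: real
  assumes s: "1 \<le> s" and T: "0 < T" and y: "in_Wsinf 0 T (s + 1) y" and c: "continuous_on {0..T} y"
  obtains Z where "chain 0 T (Suc (nat \<lfloor>s\<rfloor>)) Z" "Z 0 = y"
    "\<And>j. j \<le> Suc (nat \<lfloor>s\<rfloor>) \<Longrightarrow> AE x in lebesgue_on {0<..<T}. Z j x = weak_deriv 0 T j y x"
proof -
  define k where "k = nat \<lfloor>s\<rfloor>"
  have hw: "has_weak_deriv 0 T j y (weak_deriv 0 T j y)" if j: "j \<le> Suc k" for j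
  proof -
    obtain g where g: "has_weak_deriv 0 T j y g"
      using y j unfolding in_Wsinf_def nat_floor_add_1[OF s] k_def by blast
    show ?thesis unfolding weak_deriv_def by (rule someI[of "has_weak_deriv 0 T j y" g, OF g])
  qed
  have L: "in_L2 0 T (weak_deriv 0 T j y)" if j: "j \<le> Suc k" for j
  proof (rule in_L2_bounded)
    show "weak_deriv 0 T j y \<in> borel_measurable (lebesgue_on {0<..<T})"
      using y j unfolding in_Wsinf_def nat_floor_add_1[OF s] k_def by blast
    show "AE x in lebesgue_on {0<..<T}. \<bar>weak_deriv 0 T j y x\<bar> \<le> Wsinf_norm 0 T (s + 1) y"
      by (rule Wsinf_bounds(1)[OF s y]) (use j in \<open>simp add: k_def\<close>)
  qed
  obtain Z where Z: "chain 0 T (Suc k) Z" "\<And>j. j \<le> Suc k \<Longrightarrow> AE x in lebesgue_on {0<..<T}. Z j x = weak_deriv 0 T j y x"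
    using weak_derivs_chain[OF T hw L, of "Suc k"] by blast
  have yL: "in_L2 0 T y" by (rule in_L2_continuous[OF c])
  have "has_weak_deriv 0 T 0 y y" using in_L2_locally_integrable[OF yL] by (simp add: has_weak_deriv_def)
  from weak_deriv_eqI[OF this] Z(2)[of 0] have ae: "AE x in lebesgue_on {0<..<T}. Z 0 x = y x"
    by (auto elim: eventually_elim2)
  have Zy: "Z 0 x = y x" if "x \<in> {0..T}" for x
    using continuous_AE_eq[OF T ac_continuous[OF chain_acD[OF Z(1)]] c ae that] by simp
  define Z' where "Z' = Z(0 := y)"
  have "ac 0 T y (Z (Suc 0))"
    unfolding ac_def
  proof (intro conjI ballI)
    show "in_L2 0 T (Z (Suc 0))" by (rule chain_in_L2[OF Z(1)]) simp
    fix x assume x: "x \<in> {0..T}"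
    then show "y x = y 0 + integral {0..x} (Z (Suc 0))"
      using ac_eq[OF chain_acD[OF Z(1), of 0], of x] Zy[OF x] Zy[of 0] T by simp
  qed
  then have "chain 0 T (Suc k) Z'" using Z(1) by (auto simp: chain_def Z'_def)
  moreover have "AE x in lebesgue_on {0<..<T}. Z' j x = weak_deriv 0 T j y x" if "j \<le> Suc k" for j
    using Z(2)[OF that] Z(2)[of 0] ae by (cases "j = 0") (auto simp: Z'_def elim: eventually_elim2)
  ultimately show ?thesis using that[of Z'] by (simp add: Z'_def k_def)
qed

text \<open>A bound by W on an interval costs the square root of its length in L2; the squares then
  sum to T W^2 over a partition.\<close>

lemma Wsinf_local_bounds:
  fixes s :: real
  assumes s: "1 \<le> s" and y: "in_Wsinf 0 T (s + 1) y"
    and Z: "chain 0 T (Suc (nat \<lfloor>s\<rfloor>)) Z"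
      "\<And>j. j \<le> Suc (nat \<lfloor>s\<rfloor>) \<Longrightarrow> AE x in lebesgue_on {0<..<T}. Z j x = weak_deriv 0 T j y x"
    and ab: "0 \<le> a" "a < b" "b \<le> T"
  defines "W \<equiv> Wsinf_norm 0 T (s + 1) y"
  shows "j \<le> Suc (nat \<lfloor>s\<rfloor>) \<Longrightarrow> nrm a b (Z j) \<le> sqrt (b - a) * W"
    and "s \<notin> \<int> \<Longrightarrow> \<exists>w\<in>borel_measurable borel. (AE x in lebesgue_on {a<..<b}. Z (Suc (nat \<lfloor>s\<rfloor>)) x = w x) \<and>
      (\<forall>\<delta>>0. osc a b \<delta> w \<le> ennreal (2 * \<delta> powr (1 + 2 * frac s) * (sqrt (b - a) * W)\<^sup>2))"
proof -
  define k where "k = nat \<lfloor>s\<rfloor>"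
  show "nrm a b (Z j) \<le> sqrt (b - a) * W" if j: "j \<le> Suc (nat \<lfloor>s\<rfloor>)"
  proof (rule nrm_le_bound)
    show "in_L2 a b (Z j)" by (rule in_L2_subinterval[OF chain_in_L2[OF Z(1) j] ab(1,3)])
    have "AE x in lebesgue_on {0<..<T}. \<bar>Z j x\<bar> \<le> W"
      using Z(2)[OF j] Wsinf_bounds(1)[OF s y j] unfolding W_def by eventually_elim simp
    then show "AE x in lebesgue_on {a<..<b}. \<bar>Z j x\<bar> \<le> W" by (rule AE_Ioo_subinterval[OF _ ab(1,3)])
    show "0 \<le> W" unfolding W_def by (rule Wsinf_bounds(2)[OF s y j])
  qed (use ab in simp)
  assume ni: "s \<notin> \<int>"
  obtain w where w: "w \<in> borel_measurable borel" "AE x in lebesgue_on {0<..<T}. Z (Suc k) x = w x"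
    using borel_representative[OF chain_in_L2[OF Z(1) order_refl]] unfolding k_def by blast
  have ae: "AE x in lebesgue_on {0<..<T}. weak_deriv 0 T (Suc k) y x = w x"
    using Z(2)[of "Suc k"] w(2) by (auto simp: k_def elim: eventually_elim2)
  have fin: "hoelder_eseminorm 0 T (frac s) (weak_deriv 0 T (Suc k) y) < \<infinity>"
    using y ni unfolding in_Wsinf_def nat_floor_add_1[OF s] frac_add_1 add_1_in_Ints_iff k_def by blast
  have f0: "0 < frac s" using ni by (simp add: frac_gt_0_iff)
  have "osc a b \<delta> w \<le> ennreal (2 * \<delta> powr (1 + 2 * frac s) * (sqrt (b - a) * W)\<^sup>2)" if "0 < \<delta>" for \<delta>
    unfolding W_def using Wsinf_bounds(3)[OF s y le0 ni]
    by (intro osc_le_hoelder[OF w(1) ae fin _ f0 ab that]) (simp add: k_def)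
  then show "\<exists>w\<in>borel_measurable borel. (AE x in lebesgue_on {a<..<b}. Z (Suc (nat \<lfloor>s\<rfloor>)) x = w x) \<and>
      (\<forall>\<delta>>0. osc a b \<delta> w \<le> ennreal (2 * \<delta> powr (1 + 2 * frac s) * (sqrt (b - a) * W)\<^sup>2))"
    using w(1) AE_Ioo_subinterval[OF w(2) ab(1,3)] unfolding k_def by blast
qed

lemma ac_pointwise_bound:
  assumes e: "ac a b e e'" and e0: "e a = 0" and x: "a \<le> x" "x \<le> b"
  shows "\<bar>e x\<bar> \<le> sqrt (b - a) * nrm a b e'"
proof -
  have L: "in_L2 a b e'" by (rule ac_in_L2[OF e])
  have Lx: "in_L2 a x e'" by (rule in_L2_subinterval[OF L order_refl x(2)])
  have "e x = integral {a..x} e'" using ac_eq[OF e x] e0 by simp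
  also have "\<dots> = ip a x e' (\<lambda>x. 1)" by (subst ip_eq_integral[OF Lx]) auto
  finally have "\<bar>e x\<bar> \<le> nrm a x e' * nrm a x (\<lambda>x. 1)" using ip_Cauchy_Schwarz[OF Lx in_L2_const] by simp
  also have "nrm a x (\<lambda>x. 1) = sqrt (x - a)" using x by (simp add: nrm_def ip_def measure_Ioo)
  also have "nrm a x e' * sqrt (x - a) \<le> nrm a b e' * sqrt (b - a)"
    using x ip_self_mono_interval[OF L order_refl x] by (intro mult_mono) (auto simp: nrm_def ip_self_nonneg)
  finally show ?thesis by (simp add: mult.commute)
qed

text \<open>The error is the integral of the residual of the derivative, so Cauchy--Schwarz gives a
  factor sqrt h, and the L2 norms of the derivatives give another. With j = min k r this yields
  h^(j+1) r^(-j); for k <= r this suffices as s - 2 <= j, and for k > r the powers of r are absorbed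
  by s^s.\<close>

lemma interp_pointwise_error:
  fixes s :: real
  assumes s: "1 \<le> s" and r: "1 \<le> r" and ab: "a < b" "b - a \<le> \<tau>" "b - a \<le> T"
    and Z: "chain a b (Suc (nat \<lfloor>s\<rfloor>)) Z" and W: "0 \<le> W" "\<And>j. j \<le> Suc (nat \<lfloor>s\<rfloor>) \<Longrightarrow> nrm a b (Z j) \<le> sqrt (b - a) * W"
    and x: "x \<in> {a..b}"
  shows "\<bar>Z 0 x - poly (cg_interp r a b (Z 0) (Z 1)) x\<bar>
    \<le> err_const s * (\<tau> powr min (real r + 1) s / real r powr (s - 2)) * (1 + T) * W"
proof -
  define k where "k = nat \<lfloor>s\<rfloor>"
  define h where "h = b - a"
  define j where "j = min k r"
  define \<mu> where "\<mu> = min (real r + 1) s"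
  have k: "1 \<le> k" "real k \<le> s" "s < real k + 1" using nat_floor_bounds[OF s] by (auto simp: k_def)
  have h: "0 < h" "h \<le> \<tau>" "h \<le> T" using ab by (auto simp: h_def)
  have ss: "1 \<le> s powr s" by (rule powr_self_ge_1[OF s])
  let ?e = "\<lambda>x. Z 0 x - poly (cg_interp r a b (Z 0) (Z 1)) x"
  have "ac a b (Z 0) (Z 1)" using chain_acD[OF Z, of 0] by simp
  from ac_cg_error[OF this, of r]
  have "\<bar>?e x\<bar> \<le> sqrt h * nrm a b (\<lambda>x. Z 1 x - poly (L2_proj (r - 1) a b (Z 1)) x)"
    unfolding h_def using x by (intro ac_pointwise_bound) (auto simp: poly_cg_interp_left)
  also have "\<dots> \<le> sqrt h * (fact j * (h / real r) ^ j * nrm a b (Z (Suc j)))"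
  proof (rule mult_left_mono)
    have "chain a b j (\<lambda>i. Z (Suc i))" by (rule chain_le[OF chain_shift[OF Z]]) (simp add: j_def k_def)
    from chain_proj_error_power[OF ab(1) this _ r]
    show "nrm a b (\<lambda>x. Z 1 x - poly (L2_proj (r - 1) a b (Z 1)) x) \<le> fact j * (h / real r) ^ j * nrm a b (Z (Suc j))"
      by (simp add: h_def j_def)
  qed (use h in simp)
  also have "\<dots> \<le> sqrt h * (fact j * (h / real r) ^ j * (sqrt h * W))"
    using h W(2)[of "Suc j"] unfolding h_def[symmetric] by (intro mult_left_mono) (auto simp: j_def k_def)
  also have "\<dots> = fact j * (sqrt h * sqrt h) * (h / real r) ^ j * W" by (simp add: ac_simps)
  also have "\<dots> = fact j * h ^ Suc j * (1 / real r ^ j) * W" using h by (simp add: power_divide)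
  also have "\<dots> \<le> fact (Suc k) * (\<tau> powr \<mu> * (1 + T)) * (s powr s / real r powr (s - 2)) * W"
  proof (intro mult_right_mono mult_mono)
    show "(fact j :: real) \<le> fact (Suc k)" by (rule fact_mono) (simp add: j_def)
    \<comment> \<open>The surplus over the required power of h: it is k + 1 - s if k <= r and 0
      otherwise, hence between 0 and 1, and h^d is at most 1 + T.\<close>
    define d where "d = real (Suc j) - \<mu>"
    have d: "0 \<le> d" "d \<le> 1" using k by (auto simp: d_def j_def \<mu>_def min_def)
    have "h ^ Suc j = h powr real (Suc j)" using h(1) by (simp only: powr_realpow)
    also have "real (Suc j) = \<mu> + d" by (simp add: d_def)
    also have "h powr (\<mu> + d) = h powr \<mu> * h powr d" by (rule powr_add)
    also have "h powr \<mu> * h powr d \<le> \<tau> powr \<mu> * (1 + T)"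
    proof (intro mult_mono)
      show "h powr \<mu> \<le> \<tau> powr \<mu>" using h s by (intro powr_mono2) (auto simp: \<mu>_def)
      have "h powr d \<le> (1 + T) powr d" using h d by (intro powr_mono2) auto
      also have "\<dots> \<le> (1 + T) powr 1" using h d by (intro powr_mono) auto
      finally show "h powr d \<le> 1 + T" using h by simp
    qed auto
    finally show "h ^ Suc j \<le> \<tau> powr \<mu> * (1 + T)" .
    have "real r powr (s - 2 - real j) \<le> s powr s"
    proof (cases "k \<le> r")
      case True
      then have "real r powr (s - 2 - real j) \<le> real r powr 0" using k r by (intro powr_mono) (auto simp: j_def)
      then show ?thesis using ss r by simp
    next
      case False
      have "real r powr (s - 2 - real j) \<le> real r powr s" using r by (intro powr_mono) auto
      also have "\<dots> \<le> s powr s" using False k s by (intro powr_mono2) auto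
      finally show ?thesis .
    qed
    then have "real r powr (s - 2) / real r ^ j \<le> s powr s" using r by (simp add: powr_diff powr_realpow)
    then show "1 / real r ^ j \<le> s powr s / real r powr (s - 2)" using r by (simp add: field_simps)
  qed (use h W in auto)
  also have "\<dots> = (fact (Suc k) * s powr s) * ((\<tau> powr \<mu> / real r powr (s - 2)) * (1 + T) * W)" by simp
  also have "\<dots> \<le> err_const s * ((\<tau> powr \<mu> / real r powr (s - 2)) * (1 + T) * W)"
    using h W by (intro mult_right_mono) (auto simp: err_const_def k_def simp del: fact_Suc)
  finally show ?thesis by (simp add: \<mu>_def mult.assoc)
qed

section \<open>The error estimates\<close>

lemma ac_Lipschitz:
  assumes u: "ac a b u g" and B: "AE x in lebesgue_on {a<..<b}. \<bar>g x\<bar> \<le> B" and xy: "x \<in> {a..b}" "y \<in> {a..b}"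
  shows "\<bar>u x - u y\<bar> \<le> B * \<bar>x - y\<bar>"
proof -
  have *: "\<bar>u q - u p\<bar> \<le> B * (q - p)" if pq: "a \<le> p" "p \<le> q" "q \<le> b" for p q
  proof -
    have L: "in_L2 p q g" by (rule in_L2_subinterval[OF ac_in_L2[OF u] pq(1,3)])
    have i: "integrable (lebesgue_on {p<..<q}) g" by (rule in_L2_integrable[OF L])
    have "\<bar>u q - u p\<bar> = \<bar>\<integral>x. g x \<partial>lebesgue_on {p<..<q}\<bar>"
      by (simp only: ac_diff_eq[OF u pq] integral_lebesgue_on_Ioo[OF i])
    also have "\<dots> \<le> (\<integral>x. \<bar>g x\<bar> \<partial>lebesgue_on {p<..<q})" by (rule integral_abs_bound)
    also have "\<dots> \<le> (\<integral>x. B \<partial>lebesgue_on {p<..<q})"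
      using i in_L2_integrable[OF in_L2_const] AE_Ioo_subinterval[OF B pq(1,3)] by (intro integral_mono_AE) auto
    also have "\<dots> = B * (q - p)" using pq by (simp add: measure_Ioo)
    finally show ?thesis .
  qed
  show ?thesis
    using *[of x y] *[of y x] xy by (cases "x \<le> y") (auto simp: abs_minus_commute)
qed

lemma partition_cover:
  fixes t :: "nat \<Rightarrow> real"
  assumes "t 0 \<le> x" "x \<le> t N" "0 < N" shows "\<exists>n<N. x \<in> {t n..t (Suc n)}"
  using assms
proof (induction N)
  case (Suc N)
  show ?case
  proof (cases "t N \<le> x")
    case False
    then have "0 < N" using Suc.prems by (cases N) auto
    then show ?thesis using Suc False by (meson less_SucI nle_le)
  qed (use Suc in auto)
qed simp

lemma err_const_pos: "1 \<le> s \<Longrightarrow> 0 < err_const s"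
  by (simp add: err_const_def del: fact_Suc)

text \<open>The interpolation error of D Y is bounded twice: through the H^s norm of D Y for the
  nodal estimate, and through Y' and R for the pointwise one, which also carries the pointwise
  interpolation error of Y.\<close>

lemma error_estimates:
  fixes s T :: real and t :: "nat \<Rightarrow> real"
  assumes s: "1 \<le> s" and T: "0 < T" and D: "neg_semidef M (\<lambda>i j. D i j + D j i)" and r: "1 \<le> r"
    and tp: "time_partition T N t" and ivp: "ivp_solution T M D Y0 R Y"
    and R: "\<And>i. i < M \<Longrightarrow> in_Hs 0 T s (R i)" and Y: "\<And>i. i < M \<Longrightarrow> in_Wsinf 0 T (s + 1) (Y i)"
    and cg: "cg_solution T N t r M D Y0 R Yr"
  defines "\<tau> \<equiv> max_step N t" and "VW \<equiv> vec_Wsinf_norm M 0 T (s + 1) Y" and "VR \<equiv> vec_Hs_norm M 0 T s R"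
  shows "n \<le> N \<Longrightarrow> L2_set (\<lambda>i. Y i (t n) - Yr i (t n)) {..<M} \<le>
      2 * err_const s * sqrt T * (\<tau> powr min (real r + 1) s / real r powr s) * vec_Hs_norm M 0 T s (mat_vec M D Y)"
    and "x \<in> {0..T} \<Longrightarrow> L2_set (\<lambda>i. Y i x - Yr i x) {..<M} \<le>
      21 * err_const s * (1 + 1 / sqrt T) * (1 + sqrt T) * (\<tau> powr min (real r + 1) s / real r powr (s - 2)) * (sqrt T * VW + VR)"
proof -
  define k where "k = nat \<lfloor>s\<rfloor>"
  define E where "E = err_const s"
  define X where "X = \<tau> powr min (real r + 1) s / real r powr s"
  define X2 where "X2 = \<tau> powr min (real r + 1) s / real r powr (s - 2)"
  have E: "0 < E" unfolding E_def by (rule err_const_pos[OF s])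
  have X: "0 \<le> X" "0 \<le> X2" by (auto simp: X_def X2_def)
  have t: "t 0 = 0" "t N = T" and tm: "\<And>n. n < N \<Longrightarrow> t n < t (Suc n)" using tp by (auto simp: time_partition_def)
  have N: "0 < N" using t T by (cases N) auto
  have mono: "t m \<le> t n" if "m \<le> n" "n \<le> N" for m n
    by (rule partition_mono[OF _ that]) (simp add: tm less_imp_le)
  have sub: "0 \<le> t n" "t (Suc n) \<le> T" if "n < N" for n
    using mono[of 0 n] mono[of "Suc n" N] that t by auto
  have tau: "t (Suc n) - t n \<le> \<tau>" if "n < N" for n
    unfolding \<tau>_def max_step_def using that by (intro Max_ge) auto
  have ivpD: "continuous_on {0..T} (Y i)" "Y i 0 = Y0 i" "has_weak_deriv 0 T 1 (Y i) (\<lambda>x. mat_vec M D Y i x + R i x)"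
    if "i < M" for i using ivp that by (auto simp: ivp_solution_def)
  have "\<exists>Z. i < M \<longrightarrow> chain 0 T (Suc k) Z \<and> Z 0 = Y i \<and>
     (\<forall>j\<le>Suc k. AE x in lebesgue_on {0<..<T}. Z j x = weak_deriv 0 T j (Y i) x)" for i
  proof (cases "i < M")
    case True
    show ?thesis by (rule Wsinf_chain[OF s T Y[OF True] ivpD(1)[OF True]]) (auto simp: k_def)
  qed auto
  then obtain Z where Z0: "\<forall>i. i < M \<longrightarrow> chain 0 T (Suc k) (Z i) \<and> Z i 0 = Y i \<and>
     (\<forall>j\<le>Suc k. AE x in lebesgue_on {0<..<T}. Z i j x = weak_deriv 0 T j (Y i) x)" by metis
  have Z: "chain 0 T (Suc k) (Z i)" "Z i 0 = Y i"
    "\<And>j. j \<le> Suc k \<Longrightarrow> AE x in lebesgue_on {0<..<T}. Z i j x = weak_deriv 0 T j (Y i) x" if "i < M" for i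
    using Z0 that by auto
  define W where "W i = Wsinf_norm 0 T (s + 1) (Y i)" for i
  have W0: "0 \<le> W i" if "i < M" for i unfolding W_def by (rule Wsinf_bounds(2)[OF s Y[OF that], of 0]) simp
  define UD where "UD i j x = (\<Sum>m<M. D i m * Z m j x)" for i j x
  \<comment> \<open>Derivatives of R are represented by those of Y' - D Y, so that the splitting of
    D Y holds exactly at every order; equality with R almost everywhere follows from uniqueness of
    weak derivatives.\<close>
  define UR where "UR i j x = Z i (Suc j) x - UD i j x" for i j x
  have UD0: "mat_vec M D Y i = UD i 0" for i using Z(2) by (simp add: mat_vec_def UD_def fun_eq_iff)
  have UD1: "mat_vec M D (\<lambda>m. Z m 1) i = UD i 1" for i by (simp add: mat_vec_def UD_def fun_eq_iff)
  have cUD: "chain 0 T (Suc k) (UD i)" for i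
    unfolding UD_def using Z(1) by (intro chain_lincomb) auto
  have cUDk: "chain 0 T k (UD i)" for i by (rule chain_le[OF cUD]) simp
  have cUR: "chain 0 T k (UR i)" if "i < M" for i
    unfolding UR_def by (intro chain_diff chain_shift Z(1)[OF that] cUDk)
  have acY: "ac 0 T (Y i) (Z i 1)" if "i < M" for i
    using chain_acD[OF Z(1)[OF that], of 0] Z(2)[OF that] by simp
  have Rae: "AE x in lebesgue_on {0<..<T}. UR i 0 x = R i x" if i: "i < M" for i
  proof -
    have "has_weak_deriv 0 T 1 (Y i) (Z i 1)"
      using Z(2)[OF i] by (intro chain_weak_deriv[OF less_imp_le[OF T] Z(1)[OF i]]) auto
    from has_weak_deriv_unique[OF this ivpD(3)[OF i]] show ?thesis
      unfolding UD0 by eventually_elim (simp add: UR_def)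
  qed

  have "\<exists>A. local_bounds s N t (UD i) A \<and> (\<Sum>n<N. (A n)\<^sup>2) \<le> (Hs_norm 0 T s (mat_vec M D Y i))\<^sup>2" for i
  proof (rule Hs_local_bounds[OF s t T tm cUDk[unfolded k_def]])
    show "AE x in lebesgue_on {0<..<T}. UD i 0 x = mat_vec M D Y i x" by (simp add: UD0)
    obtain w where w: "w \<in> borel_measurable borel" "AE x in lebesgue_on {0<..<T}. UD i k x = w x"
      using borel_representative[OF chain_in_L2[OF cUDk order_refl]] by blast
    define B where "B = (\<Sum>m<M. \<bar>D i m\<bar> * W m)"
    have "\<forall>m\<in>{..<M}. AE x in lebesgue_on {0<..<T}. \<bar>Z m (Suc k) x\<bar> \<le> W m"
    proof
      fix m assume "m \<in> {..<M}"
      then have m: "m < M" by simp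
      show "AE x in lebesgue_on {0<..<T}. \<bar>Z m (Suc k) x\<bar> \<le> W m"
        using Z(3)[OF m order_refl] Wsinf_bounds(1)[OF s Y[OF m], of "Suc k"]
        unfolding W_def k_def by (auto elim: eventually_elim2)
    qed
    then have "AE x in lebesgue_on {0<..<T}. \<forall>m\<in>{..<M}. \<bar>Z m (Suc k) x\<bar> \<le> W m"
      by (subst AE_ball_countable) (auto intro: countable_finite)
    then have UB: "AE x in lebesgue_on {0<..<T}. \<bar>UD i (Suc k) x\<bar> \<le> B"
    proof eventually_elim
      case (elim x)
      have "\<bar>UD i (Suc k) x\<bar> \<le> (\<Sum>m<M. \<bar>D i m * Z m (Suc k) x\<bar>)" unfolding UD_def by (rule sum_abs)
      also have "\<dots> \<le> B" unfolding B_def using elim by (intro sum_mono) (auto simp: abs_mult intro!: mult_left_mono)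
      finally show ?case .
    qed
    \<comment> \<open>The derivative of order k + 1 of D Y is bounded, so the one of order k is
      Lipschitz.\<close>
    have "gag 0 T (frac s) w < \<infinity>"
      by (rule gag_finite_if_Lipschitz[OF w(1,2) ac_Lipschitz[OF chain_acD[OF cUD] UB] _ T]) (auto simp: frac_lt_1)
    then show "\<exists>w\<in>borel_measurable borel. (AE x in lebesgue_on {0<..<T}. UD i (nat \<lfloor>s\<rfloor>) x = w x) \<and> gag 0 T (frac s) w < \<infinity>"
      using w unfolding k_def by blast
  qed
  then obtain AU where AU: "\<And>i. local_bounds s N t (UD i) (AU i)"
    "\<And>i. (\<Sum>n<N. (AU i n)\<^sup>2) \<le> (Hs_norm 0 T s (mat_vec M D Y i))\<^sup>2"
    by metis

  have "\<exists>A. i < M \<longrightarrow> local_bounds s N t (UR i) A \<and> (\<Sum>n<N. (A n)\<^sup>2) \<le> (Hs_norm 0 T s (R i))\<^sup>2" for i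
  proof (cases "i < M")
    case i: True
    have "\<exists>A. local_bounds s N t (UR i) A \<and> (\<Sum>n<N. (A n)\<^sup>2) \<le> (Hs_norm 0 T s (R i))\<^sup>2"
    proof (rule Hs_local_bounds[OF s t T tm cUR[OF i, unfolded k_def] Rae[OF i]])
      assume ni: "s \<notin> \<int>"
      obtain w where w: "w \<in> borel_measurable borel" "AE x in lebesgue_on {0<..<T}. UR i k x = w x"
        using borel_representative[OF chain_in_L2[OF cUR[OF i] order_refl]] by blast
      have "AE x in lebesgue_on {0<..<T}. weak_deriv 0 T k (R i) x = w x"
        using weak_deriv_eqI[OF chain_weak_deriv[OF less_imp_le[OF T] cUR[OF i] Rae[OF i] order_refl]] w(2)
        by eventually_elim simp
      moreover have "integrable (lebesgue_on ({0<..<T} \<times> {0<..<T})) (gagliardo_quot (frac s) (weak_deriv 0 T k (R i)))"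
        using R[OF i] ni by (simp add: in_Hs_def k_def)
      ultimately have "gag 0 T (frac s) w < \<infinity>" by (rule gag_finite_if_integrable[OF w(1)])
      then show "\<exists>w\<in>borel_measurable borel. (AE x in lebesgue_on {0<..<T}. UR i (nat \<lfloor>s\<rfloor>) x = w x) \<and> gag 0 T (frac s) w < \<infinity>"
        using w unfolding k_def by blast
    qed
    then show ?thesis by blast
  qed auto
  then obtain AR where AR: "\<And>i. i < M \<Longrightarrow> local_bounds s N t (UR i) (AR i)"
    "\<And>i. i < M \<Longrightarrow> (\<Sum>n<N. (AR i n)\<^sup>2) \<le> (Hs_norm 0 T s (R i))\<^sup>2"
    by metis

  have Wb: "nrm (t n) (t (Suc n)) (Z i j) \<le> sqrt (t (Suc n) - t n) * W i"
    if "i < M" "n < N" "j \<le> Suc (nat \<lfloor>s\<rfloor>)" for i n j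
    unfolding W_def
    by (rule Wsinf_local_bounds(1)[OF s Y[OF that(1)] Z(1)[OF that(1), unfolded k_def] _ sub(1)[OF that(2)] tm[OF that(2)] sub(2)[OF that(2)] that(3)])
      (rule Z(3)[OF that(1), unfolded k_def])
  have Wo: "\<exists>w\<in>borel_measurable borel. (AE x in lebesgue_on {t n<..<t (Suc n)}. Z i (Suc (nat \<lfloor>s\<rfloor>)) x = w x) \<and>
      (\<forall>\<delta>>0. osc (t n) (t (Suc n)) \<delta> w \<le> ennreal (2 * \<delta> powr (1 + 2 * frac s) * (sqrt (t (Suc n) - t n) * W i)\<^sup>2))"
    if "i < M" "n < N" "s \<notin> \<int>" for i n
    unfolding W_def
    by (rule Wsinf_local_bounds(2)[OF s Y[OF that(1)] Z(1)[OF that(1), unfolded k_def] _ sub(1)[OF that(2)] tm[OF that(2)] sub(2)[OF that(2)] that(3)])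
      (rule Z(3)[OF that(1), unfolded k_def])
  define err where "err i n = nrm (t n) (t (Suc n)) (\<lambda>x. UD i 0 x - poly (cg_interp r (t n) (t (Suc n)) (UD i 0) (UD i 1)) x)" for i n
  have err1: "err i n \<le> E * X * AU i n" if n: "n < N" for i n
    unfolding err_def E_def X_def
    by (rule local_error_bounds[OF s r tm[OF n] tau[OF n] chain_subinterval[OF cUDk[unfolded k_def] sub[OF n]] AU(1) n])
  \<comment> \<open>Here \<open>D\<close> disappears from the bound: each summand of Y' - R has
    regularity of order s by hypothesis, and the interpolation is linear.\<close>
  have err2: "err i n \<le> E * X * (sqrt (t (Suc n) - t n) * W i + AR i n)" if i: "i < M" and n: "n < N" for i n
  proof -
    let ?a = "t n" and ?b = "t (Suc n)"
    define eY where "eY = (\<lambda>x. Z i 1 x - poly (cg_interp r ?a ?b (Z i 1) (Z i 2)) x)"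
    define eR where "eR = (\<lambda>x. UR i 0 x - poly (cg_interp r ?a ?b (UR i 0) (UR i 1)) x)"
    have cY: "chain ?a ?b k (\<lambda>j. Z i (Suc j))" by (intro chain_subinterval[OF _ sub[OF n]] chain_shift Z(1)[OF i])
    have cR: "chain ?a ?b k (UR i)" by (intro chain_subinterval[OF _ sub[OF n]] cUR[OF i])
    have k1: "1 \<le> k" using nat_floor_bounds(1)[OF s] by (simp add: k_def)
    have L: "in_L2 ?a ?b (Z i 1)" "in_L2 ?a ?b (Z i 2)" "in_L2 ?a ?b (UR i 0)" "in_L2 ?a ?b (UR i 1)"
      using chain_in_L2[OF cY, of 0] chain_in_L2[OF cY k1] chain_in_L2[OF cR, of 0] chain_in_L2[OF cR k1]
      by (auto simp: numeral_2_eq_2)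
    have nY: "nrm ?a ?b eY \<le> E * X * (sqrt (?b - ?a) * W i)"
    proof -
      have "nrm ?a ?b (\<lambda>x. Z i (Suc 0) x - poly (cg_interp r ?a ?b (Z i (Suc 0)) (Z i (Suc 1))) x)
        \<le> err_const s * (\<tau> powr min (real r + 1) s / real r powr s) * (sqrt (?b - ?a) * W i)"
      proof (rule local_error[OF s r tm[OF n] tau[OF n] cY[unfolded k_def]])
        show "0 \<le> sqrt (?b - ?a) * W i" using tm[OF n] W0[OF i] by simp
        show "nrm ?a ?b (Z i (Suc j)) \<le> sqrt (?b - ?a) * W i" if "j \<le> nat \<lfloor>s\<rfloor>" for j
          using that by (intro Wb[OF i n]) simp
        show "\<exists>w\<in>borel_measurable borel. (AE x in lebesgue_on {?a<..<?b}. Z i (Suc (nat \<lfloor>s\<rfloor>)) x = w x) \<and>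
          (\<forall>\<delta>>0. osc ?a ?b \<delta> w \<le> ennreal (2 * \<delta> powr (1 + 2 * frac s) * (sqrt (?b - ?a) * W i)\<^sup>2))" if "s \<notin> \<int>"
          by (rule Wo[OF i n that])
      qed
      then show ?thesis by (simp add: eY_def E_def X_def numeral_2_eq_2)
    qed
    have nR: "nrm ?a ?b eR \<le> E * X * AR i n"
      unfolding eR_def E_def X_def
      by (rule local_error_bounds[OF s r tm[OF n] tau[OF n] cR[unfolded k_def] AR(1)[OF i] n])
    have uD: "UD i 0 = (\<lambda>x. Z i 1 x - UR i 0 x)" "UD i 1 = (\<lambda>x. Z i 2 x - UR i 1 x)"
      by (auto simp: UR_def numeral_2_eq_2)
    have "UD i 0 x - poly (cg_interp r ?a ?b (UD i 0) (UD i 1)) x = eY x - eR x" for x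
      unfolding uD cg_interp_diff[OF tm[OF n] L(2,4)] eY_def eR_def by simp
    then have "err i n = nrm ?a ?b (\<lambda>x. eY x - eR x)" by (simp only: err_def)
    also have "\<dots> \<le> nrm ?a ?b eY + nrm ?a ?b eR"
      by (rule nrm_diff_triangle) (unfold eY_def eR_def, (intro in_L2_diff L in_L2_poly)+)
    also have "\<dots> \<le> E * X * (sqrt (?b - ?a) * W i + AR i n)" using nY nR by (simp add: distrib_left)
    finally show ?thesis .
  qed
  have e0: "0 \<le> err i n" for i n by (simp add: err_def)

  have E2a: "(\<Sum>n<N. \<Sum>i<M. (err i n)\<^sup>2) \<le> (E * X * vec_Hs_norm M 0 T s (mat_vec M D Y))\<^sup>2"
  proof -
    have "(\<Sum>n<N. \<Sum>i<M. (err i n)\<^sup>2) \<le> (\<Sum>n<N. \<Sum>i<M. (E * X * AU i n)\<^sup>2)"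
      using err1 e0 by (intro sum_mono power_mono) auto
    also have "\<dots> = (E * X)\<^sup>2 * (\<Sum>i<M. \<Sum>n<N. (AU i n)\<^sup>2)"
      by (subst sum.swap) (simp add: power_mult_distrib sum_distrib_left)
    also have "\<dots> \<le> (E * X)\<^sup>2 * (\<Sum>i<M. (Hs_norm 0 T s (mat_vec M D Y i))\<^sup>2)"
      using AU(2) by (intro mult_left_mono sum_mono) auto
    also have "\<dots> = (E * X * vec_Hs_norm M 0 T s (mat_vec M D Y))\<^sup>2"
      by (simp add: vec_Hs_norm_def L2_set_def power_mult_distrib sum_nonneg)
    finally show ?thesis .
  qed
  have VW0: "0 \<le> VW" "0 \<le> VR" by (auto simp: VW_def VR_def vec_Wsinf_norm_def vec_Hs_norm_def)
  define S where "S = sqrt T * VW + VR"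
  have S0: "0 \<le> S" "sqrt T * VW \<le> S" using VW0 T by (auto simp: S_def)
  have E2b: "(\<Sum>n<N. \<Sum>i<M. (err i n)\<^sup>2) \<le> (2 * E * X * S)\<^sup>2"
  proof -
    have "(\<Sum>n<N. \<Sum>i<M. (err i n)\<^sup>2) \<le> (\<Sum>n<N. \<Sum>i<M. (E * X)\<^sup>2 * (2 * ((t (Suc n) - t n) * (W i)\<^sup>2) + 2 * (AR i n)\<^sup>2))"
    proof (intro sum_mono)
      fix n i assume "n \<in> {..<N}" "i \<in> {..<M}"
      then have n: "n < N" and i: "i < M" by auto
      define p where "p = sqrt (t (Suc n) - t n) * W i"
      have "(err i n)\<^sup>2 \<le> (E * X * (p + AR i n))\<^sup>2" unfolding p_def by (rule power_mono[OF err2[OF i n] e0])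
      also have "\<dots> = (E * X)\<^sup>2 * (p + AR i n)\<^sup>2" by (rule power_mult_distrib)
      also have "\<dots> \<le> (E * X)\<^sup>2 * (2 * p\<^sup>2 + 2 * (AR i n)\<^sup>2)"
        using zero_le_power2[of "p - AR i n"] by (intro mult_left_mono) (auto simp: power2_sum power2_diff)
      also have "p\<^sup>2 = (t (Suc n) - t n) * (W i)\<^sup>2" using tm[OF n] by (simp add: p_def power_mult_distrib)
      finally show "(err i n)\<^sup>2 \<le> (E * X)\<^sup>2 * (2 * ((t (Suc n) - t n) * (W i)\<^sup>2) + 2 * (AR i n)\<^sup>2)" .
    qed
    also have "\<dots> = (E * X)\<^sup>2 * (2 * (\<Sum>i<M. (\<Sum>n<N. t (Suc n) - t n) * (W i)\<^sup>2) + 2 * (\<Sum>i<M. \<Sum>n<N. (AR i n)\<^sup>2))"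
      by (subst sum.swap) (simp only: sum_distrib_left[symmetric] sum.distrib sum_distrib_right[symmetric])
    \<comment> \<open>The step lengths add up to T; this produces the factor sqrt T before the norm
      of Y.\<close>
    also have "(\<Sum>n<N. t (Suc n) - t n) = T" using sum_lessThan_telescope[of t N] t by simp
    also have "(\<Sum>i<M. T * (W i)\<^sup>2) = T * VW\<^sup>2"
      by (simp add: VW_def vec_Wsinf_norm_def L2_set_def sum_nonneg W_def sum_distrib_left)
    also have "(E * X)\<^sup>2 * (2 * (T * VW\<^sup>2) + 2 * (\<Sum>i<M. \<Sum>n<N. (AR i n)\<^sup>2)) \<le> (E * X)\<^sup>2 * (2 * (T * VW\<^sup>2) + 2 * VR\<^sup>2)"
    proof -
      have "(\<Sum>i<M. \<Sum>n<N. (AR i n)\<^sup>2) \<le> (\<Sum>i<M. (Hs_norm 0 T s (R i))\<^sup>2)"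
        using AR(2) by (intro sum_mono) auto
      also have "\<dots> = VR\<^sup>2" by (simp add: VR_def vec_Hs_norm_def L2_set_def sum_nonneg)
      finally show ?thesis by (intro mult_left_mono) auto
    qed
    also have "\<dots> \<le> (E * X)\<^sup>2 * (2 * S)\<^sup>2"
    proof (rule mult_left_mono)
      have "S\<^sup>2 = T * VW\<^sup>2 + VR\<^sup>2 + 2 * (sqrt T * VW) * VR"
        using T by (simp add: S_def power2_sum power_mult_distrib)
      moreover have "0 \<le> 2 * (sqrt T * VW) * VR" "0 \<le> T * VW\<^sup>2" using VW0 T by auto
      ultimately have "2 * (T * VW\<^sup>2) + 2 * VR\<^sup>2 \<le> 4 * S\<^sup>2" using zero_le_power2[of VR] by linarith
      then show "2 * (T * VW\<^sup>2) + 2 * VR\<^sup>2 \<le> (2 * S)\<^sup>2" by (simp add: power_mult_distrib)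
    qed simp
    also have "\<dots> = (2 * E * X * S)\<^sup>2" by (simp add: power_mult_distrib)
    finally show ?thesis .
  qed
  have sum_eq: "(\<Sum>n<N. \<Sum>i<M. (nrm (t n) (t (Suc n)) (\<lambda>x. mat_vec M D Y i x
       - poly (cg_interp r (t n) (t (Suc n)) (mat_vec M D Y i) (mat_vec M D (\<lambda>m. Z m 1) i)) x))\<^sup>2) = (\<Sum>n<N. \<Sum>i<M. (err i n)\<^sup>2)"
    by (simp only: err_def UD0 UD1)
  have Rae': "AE x in lebesgue_on {0<..<T}. Z i 1 x - mat_vec M D Y i x = R i x" if "i < M" for i
    using Rae[OF that] by (simp add: UR_def UD0)
  show "L2_set (\<lambda>i. Y i (t n) - Yr i (t n)) {..<M} \<le>
      2 * err_const s * sqrt T * (\<tau> powr min (real r + 1) s / real r powr s) * vec_Hs_norm M 0 T s (mat_vec M D Y)"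
    if n: "n \<le> N"
  proof -
    have "L2_set (\<lambda>i. Y i (t n) - Yr i (t n)) {..<M} \<le> 2 * sqrt T * sqrt ((E * X * vec_Hs_norm M 0 T s (mat_vec M D Y))\<^sup>2)"
      by (rule cg_error_bounds(1)[where dY = "\<lambda>m. Z m 1", OF T D r tp cg])
        (rule n E2a[folded sum_eq] | (rule acY ivpD(2) Rae'; assumption))+
    then show ?thesis
      using E X by (simp add: E_def X_def vec_Hs_norm_def ac_simps)
  qed
  show "L2_set (\<lambda>i. Y i x - Yr i x) {..<M} \<le>
      21 * err_const s * (1 + 1 / sqrt T) * (1 + sqrt T) * (\<tau> powr min (real r + 1) s / real r powr (s - 2)) * (sqrt T * VW + VR)"
    if x: "x \<in> {0..T}"
  proof -
    obtain n where n: "n < N" "x \<in> {t n..t (Suc n)}" using partition_cover[of t x N] x t N by auto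
    have 1: "L2_set (\<lambda>i. Y i x - Yr i x) {..<M}
      \<le> L2_set (\<lambda>i. Y i x - poly (cg_interp r (t n) (t (Suc n)) (Y i) (Z i 1)) x) {..<M} + 10 * real r * sqrt T * sqrt ((2 * E * X * S)\<^sup>2)"
      by (rule cg_error_bounds(2)[where dY = "\<lambda>m. Z m 1", OF T D r tp cg])
        (rule n E2b[folded sum_eq] | (rule acY ivpD(2) Rae'; assumption))+
    have 2: "L2_set (\<lambda>i. Y i x - poly (cg_interp r (t n) (t (Suc n)) (Y i) (Z i 1)) x) {..<M} \<le> E * X2 * (1 + T) * VW"
    proof -
      have "\<bar>Y i x - poly (cg_interp r (t n) (t (Suc n)) (Y i) (Z i 1)) x\<bar> \<le> E * X2 * (1 + T) * W i" if i: "i < M" for i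
      proof -
        have "\<bar>Z i 0 x - poly (cg_interp r (t n) (t (Suc n)) (Z i 0) (Z i 1)) x\<bar>
          \<le> err_const s * (\<tau> powr min (real r + 1) s / real r powr (s - 2)) * (1 + T) * W i"
          using sub[OF n(1)]
          by (intro interp_pointwise_error[OF s r tm[OF n(1)] tau[OF n(1)] _ chain_subinterval[OF Z(1)[OF i, unfolded k_def] sub[OF n(1)]] W0[OF i] _ n(2)]
              Wb[OF i n(1)]) auto
        then show ?thesis by (simp only: Z(2)[OF i] E_def X2_def)
      qed
      then have "L2_set (\<lambda>i. \<bar>Y i x - poly (cg_interp r (t n) (t (Suc n)) (Y i) (Z i 1)) x\<bar>) {..<M} \<le> L2_set (\<lambda>i. E * X2 * (1 + T) * W i) {..<M}"
        by (intro L2_set_mono) auto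
      also have "\<dots> = E * X2 * (1 + T) * VW"
        using E X T unfolding VW_def vec_Wsinf_norm_def W_def by (intro L2_set_right_distrib[symmetric]) auto
      finally show ?thesis by (simp add: L2_set_def)
    qed
    \<comment> \<open>The inverse inequality costs one power of r and leaves r^(1 - s), which is at
      most the r^(2 - s) of the estimate.\<close>
    have 3: "real r * X \<le> X2"
    proof -
      have "real r * real r powr (s - 2) \<le> real r powr s"
      proof -
        have "real r * real r powr (s - 2) = real r powr 1 * real r powr (s - 2)" using r by simp
        also have "\<dots> = real r powr (1 + (s - 2))" by (rule powr_add[symmetric])
        also have "\<dots> \<le> real r powr s" using r by (intro powr_mono) auto
        finally show ?thesis .
      qed
      then have "real r / real r powr s \<le> 1 / real r powr (s - 2)" using r by (simp add: field_simps)
      then have "\<tau> powr min (real r + 1) s * (real r / real r powr s) \<le> \<tau> powr min (real r + 1) s * (1 / real r powr (s - 2))"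
        by (intro mult_left_mono) auto
      then show ?thesis by (simp add: X_def X2_def mult.commute)
    qed
    define q where "q = sqrt T"
    have q: "0 < q" "T = q * q" using T by (auto simp: q_def)
    \<comment> \<open>P q = (1 + q)^2 dominates 1 + T = 1 + q^2: the term 1 / q creates the factor
      sqrt T that accompanies the norm of Y.\<close>
    define P where "P = (1 + 1 / q) * (1 + q)"
    have P: "1 + T \<le> P * q" "q \<le> P"
      using q by (auto simp: P_def field_simps)
    have "10 * real r * sqrt T * sqrt ((2 * E * X * S)\<^sup>2) = 20 * (E * S * q) * (real r * X)"
      using E X S0 by (simp add: q_def)
    also have "\<dots> \<le> 20 * (E * S * q) * X2" using 3 E S0 q by (intro mult_left_mono) auto
    also have "\<dots> \<le> 20 * (E * S * P) * X2" using E S0 P X by (intro mult_right_mono mult_left_mono) auto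
    finally have 4: "10 * real r * sqrt T * sqrt ((2 * E * X * S)\<^sup>2) \<le> 20 * (E * S * P) * X2" .
    have P0: "0 \<le> P" using P q by linarith
    have "E * X2 * (1 + T) * VW \<le> E * X2 * (P * q) * VW" using E X P VW0 by (intro mult_right_mono mult_left_mono) auto
    also have "\<dots> = (E * X2 * P) * (q * VW)" by simp
    also have "\<dots> \<le> (E * X2 * P) * S" using E X P0 S0 by (intro mult_left_mono) (auto simp: q_def)
    finally have "L2_set (\<lambda>i. Y i x - Yr i x) {..<M} \<le> (E * X2 * P) * S + 20 * (E * S * P) * X2"
      using 1 2 4 by linarith
    also have "\<dots> = 21 * E * P * X2 * S" by (simp add: algebra_simps)
    finally show ?thesis by (simp add: E_def P_def q_def X2_def S_def mult.assoc)
  qed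
qed

theorem theorem2p1:
  fixes s :: real
  assumes "1 \<le> s"
  shows "\<exists>C>0. \<exists>C' :: real \<Rightarrow> real. (\<forall>T>0. 0 < C' T) \<and> antimono_on {0<..} C' \<and>
    (\<forall>(T::real) (M::nat) (D :: nat \<Rightarrow> nat \<Rightarrow> real) (r::nat) (N::nat) (t :: nat \<Rightarrow> real)
      (Y0 :: nat \<Rightarrow> real) (R :: nat \<Rightarrow> real \<Rightarrow> real) (Y :: nat \<Rightarrow> real \<Rightarrow> real)
      (Yr :: nat \<Rightarrow> real \<Rightarrow> real).
      0 < T \<longrightarrow> 1 \<le> M \<longrightarrow> neg_semidef M (\<lambda>i j. D i j + D j i) \<longrightarrow> 1 \<le> r \<longrightarrow>
      time_partition T N t \<longrightarrow>
      ivp_solution T M D Y0 R Y \<longrightarrow>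
      (\<forall>i<M. in_Hs 0 T s (R i)) \<longrightarrow>
      (\<forall>i<M. in_Wsinf 0 T (1 + s) (Y i)) \<longrightarrow>
      cg_solution T N t r M D Y0 R Yr \<longrightarrow>
      (\<forall>n\<in>{1..N}. L2_set (\<lambda>i. Y i (t n) - Yr i (t n)) {..<M} \<le>
         C * sqrt T * (max_step N t powr min (real r + 1) s / real r powr s) *
         vec_Hs_norm M 0 T s (mat_vec M D Y)) \<and>
      (\<forall>x\<in>{0..T}. L2_set (\<lambda>i. Y i x - Yr i x) {..<M} \<le>
         C' T * (1 + sqrt T) * (max_step N t powr min (real r + 1) s / real r powr (s - 2)) *
         (sqrt T * vec_Wsinf_norm M 0 T (s + 1) Y + vec_Hs_norm M 0 T s R)))"
proof -
  note E = err_const_pos[OF assms]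
  \<comment> \<open>21 = 1 + 20: 1 from the pointwise interpolation error, and 20 = 10 * 2 from the
    stability constant and the splitting of D Y. The function decreases in T, so it is bounded on
    every half-line away from 0.\<close>
  define C' where "C' T = 21 * err_const s * (1 + 1 / sqrt T)" for T
  have C'_pos: "\<forall>T>0. 0 < C' T" using E by (auto simp: C'_def intro!: mult_pos_pos add_pos_pos)
  have C'_anti: "antimono_on {0<..} C'"
    unfolding C'_def using E by (intro monotone_onI) (auto simp: frac_le)
  show ?thesis
  proof (rule exI[of _ "2 * err_const s"], rule conjI, use E in simp, rule exI[of _ C'],
      intro conjI C'_pos C'_anti allI impI ballI)
    fix T :: real and M r N :: nat and D :: "nat \<Rightarrow> nat \<Rightarrow> real" and t :: "nat \<Rightarrow> real" and Y0 :: "nat \<Rightarrow> real"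
      and R Y Yr :: "nat \<Rightarrow> real \<Rightarrow> real" and n :: nat
    assume a: "0 < T" "1 \<le> M" "neg_semidef M (\<lambda>i j. D i j + D j i)" "1 \<le> r" "time_partition T N t"
      "ivp_solution T M D Y0 R Y" "\<forall>i<M. in_Hs 0 T s (R i)" "\<forall>i<M. in_Wsinf 0 T (1 + s) (Y i)"
      "cg_solution T N t r M D Y0 R Yr" "n \<in> {1..N}"
    then have R: "\<And>i. i < M \<Longrightarrow> in_Hs 0 T s (R i)" and Y: "\<And>i. i < M \<Longrightarrow> in_Wsinf 0 T (s + 1) (Y i)"
      by (auto simp: add.commute)
    show "L2_set (\<lambda>i. Y i (t n) - Yr i (t n)) {..<M} \<le>
         2 * err_const s * sqrt T * (max_step N t powr min (real r + 1) s / real r powr s) *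
         vec_Hs_norm M 0 T s (mat_vec M D Y)"
      by (rule error_estimates(1)[OF assms a(1,3,4,5,6) R Y a(9)]) (use a(10) in auto)
  next
    fix T :: real and M r N :: nat and D :: "nat \<Rightarrow> nat \<Rightarrow> real" and t :: "nat \<Rightarrow> real" and Y0 :: "nat \<Rightarrow> real"
      and R Y Yr :: "nat \<Rightarrow> real \<Rightarrow> real" and x :: real
    assume a: "0 < T" "1 \<le> M" "neg_semidef M (\<lambda>i j. D i j + D j i)" "1 \<le> r" "time_partition T N t"
      "ivp_solution T M D Y0 R Y" "\<forall>i<M. in_Hs 0 T s (R i)" "\<forall>i<M. in_Wsinf 0 T (1 + s) (Y i)"
      "cg_solution T N t r M D Y0 R Yr" "x \<in> {0..T}"
    then have R: "\<And>i. i < M \<Longrightarrow> in_Hs 0 T s (R i)" and Y: "\<And>i. i < M \<Longrightarrow> in_Wsinf 0 T (s + 1) (Y i)"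
      by (auto simp: add.commute)
    show "L2_set (\<lambda>i. Y i x - Yr i x) {..<M} \<le>
         C' T * (1 + sqrt T) * (max_step N t powr min (real r + 1) s / real r powr (s - 2)) *
         (sqrt T * vec_Wsinf_norm M 0 T (s + 1) Y + vec_Hs_norm M 0 T s R)"
      unfolding C'_def by (rule error_estimates(2)[OF assms a(1,3,4,5,6) R Y a(9,10)])
  qed
qed

end
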